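(* For every $b\in\mathbb{C}$, the singularity $f_0^{(0,b)}:(\mathbb{C}^2,0)\to(\mathbb{C},0)$, $f_0^{(0,b)}(x,y)=x^4+y^6+bx^2y^4$, satisfies $\lambda(f_0^{(0,b)})=1$. In particular, $\lambda(x^4+y^6)=1$.
   Context: A germ $f_0:(\mathbb{C}^n,0)\to(\mathbb{C},0)$ of a holomorphic function is an (isolated) singularity if it has an isolated critical point at $0$, i.e. some holomorphic representative on an open neighbourhood $U$ of $0$ satisfies $f_0(0)=0$, $\nabla f_0(0)=0$ and $\nabla f_0(z)\neq 0$ for $z\in U\setminus\{0\}$. Let $\mathcal{O}^n$ be the ring of germs at $0$ of holomorphic functions on $\mathbb{C}^n$. The Milnor number of a germ $g$ is $\mu(g)=\dim_{\mathbb{C}}\mathcal{O}^n/(\nabla g)$, where $(\nabla g)$ is the ideal generated by $\partial g/\partial z_1,\dots,\partial g/\partial z_n$ (so $\mu(g)=0$ if $\nabla g(0)\neq 0$). A deformation of a singularity $f_0$ is the germ of a holomorphic function $f=f(s,z):(\mathbb{C}\times\mathbb{C}^n,0)\to(\mathbb{C},0)$ such that: (1) $f(0,z)=f_0(z)$; (2) $f(s,0)=0$; (3) for each sufficiently small $|s|$, $\nabla_z f(s,z)\neq 0$ for $z\neq 0$ in a small neighbourhood of $0\in\mathbb{C}^n$. Write $f_s(z)=f(s,z)$; germs $f_s$ with $\nabla f_s(0)\ne 0$ are allowed. By upper semicontinuity, $\mu(f_s)$ is constant for all sufficiently small $s\neq 0$ and is at most $\mu(f_0)$. The jump of the deformation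 is $\lambda((f_s)):=\mu(f_0)-\mu(f_s)$ for small $s\neq0$. The jump of the Milnor number of $f_0$, denoted $\lambda(f_0)$, is the smallest nonzero value among the jumps of all deformations of $f_0$. *)

theory Defs
  imports
    "HOL-Analysis.Analysis"
    "HOL-Algebra.Algebraic_Closure_Type"
    "HOL-Library.Extended_Nat"
begin

subsection \<open>Holomorphic functions of several variables\<close>

text \<open>
  The distribution has no class of complex normed spaces, so the complex scalar multiplication
  \<open>sc\<close> of the domain is passed explicitly.  A function is holomorphic on an open set if at each of
  its points it has a Frechet derivative that is linear over the complex numbers.
\<close>

definition holomorphic_wrt ::
  "(complex \<Rightarrow> 'a \<Rightarrow> 'a) \<Rightarrow> ('a::real_normed_vector \<Rightarrow> complex) \<Rightarrow> 'a set \<Rightarrow> bool"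
where
  "holomorphic_wrt sc f U \<longleftrightarrow>
     open U \<and> (\<forall>z\<in>U. \<exists>f'. (f has_derivative f') (at z) \<and> (\<forall>c v. f' (sc c v) = c * f' v))"

definition holomorphic_germ :: "(complex^'n \<Rightarrow> complex) \<Rightarrow> bool" where
  "holomorphic_germ f \<longleftrightarrow> (\<exists>U. 0 \<in> U \<and> holomorphic_wrt (\<lambda>c v. c *s v) f U)"

definition holomorphic_germ_pair :: "(complex \<Rightarrow> complex^'n \<Rightarrow> complex) \<Rightarrow> bool" where
  "holomorphic_germ_pair f \<longleftrightarrow>
     (\<exists>U. (0, 0) \<in> U \<and>
        holomorphic_wrt (\<lambda>c p. (c * fst p, c *s snd p)) (\<lambda>p. f (fst p) (snd p)) U)"

lemma holomorphic_wrt_Int: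
  assumes "holomorphic_wrt sc f U" "holomorphic_wrt sc g V"
  shows "holomorphic_wrt sc f (U \<inter> V)" "holomorphic_wrt sc g (U \<inter> V)"
  using assms by (auto simp: holomorphic_wrt_def)

lemma holomorphic_wrt_const: "open U \<Longrightarrow> holomorphic_wrt sc (\<lambda>_. c) U"
  unfolding holomorphic_wrt_def by (auto intro!: exI[of _ "\<lambda>_. 0"] has_derivative_const)

lemma holomorphic_wrt_add:
  assumes "holomorphic_wrt sc f U" "holomorphic_wrt sc g U"
  shows "holomorphic_wrt sc (\<lambda>z. f z + g z) U"
  unfolding holomorphic_wrt_def
proof (intro conjI ballI)
  show "open U" using assms(1) by (simp add: holomorphic_wrt_def)
next
  fix z assume "z \<in> U"
  with assms(1) obtain f' where
    "(f has_derivative f') (at z)" "\<forall>c v. f' (sc c v) = c * f' v"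
    unfolding holomorphic_wrt_def by auto
  moreover from \<open>z \<in> U\<close> assms(2) obtain g' where
    "(g has_derivative g') (at z)" "\<forall>c v. g' (sc c v) = c * g' v"
    unfolding holomorphic_wrt_def by auto
  ultimately show "\<exists>h. ((\<lambda>z. f z + g z) has_derivative h) (at z) \<and> (\<forall>c v. h (sc c v) = c * h v)"
    by (intro exI[of _ "\<lambda>v. f' v + g' v"]) (auto intro: has_derivative_add simp: algebra_simps)
qed

lemma holomorphic_wrt_mult:
  assumes "holomorphic_wrt sc f U" "holomorphic_wrt sc g U"
  shows "holomorphic_wrt sc (\<lambda>z. f z * g z) U"
  unfolding holomorphic_wrt_def
proof (intro conjI ballI)
  show "open U" using assms(1) by (simp add: holomorphic_wrt_def)
next
  fix z assume "z \<in> U"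
  with assms(1) obtain f' where
    "(f has_derivative f') (at z)" "\<forall>c v. f' (sc c v) = c * f' v"
    unfolding holomorphic_wrt_def by auto
  moreover from \<open>z \<in> U\<close> assms(2) obtain g' where
    "(g has_derivative g') (at z)" "\<forall>c v. g' (sc c v) = c * g' v"
    unfolding holomorphic_wrt_def by auto
  ultimately show "\<exists>h. ((\<lambda>z. f z * g z) has_derivative h) (at z) \<and> (\<forall>c v. h (sc c v) = c * h v)"
    by (intro exI[of _ "\<lambda>v. f z * g' v + f' v * g z"])
       (auto intro: has_derivative_mult simp: algebra_simps)
qed

lemma holomorphic_germ_const: "holomorphic_germ (\<lambda>_. c)"
  unfolding holomorphic_germ_def by (intro exI[of _ UNIV]) (auto intro: holomorphic_wrt_const)

lemma holomorphic_germ_add: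
  "holomorphic_germ f \<Longrightarrow> holomorphic_germ g \<Longrightarrow> holomorphic_germ (\<lambda>z. f z + g z)"
proof -
  assume "holomorphic_germ f" "holomorphic_germ g"
  then obtain U V where "0 \<in> U" "holomorphic_wrt (\<lambda>c v. c *s v) f U"
      "0 \<in> V" "holomorphic_wrt (\<lambda>c v. c *s v) g V"
    unfolding holomorphic_germ_def by auto
  then show ?thesis
    unfolding holomorphic_germ_def
    by (intro exI[of _ "U \<inter> V"]) (simp add: holomorphic_wrt_add holomorphic_wrt_Int)
qed

lemma holomorphic_germ_mult:
  "holomorphic_germ f \<Longrightarrow> holomorphic_germ g \<Longrightarrow> holomorphic_germ (\<lambda>z. f z * g z)"
proof -
  assume "holomorphic_germ f" "holomorphic_germ g"
  then obtain U V where "0 \<in> U" "holomorphic_wrt (\<lambda>c v. c *s v) f U"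
      "0 \<in> V" "holomorphic_wrt (\<lambda>c v. c *s v) g V"
    unfolding holomorphic_germ_def by auto
  then show ?thesis
    unfolding holomorphic_germ_def
    by (intro exI[of _ "U \<inter> V"]) (simp add: holomorphic_wrt_mult holomorphic_wrt_Int)
qed

lemma holomorphic_germ_uminus: "holomorphic_germ f \<Longrightarrow> holomorphic_germ (\<lambda>z. - f z)"
  using holomorphic_germ_mult[OF holomorphic_germ_const[of "-1"], of f] by simp


subsection \<open>The ring of germs at the origin\<close>

definition germ_rel :: "(complex^'n \<Rightarrow> complex) \<Rightarrow> (complex^'n \<Rightarrow> complex) \<Rightarrow> bool" where
  "germ_rel f g \<longleftrightarrow> holomorphic_germ f \<and> holomorphic_germ g \<and> (\<forall>\<^sub>F z in nhds 0. f z = g z)"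

quotient_type 'n germ = "complex^'n \<Rightarrow> complex" / partial: germ_rel
  morphisms rep_germ germ_of
proof (rule part_equivpI)
  show "\<exists>f::complex^'n \<Rightarrow> complex. germ_rel f f"
    by (intro exI[of _ "\<lambda>_. 0"]) (simp add: germ_rel_def holomorphic_germ_const)
  show "symp (germ_rel :: (complex^'n \<Rightarrow> complex) \<Rightarrow> _)"
    by (auto simp: symp_def germ_rel_def elim: eventually_mono)
  show "transp (germ_rel :: (complex^'n \<Rightarrow> complex) \<Rightarrow> _)"
    unfolding transp_def germ_rel_def by (auto elim: eventually_elim2)
qed

instantiation germ :: (finite) comm_ring_1
begin

lift_definition zero_germ :: "'a germ" is "\<lambda>_. 0"
  by (simp add: germ_rel_def holomorphic_germ_const)

lift_definition one_germ :: "'a germ" is "\<lambda>_. 1"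
  by (simp add: germ_rel_def holomorphic_germ_const)

lift_definition plus_germ :: "'a germ \<Rightarrow> 'a germ \<Rightarrow> 'a germ" is "\<lambda>f g z. f z + g z"
  by (auto simp: germ_rel_def holomorphic_germ_add elim: eventually_elim2)

lift_definition times_germ :: "'a germ \<Rightarrow> 'a germ \<Rightarrow> 'a germ" is "\<lambda>f g z. f z * g z"
  by (auto simp: germ_rel_def holomorphic_germ_mult elim: eventually_elim2)

lift_definition uminus_germ :: "'a germ \<Rightarrow> 'a germ" is "\<lambda>f z. - f z"
  by (auto simp: germ_rel_def holomorphic_germ_uminus elim: eventually_mono)

definition minus_germ :: "'a germ \<Rightarrow> 'a germ \<Rightarrow> 'a germ" where
  "minus_germ f g = f + - g"

instance
proof
  fix a b c :: "'a germ"
  show "a * b * c = a * (b * c)"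
    by transfer (simp add: germ_rel_def holomorphic_germ_mult mult.assoc)
  show "a * b = b * a"
    by transfer (simp add: germ_rel_def holomorphic_germ_mult mult.commute)
  show "1 * a = a"
    by transfer (simp add: germ_rel_def)
  show "a + b + c = a + (b + c)"
    by transfer (simp add: germ_rel_def holomorphic_germ_add add.assoc)
  show "a + b = b + a"
    by transfer (simp add: germ_rel_def holomorphic_germ_add add.commute)
  show "0 + a = a"
    by transfer (simp add: germ_rel_def)
  show "- a + a = 0"
    by transfer (simp add: germ_rel_def holomorphic_germ_const)
  show "a - b = a + - b"
    by (rule minus_germ_def)
  show "(a + b) * c = a * c + b * c"
    by transfer (simp add: germ_rel_def holomorphic_germ_add holomorphic_germ_mult distrib_right)
  show "(0::'a germ) \<noteq> 1"
    by transfer (auto simp: germ_rel_def dest: eventually_nhds_x_imp_x)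
qed

end

abbreviation germ_ring :: "'n::finite germ ring" where
  "germ_ring \<equiv> ring_of_type_algebra"


subsection \<open>Milnor number\<close>

definition partial_deriv :: "'n \<Rightarrow> (complex^'n \<Rightarrow> complex) \<Rightarrow> complex^'n \<Rightarrow> complex" where
  "partial_deriv i f z = deriv (\<lambda>t. f (z + axis i t)) 0"

definition grad :: "(complex^'n \<Rightarrow> complex) \<Rightarrow> complex^'n \<Rightarrow> complex^'n" where
  "grad f z = (\<chi> i. partial_deriv i f z)"

definition gradient_ideal :: "(complex^'n::finite \<Rightarrow> complex) \<Rightarrow> 'n germ set" where
  "gradient_ideal g = Idl\<^bsub>germ_ring\<^esub> (range (\<lambda>i. germ_of (partial_deriv i g)))"

definition milnor_algebra :: "(complex^'n::finite \<Rightarrow> complex) \<Rightarrow> 'n germ set ring" where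
  "milnor_algebra g = germ_ring Quot gradient_ideal g"

definition milnor_scalars :: "(complex^'n::finite \<Rightarrow> complex) \<Rightarrow> 'n germ set set" where
  "milnor_scalars g = range (\<lambda>c::complex. gradient_ideal g +>\<^bsub>germ_ring\<^esub> germ_of (\<lambda>_. c))"

text \<open>
  The set below contains the dimension of the Milnor algebra over the complex numbers if that
  dimension is finite, and is empty otherwise, in which case the infimum is \<open>\<infinity>\<close>.
\<close>

definition milnor :: "(complex^'n::finite \<Rightarrow> complex) \<Rightarrow> enat" where
  "milnor g =
     Inf {enat m |m. ring.dimension (milnor_algebra g) m (milnor_scalars g)
                       (carrier (milnor_algebra g))}"


subsection \<open>Deformations and jumps\<close>

definition isolated_singularity :: "(complex^'n \<Rightarrow> complex) \<Rightarrow> bool" where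
  "isolated_singularity f \<longleftrightarrow>
     holomorphic_germ f \<and> f 0 = 0 \<and> grad f 0 = 0 \<and> (\<forall>\<^sub>F z in at 0. grad f z \<noteq> 0)"

text \<open>
  In the last condition the neighbourhood of the origin may depend on the parameter.
\<close>

definition deformation ::
  "(complex^'n \<Rightarrow> complex) \<Rightarrow> (complex \<Rightarrow> complex^'n \<Rightarrow> complex) \<Rightarrow> bool"
where
  "deformation f\<^sub>0 f \<longleftrightarrow>
     holomorphic_germ_pair f \<and>
     (\<forall>\<^sub>F z in nhds 0. f 0 z = f\<^sub>0 z) \<and>
     (\<forall>\<^sub>F s in nhds 0. f s 0 = 0) \<and>
     (\<forall>\<^sub>F s in nhds 0. \<forall>\<^sub>F z in at 0. grad (f s) z \<noteq> 0)"

text \<open>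
  Jumps are integers, so that the nonnegativity of jumps (upper semicontinuity of the Milnor
  number) is not built into the definitions.
\<close>

definition has_jump ::
  "(complex^'n::finite \<Rightarrow> complex) \<Rightarrow> (complex \<Rightarrow> complex^'n \<Rightarrow> complex) \<Rightarrow> int \<Rightarrow> bool"
where
  "has_jump f\<^sub>0 f j \<longleftrightarrow>
     (\<exists>m\<^sub>0 m. milnor f\<^sub>0 = enat m\<^sub>0 \<and> (\<forall>\<^sub>F s in at 0. milnor (f s) = enat m) \<and>
             j = int m\<^sub>0 - int m)"

definition milnor_jump :: "(complex^'n::finite \<Rightarrow> complex) \<Rightarrow> int" where
  "milnor_jump f\<^sub>0 = (LEAST j. j \<noteq> 0 \<and> (\<exists>f. deformation f\<^sub>0 f \<and> has_jump f\<^sub>0 f j))"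

end

theory Submission
  imports Defs "HOL-Complex_Analysis.Complex_Analysis"
begin

text \<open>
  The singularity is \<open>P (x, y\<^sup>2)\<close> for \<open>P (u, v) = u\<^sup>4 + v\<^sup>3 + b u\<^sup>2 v\<^sup>2\<close>, and it is deformed to
  \<open>P (x, v)\<close> with \<open>v = y\<^sup>2 + s x\<close>.  For \<open>s \<noteq> 0\<close> the functions \<open>v\<close> and \<open>y\<close> are coordinates in which
  the deformed function has leading form \<open>v\<^sup>3 + y\<^sup>8 / s\<^sup>4\<close>, so its Milnor number is 14, while that of the
  undeformed singularity is 15.  Both numbers are obtained from a monomial basis of the Milnor algebra:
  it spans because high powers of the coordinates lie in the gradient ideal, and it is independent because
  a linear functional on Taylor coefficients that annihilates the ideal pairs the basis with itself
  nondegenerately.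

  No deformation has a negative jump.  If \<open>\<mu>(f\<^sub>s) = m\<close> for all small \<open>s \<noteq> 0\<close>, then \<open>x\<^sup>m\<close> and \<open>y\<^sup>m\<close> lie in
  the gradient ideal of \<open>f\<^sub>s\<close>, so that only the Taylor coefficients of degree less than \<open>2m\<close> matter.
  These depend continuously on \<open>s\<close>, hence a spanning set of the Milnor algebra of \<open>f\<^sub>0\<close> still spans
  that of \<open>f\<^sub>s\<close>.
\<close>

subsection \<open>Holomorphic functions of two variables\<close>

text \<open>With x = (v - y^2) / s, the term x^4 contributes y^8 / s^4, and all further terms lie
  above the Newton segment from v^3 to y^8. Hence 14 = (3 - 1)(8 - 1), against 15 = (4 - 1)(6 - 1).
  In Arnold's notation the two types are W_{1,0} and E_14, whence \<open>W10\<close> and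
  \<open>E14\<close> in the names.

  Arbitrary deformations need no classification: jumps are integers, so once m \<le> 15 is known a
  nonzero jump is at least 1. The obstacle is that the comparison by linear algebra needs a
  truncation order independent of s. The definition of a jump supplies it, since m is common to all
  small s \<noteq> 0.

  Taylor coefficients are obtained by iterated division by a coordinate, not by differentiation.
  Division acts on the ring of germs, where it obeys simple algebraic rules, and it depends
  continuously on a parameter by the maximum principle. So one construction serves both the
  functionals and the semicontinuity.\<close>

definition diff_quot :: "(complex \<Rightarrow> complex) \<Rightarrow> complex \<Rightarrow> complex" where
  "diff_quot f x = (if x = 0 then deriv f 0 else (f x - f 0) / x)"

lemma diff_quot_eq: "f x = f 0 + x * diff_quot f x"
  by (simp add: diff_quot_def)

lemma diff_quot_holomorphic:
  assumes "f holomorphic_on S" "open S"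
  shows "diff_quot f holomorphic_on S"
proof -
  have "diff_quot f = (\<lambda>z. if z = 0 then deriv f 0 else (f z - f 0) / (z - 0))"
    by (auto simp: diff_quot_def)
  with pole_lemma_open[OF assms, of 0] show ?thesis by simp
qed

lemma diff_quot_cong:
  assumes "\<forall>\<^sub>F x in nhds 0. f x = g x" "f x = g x"
  shows "diff_quot f x = diff_quot g x"
  using assms deriv_cong_ev[OF assms(1) refl] eventually_nhds_x_imp_x[OF assms(1)]
  by (auto simp: diff_quot_def)

text \<open>On the circle of radius \<rho> division by z costs only the factor 1 / \<rho>, and the
  numerator is off by at most e at z and e at 0. The maximum principle carries the bound into the
  disc, including 0, where the quotient is a derivative.\<close>

lemma diff_quot_bound:
  assumes hf: "f holomorphic_on ball 0 r" and hg: "g holomorphic_on ball 0 r"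
    and "0 < \<rho>" "\<rho> < r" and le: "\<And>t. t \<in> cball 0 \<rho> \<Longrightarrow> dist (f t) (g t) \<le> e"
    and "x \<in> cball 0 \<rho>"
  shows "dist (diff_quot f x) (diff_quot g x) \<le> 2 * e / \<rho>"
proof -
  define h where "h = (\<lambda>x. diff_quot f x - diff_quot g x)"
  have hh: "h holomorphic_on ball 0 r"
    unfolding h_def using hf hg by (intro holomorphic_on_diff diff_quot_holomorphic) auto
  have "norm (h x) \<le> 2 * e / \<rho>"
  proof (rule maximum_modulus_frontier[where S = "cball 0 \<rho>" and f = h and \<xi> = x])
    show "h holomorphic_on interior (cball 0 \<rho>)"
      using hh \<open>\<rho> < r\<close> by (auto elim!: holomorphic_on_subset)
    show "continuous_on (closure (cball 0 \<rho>)) h"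
      using hh \<open>\<rho> < r\<close> by (auto intro!: holomorphic_on_imp_continuous_on elim!: holomorphic_on_subset)
    fix z :: complex assume "z \<in> frontier (cball 0 \<rho>)"
    then have z: "norm z = \<rho>" by (simp add: frontier_cball)
    then have "z \<noteq> 0" using \<open>0 < \<rho>\<close> by auto
    then have "h z = ((f z - g z) - (f 0 - g 0)) / z"
      by (simp add: h_def diff_quot_def field_simps)
    moreover have "norm ((f z - g z) - (f 0 - g 0)) \<le> e + e"
      using le[of z] le[of 0] z \<open>0 < \<rho>\<close> norm_triangle_ineq4[of "f z - g z" "f 0 - g 0"]
      by (simp add: dist_norm)
    ultimately show "norm (h z) \<le> 2 * e / \<rho>"
      using z \<open>0 < \<rho>\<close> by (simp add: norm_divide divide_right_mono)
  qed (use assms in auto)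
  then show ?thesis by (simp add: h_def dist_norm)
qed

lemma continuous_on_compact_uniformE:
  fixes F :: "'a::topological_space \<Rightarrow> 'b::topological_space \<Rightarrow> 'c::metric_space"
  assumes "continuous_on (U \<times> C) (\<lambda>(x, t). F x t)" "compact C" "x0 \<in> U" "e > 0"
  obtains X0 where "x0 \<in> X0" "open X0"
    "\<And>x t. x \<in> X0 \<inter> U \<Longrightarrow> t \<in> C \<Longrightarrow> dist (F x t) (F x0 t) \<le> e"
  by (rule continuous_on_prod_compactE[OF assms], rule that) auto

text \<open>At x = 0 continuity of quotients is of no help. Instead the increment is split: the
  change of p is controlled uniformly in x by \<open>diff_quot_bound\<close>, the change of x at the
  fixed parameter \<open>p0\<close> by holomorphy.\<close>

lemma continuous_on_diff_quot:
  fixes F :: "'p::topological_space \<Rightarrow> complex \<Rightarrow> complex"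
  assumes cont: "continuous_on (P \<times> ball 0 r) (\<lambda>(p, x). F p x)"
    and hol: "\<And>p. p \<in> P \<Longrightarrow> F p holomorphic_on ball 0 r"
  shows "continuous_on (P \<times> ball 0 r) (\<lambda>(p, x). diff_quot (F p) x)"
  unfolding continuous_on_def
proof safe
  fix p0 x0 assume p0: "p0 \<in> P" and x0: "x0 \<in> ball (0::complex) r"
  obtain \<rho> where \<rho>: "norm x0 < \<rho>" "\<rho> < r" using x0 dense by auto
  then have "0 < \<rho>" using norm_ge_zero[of x0] by linarith
  show "((\<lambda>(p, x). diff_quot (F p) x) \<longlongrightarrow> diff_quot (F p0) x0) (at (p0, x0) within P \<times> ball 0 r)"
  proof (rule tendstoI)
    fix e :: real assume "e > 0"
    \<comment> \<open>\<open>diff_quot_bound\<close> turns d into 2 d / \<rho> = e / 3, which is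
      below the share e / 2.\<close>
    define d where "d = e * \<rho> / 6"
    have "d > 0" using \<open>e > 0\<close> \<open>0 < \<rho>\<close> by (simp add: d_def)
    have "continuous_on (P \<times> cball 0 \<rho>) (\<lambda>(p, x). F p x)"
      using cont by (rule continuous_on_subset) (use \<rho> in auto)
    from continuous_on_compact_uniformE[OF this compact_cball p0 \<open>d > 0\<close>]
    obtain X0 where X0: "p0 \<in> X0" "open X0"
      "\<And>p t. p \<in> X0 \<inter> P \<Longrightarrow> t \<in> cball 0 \<rho> \<Longrightarrow> dist (F p t) (F p0 t) \<le> d"
      by blast
    have "continuous_on (ball 0 r) (diff_quot (F p0))"
      by (intro holomorphic_on_imp_continuous_on diff_quot_holomorphic hol p0) auto
    then have "isCont (diff_quot (F p0)) x0"
      using x0 continuous_on_eq_continuous_at[OF open_ball] by blast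
    then have "\<forall>\<^sub>F x in nhds x0. dist (diff_quot (F p0) x) (diff_quot (F p0) x0) < e / 2"
      using \<open>e > 0\<close> by (metis half_gt_zero isCont_def tendstoD tendsto_at_iff_tendsto_nhds)
    moreover have "\<forall>\<^sub>F x in nhds x0. x \<in> ball 0 \<rho>"
      using \<rho>(1) by (intro eventually_nhds_in_open) auto
    ultimately have ev1: "\<forall>\<^sub>F x in nhds x0. dist (diff_quot (F p0) x) (diff_quot (F p0) x0) < e / 2 \<and> x \<in> ball 0 \<rho>"
      by eventually_elim auto
    have ev2: "\<forall>\<^sub>F p in nhds p0. p \<in> X0" using X0 by (intro eventually_nhds_in_open)
    have "\<forall>\<^sub>F q in nhds p0 \<times>\<^sub>F nhds x0. fst q \<in> X0 \<and> dist (diff_quot (F p0) (snd q)) (diff_quot (F p0) x0) < e / 2 \<and> snd q \<in> ball 0 \<rho>"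
      using ev1 ev2 by (auto simp: eventually_prod_filter)
    then have "\<forall>\<^sub>F q in at (p0, x0) within P \<times> ball 0 r. fst q \<in> X0 \<and> dist (diff_quot (F p0) (snd q)) (diff_quot (F p0) x0) < e / 2 \<and> snd q \<in> ball 0 \<rho>"
      unfolding nhds_prod[symmetric] by (auto simp: eventually_at_filter elim: eventually_mono)
    moreover have "\<forall>\<^sub>F q in at (p0, x0) within P \<times> ball 0 r. q \<in> P \<times> ball 0 r"
      by (simp add: eventually_at_filter)
    ultimately show "\<forall>\<^sub>F q in at (p0, x0) within P \<times> ball 0 r.
        dist (case q of (p, x) \<Rightarrow> diff_quot (F p) x) (diff_quot (F p0) x0) < e"
    proof eventually_elim
      case (elim q)
      obtain p x where q: "q = (p, x)" by (cases q)
      have "dist (diff_quot (F p) x) (diff_quot (F p0) x) \<le> 2 * d / \<rho>"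
      proof (rule diff_quot_bound)
        show "F p holomorphic_on ball 0 r" "F p0 holomorphic_on ball 0 r"
          using elim q p0 hol by auto
        show "dist (F p t) (F p0 t) \<le> d" if "t \<in> cball 0 \<rho>" for t
          using X0(3) elim q that by auto
      qed (use elim q \<rho> \<open>0 < \<rho>\<close> in auto)
      also have "\<dots> < e / 2" using \<open>e > 0\<close> \<open>0 < \<rho>\<close> by (simp add: d_def)
      finally have "dist (diff_quot (F p) x) (diff_quot (F p0) x) < e / 2" .
      with elim q dist_triangle_half_r[of "diff_quot (F p0) x" "diff_quot (F p) x" e "diff_quot (F p0) x0"]
      show ?case by (simp add: dist_commute)
    qed
  qed
qed

text \<open>
  By Osgood's lemma, joint continuity and separate holomorphy amount to holomorphy in \<open>(x, y)\<close>.
  The parameter \<open>s\<close> is not required to enter holomorphically: continuity suffices for the semicontinuity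
  argument.
\<close>

definition hol_family ::
  "'s::topological_space set \<Rightarrow> real \<Rightarrow> ('s \<Rightarrow> complex \<Rightarrow> complex \<Rightarrow> complex) \<Rightarrow> bool"
where
  "hol_family S r F \<longleftrightarrow>
     continuous_on (S \<times> ball 0 r \<times> ball 0 r) (\<lambda>(s, x, y). F s x y) \<and>
     (\<forall>s\<in>S. \<forall>y\<in>ball 0 r. (\<lambda>x. F s x y) holomorphic_on ball 0 r) \<and>
     (\<forall>s\<in>S. \<forall>x\<in>ball 0 r. F s x holomorphic_on ball 0 r)"

lemma hol_family_swap:
  assumes "hol_family S r F" shows "hol_family S r (\<lambda>s x y. F s y x)"
proof -
  have "continuous_on (S \<times> ball 0 r \<times> ball 0 r) ((\<lambda>(s, x, y). F s x y) \<circ> (\<lambda>(s, x, y). (s, y, x)))"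
    using assms unfolding hol_family_def
    by (intro continuous_on_compose)
       (auto simp: case_prod_unfold intro!: continuous_intros elim!: continuous_on_subset)
  then show ?thesis using assms unfolding hol_family_def by (auto simp: o_def case_prod_unfold)
qed

lemma hol_family_subset:
  assumes F: "hol_family S r F" and TS: "T \<subseteq> S" and "q \<le> r"
  shows "hol_family T q F"
proof -
  have sub: "ball (0::complex) q \<subseteq> ball 0 r" using \<open>q \<le> r\<close> by auto
  have "continuous_on (T \<times> ball 0 q \<times> ball 0 q) (\<lambda>(s, x, y). F s x y)"
    by (rule continuous_on_subset[OF _ Sigma_mono[OF TS Sigma_mono[OF sub sub]]])
       (use F in \<open>simp add: hol_family_def\<close>)
  moreover have "(\<lambda>x. F s x y) holomorphic_on ball 0 q" "F s y holomorphic_on ball 0 q"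
    if "s \<in> T" "y \<in> ball 0 q" for s y
  proof -
    have s: "s \<in> S" "y \<in> ball 0 r" using that TS sub by auto
    show "(\<lambda>x. F s x y) holomorphic_on ball 0 q"
      by (rule holomorphic_on_subset[OF _ sub]) (use F s in \<open>simp add: hol_family_def\<close>)
    show "F s y holomorphic_on ball 0 q"
      by (rule holomorphic_on_subset[OF _ sub]) (use F s in \<open>simp add: hol_family_def\<close>)
  qed
  ultimately show ?thesis by (simp add: hol_family_def)
qed

lemma hol_family_compose:
  assumes "hol_family S r F" "continuous_on T c" "c ` T \<subseteq> S"
  shows "hol_family T r (\<lambda>t. F (c t))"
proof -
  have "continuous_on (T \<times> ball 0 r \<times> ball 0 r) ((\<lambda>(s, x, y). F s x y) \<circ> (\<lambda>(t, x, y). (c t, x, y)))"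
    using assms unfolding hol_family_def
    by (intro continuous_on_compose)
       (auto simp: case_prod_unfold intro!: continuous_intros continuous_on_compose2[OF assms(2)]
          elim!: continuous_on_subset)
  then show ?thesis
    using assms unfolding hol_family_def by (auto simp: o_def case_prod_unfold)
qed

lemma continuous_on_diff_quot_family:
  assumes "hol_family S r F"
  shows "continuous_on (S \<times> ball 0 r \<times> ball 0 r) (\<lambda>(s, x, y). diff_quot (\<lambda>x. F s x y) x)"
proof -
  have "continuous_on ((S \<times> ball 0 r) \<times> ball 0 r) ((\<lambda>(s, x, y). F s x y) \<circ> (\<lambda>((s, y), x). (s, x, y)))"
    using assms unfolding hol_family_def
    by (intro continuous_on_compose)
       (auto simp: case_prod_unfold intro!: continuous_intros elim!: continuous_on_subset)
  then have "continuous_on ((S \<times> ball 0 r) \<times> ball 0 r) (\<lambda>(p, x). F (fst p) x (snd p))"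
    by (simp add: o_def case_prod_unfold)
  from continuous_on_diff_quot[OF this] assms
  have *: "continuous_on ((S \<times> ball 0 r) \<times> ball 0 r) (\<lambda>(p, x). diff_quot (\<lambda>x. F (fst p) x (snd p)) x)"
    by (auto simp: hol_family_def)
  have "continuous_on (S \<times> ball 0 r \<times> ball 0 r)
     ((\<lambda>(p, x). diff_quot (\<lambda>x. F (fst p) x (snd p)) x) \<circ> (\<lambda>(s, x, y). ((s, y), x)))"
    by (intro continuous_on_compose continuous_on_subset[OF *])
       (auto simp: case_prod_unfold intro!: continuous_intros)
  then show ?thesis by (simp add: o_def case_prod_unfold)
qed

text \<open>The derivative at x = 0 is a locally uniform limit of difference quotients at nonzero
  points tending to 0, and each of these is visibly holomorphic in y. Uniformity on a closed disc in
  y comes from joint continuity of \<open>diff_quot\<close> and compactness.\<close>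

lemma deriv_holomorphic_in_parameter:
  assumes "hol_family S r F" "s \<in> S" "0 < r"
  shows "(\<lambda>y. deriv (\<lambda>x. F s x y) 0) holomorphic_on ball 0 r"
proof -
  define x where "x = (\<lambda>n::nat. of_real (r / 2) / of_nat (Suc n) :: complex)"
  have x0: "x \<longlonglongrightarrow> 0"
    unfolding x_def using lim_const_over_n by (rule LIMSEQ_Suc)
  have xn: "x n \<in> ball 0 r - {0}" for n
  proof -
    have "norm (x n) = r / 2 / real (Suc n)"
      using \<open>0 < r\<close> by (simp add: x_def norm_divide del: of_nat_Suc)
    also have "\<dots> \<le> r / 2 / 1" using \<open>0 < r\<close> by (intro divide_left_mono) auto
    finally show ?thesis using \<open>0 < r\<close> by (auto simp: x_def simp del: of_nat_Suc)
  qed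
  show ?thesis
  proof (rule holomorphic_uniform_sequence[where f = "\<lambda>n y. diff_quot (\<lambda>x. F s x y) (x n)"])
    show "(\<lambda>y. diff_quot (\<lambda>x. F s x y) (x n)) holomorphic_on ball 0 r" for n
      using assms xn[of n] unfolding hol_family_def diff_quot_def
      by (auto intro!: holomorphic_intros)
    fix y :: complex assume "y \<in> ball 0 r"
    then obtain d where d: "d > 0" "cball y d \<subseteq> ball 0 r"
      using open_contains_cball by (metis open_ball)
    have c: "continuous_on (ball 0 r \<times> cball y d) (\<lambda>(x, y). diff_quot (\<lambda>x. F s x y) x)"
    proof -
      have "continuous_on (ball 0 r \<times> cball y d)
         ((\<lambda>(s, x, y). diff_quot (\<lambda>x. F s x y) x) \<circ> (\<lambda>(x, y). (s, x, y)))"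
        using d assms
        by (intro continuous_on_compose continuous_on_subset[OF continuous_on_diff_quot_family[OF assms(1)]])
           (auto simp: case_prod_unfold intro!: continuous_intros)
      then show ?thesis by (simp add: o_def case_prod_unfold)
    qed
    have "uniform_limit (cball y d) (\<lambda>n y. diff_quot (\<lambda>x. F s x y) (x n))
        (\<lambda>y. diff_quot (\<lambda>x. F s x y) 0) sequentially"
    proof (rule uniform_limitI)
      fix e :: real assume "e > 0"
      then have "e / 2 > 0" by simp
      have "0 \<in> ball (0::complex) r" using \<open>0 < r\<close> by simp
      from continuous_on_compact_uniformE[OF c compact_cball this \<open>e / 2 > 0\<close>]
      obtain X0 where X0: "0 \<in> X0" "open X0"
        "\<And>x t. x \<in> X0 \<inter> ball 0 r \<Longrightarrow> t \<in> cball y d \<Longrightarrow>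
          dist (diff_quot (\<lambda>x. F s x t) x) (diff_quot (\<lambda>x. F s x t) 0) \<le> e / 2"
        by blast
      have "\<forall>\<^sub>F n in sequentially. x n \<in> X0" using x0 X0 by (auto dest: topological_tendstoD)
      then show "\<forall>\<^sub>F n in sequentially. \<forall>ya\<in>cball y d.
          dist (diff_quot (\<lambda>x. F s x ya) (x n)) (diff_quot (\<lambda>x. F s x ya) 0) < e"
      proof eventually_elim
        case (elim n)
        then have "x n \<in> X0 \<inter> ball 0 r" using xn[of n] by auto
        from X0(3)[OF this] \<open>e > 0\<close> show ?case by fastforce
      qed
    qed
    with d show "\<exists>d>0. cball y d \<subseteq> ball 0 r \<and>
        uniform_limit (cball y d) (\<lambda>n y. diff_quot (\<lambda>x. F s x y) (x n))
           (\<lambda>y. deriv (\<lambda>x. F s x y) 0) sequentially"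
      by (auto simp: diff_quot_def)
  qed auto
qed

lemma hol_family_diff_quot:
  assumes "hol_family S r F" "0 < r"
  shows "hol_family S r (\<lambda>s x y. diff_quot (\<lambda>x. F s x y) x)"
  unfolding hol_family_def
proof (intro conjI ballI)
  show "continuous_on (S \<times> ball 0 r \<times> ball 0 r) (\<lambda>(s, x, y). diff_quot (\<lambda>x. F s x y) x)"
    using assms(1) by (rule continuous_on_diff_quot_family)
  fix s assume s: "s \<in> S"
  show "(\<lambda>x. diff_quot (\<lambda>x. F s x y) x) holomorphic_on ball 0 r" if "y \<in> ball 0 r" for y
    using assms s that unfolding hol_family_def by (intro diff_quot_holomorphic) auto
  show "(\<lambda>y. diff_quot (\<lambda>x. F s x y) x) holomorphic_on ball 0 r" if "x \<in> ball 0 r" for x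
  proof (cases "x = 0")
    case True
    then show ?thesis
      using deriv_holomorphic_in_parameter[OF assms(1) s assms(2)] by (simp add: diff_quot_def)
  next
    case False
    then show ?thesis
      using assms s that unfolding hol_family_def diff_quot_def by (auto intro!: holomorphic_intros)
  qed
qed

text \<open>A derivative at a is the value at h = 0 of the difference quotient of the translate by
  a, so the results on division apply after recentring. The loss from r to q leaves room for the
  translation.\<close>

lemma hol_family_deriv:
  assumes "hol_family S r F" "0 < q" "q < r"
  shows "hol_family S q (\<lambda>s x y. deriv (\<lambda>x. F s x y) x)"
proof -
  define d where "d = r - q"
  have d: "d > 0" "\<And>a h::complex. norm a < q \<Longrightarrow> norm h < d \<Longrightarrow> norm (a + h) < r"
    using assms norm_add_less[of _ q _ d] unfolding d_def by auto
  have qr: "norm y < r" if "norm y < q" for y :: complex using that assms by simp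
  have shift: "deriv (\<lambda>h. F s (a + h) y) 0 = deriv (\<lambda>x. F s x y) a" for s a y
    using deriv_shift_0[of "\<lambda>x. F s x y" a] by (simp add: o_def)
  have r: "r > 0" using assms by simp
  define \<rho> where "\<rho> = min d q"
  have \<rho>: "\<rho> > 0" "\<rho> \<le> d" "\<rho> \<le> q" using d assms by (auto simp: \<rho>_def)
    have cont: "continuous_on (S \<times> ball 0 q \<times> ball 0 q) (\<lambda>(s, x, y). deriv (\<lambda>x. F s x y) x)"
    proof -
      \<comment> \<open>The triple (s, x, y) becomes the parameter, and h the variable that is
        divided out.\<close>
      have "continuous_on ((S \<times> ball 0 q \<times> ball 0 q) \<times> ball 0 \<rho>)
          ((\<lambda>(s, x, y). F s x y) \<circ> (\<lambda>((s, x, y), h). (s, x + h, y)))"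
        using assms d qr \<rho> unfolding hol_family_def
        by (intro continuous_on_compose)
           (auto simp: case_prod_unfold intro!: continuous_intros elim!: continuous_on_subset)
      then have 1: "continuous_on ((S \<times> ball 0 q \<times> ball 0 q) \<times> ball 0 \<rho>)
          (\<lambda>(p, h). F (fst p) (fst (snd p) + h) (snd (snd p)))"
        by (simp add: o_def case_prod_unfold)
      have 2: "(\<lambda>h. F s (x + h) y) holomorphic_on ball 0 \<rho>"
        if "s \<in> S" "x \<in> ball 0 q" "y \<in> ball 0 q" for s x y
      proof -
        have "(\<lambda>h. x + h) ` ball 0 \<rho> \<subseteq> ball 0 r"
          using d(2)[of x] that \<rho> by (intro image_subsetI) auto
        then have "(\<lambda>x. F s x y) \<circ> (\<lambda>h. x + h) holomorphic_on ball 0 \<rho>"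
          using assms that qr unfolding hol_family_def
          by (intro holomorphic_on_compose_gen[where t = "ball 0 r"]) (auto intro!: holomorphic_intros)
        then show ?thesis by (simp add: o_def)
      qed
      have "continuous_on ((S \<times> ball 0 q \<times> ball 0 q) \<times> ball 0 \<rho>)
          (\<lambda>(p, h). diff_quot (\<lambda>h. F (fst p) (fst (snd p) + h) (snd (snd p))) h)"
        by (rule continuous_on_diff_quot[OF 1]) (use 2 in auto)
      from continuous_on_compose2[OF this, of "S \<times> ball 0 q \<times> ball 0 q" "\<lambda>p. (p, 0)"] \<rho>
      have "continuous_on (S \<times> ball 0 q \<times> ball 0 q)
          (\<lambda>p. diff_quot (\<lambda>h. F (fst p) (fst (snd p) + h) (snd (snd p))) 0)"
        by (force intro!: continuous_intros)
      then show ?thesis by (simp add: diff_quot_def shift case_prod_unfold)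
    qed
    have hol1: "(\<lambda>x. deriv (\<lambda>x. F s x y) x) holomorphic_on ball 0 q"
      if "s \<in> S" "y \<in> ball 0 q" for s y
    proof -
      have "deriv (\<lambda>x. F s x y) holomorphic_on ball 0 r"
        using assms that qr unfolding hol_family_def by (intro holomorphic_deriv) auto
      then show ?thesis by (rule holomorphic_on_subset) (use qr in auto)
    qed
    have hol2: "(\<lambda>y. deriv (\<lambda>x. F s x y) x) holomorphic_on ball 0 q"
      if s: "s \<in> S" and x: "x \<in> ball 0 q" for s x
    proof -
      have sep: "(\<lambda>y. deriv (\<lambda>x. F s x y) x) field_differentiable at z"
        if z: "z \<in> ball 0 q" for z
      proof -
        have zr: "norm z + d \<le> r" "norm x + d \<le> r" using z x by (auto simp: d_def)
        have lt: "norm (z + h) < r" "norm (x + h) < r" if "norm h < d" for h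
          using zr that norm_triangle_ineq[of z h] norm_triangle_ineq[of x h] by auto
        \<comment> \<open>Recentring at (x, z) reduces holomorphy in y near z to
          \<open>deriv_holomorphic_in_parameter\<close> at the origin.\<close>
        have "hol_family {s} d (\<lambda>s h k. F s (x + h) (z + k))"
          unfolding hol_family_def
        proof (intro conjI ballI)
          have "continuous_on ({s} \<times> ball 0 d \<times> ball 0 d)
             ((\<lambda>(s, x, y). F s x y) \<circ> (\<lambda>(s, h, k). (s, x + h, z + k)))"
            using assms lt s unfolding hol_family_def
            by (intro continuous_on_compose)
               (auto simp: case_prod_unfold intro!: continuous_intros elim!: continuous_on_subset)
          then show "continuous_on ({s} \<times> ball 0 d \<times> ball 0 d) (\<lambda>(s, h, k). F s (x + h) (z + k))"
            by (simp add: o_def case_prod_unfold)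
          fix s' assume s': "s' \<in> {s}"
          fix w :: complex assume w: "w \<in> ball 0 d"
          have im: "(\<lambda>h. x + h) ` ball 0 d \<subseteq> ball 0 r" "(\<lambda>k. z + k) ` ball 0 d \<subseteq> ball 0 r"
            by (intro image_subsetI; use lt in simp)+
          have "(\<lambda>x. F s x (z + w)) \<circ> (\<lambda>h. x + h) holomorphic_on ball 0 d"
            using assms w lt s im unfolding hol_family_def
            by (intro holomorphic_on_compose_gen[where t = "ball 0 r"]) (auto intro!: holomorphic_intros)
          then show "(\<lambda>h. F s' (x + h) (z + w)) holomorphic_on ball 0 d" using s' by (simp add: o_def)
          have "(\<lambda>y. F s (x + w) y) \<circ> (\<lambda>k. z + k) holomorphic_on ball 0 d"
            using assms w lt s im unfolding hol_family_def
            by (intro holomorphic_on_compose_gen[where t = "ball 0 r"]) (auto intro!: holomorphic_intros)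
          then show "(\<lambda>k. F s' (x + w) (z + k)) holomorphic_on ball 0 d" using s' by (simp add: o_def)
        qed
        from deriv_holomorphic_in_parameter[OF this] d
        have h: "(\<lambda>k. deriv (\<lambda>x. F s x (z + k)) x) holomorphic_on ball 0 d" by (simp add: shift)
        have "(\<lambda>k. deriv (\<lambda>x. F s x (z + k)) x) field_differentiable at (z - z)"
          using holomorphic_on_imp_differentiable_at[OF h open_ball] d by simp
        moreover have "(\<lambda>y. y - z) field_differentiable at z" by (auto intro!: derivative_intros)
        ultimately have "(\<lambda>k. deriv (\<lambda>x. F s x (z + k)) x) \<circ> (\<lambda>y. y - z) field_differentiable at z"
          by (intro field_differentiable_compose)
        then show ?thesis by (simp add: o_def)
      qed
      then show ?thesis unfolding holomorphic_on_def
        using field_differentiable_at_within by blast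
    qed
    show ?thesis unfolding hol_family_def using cont hol1 hol2 by simp
qed

section \<open>Coordinates on \<open>complex^2\<close>, and holomorphic germs as families\<close>

definition point2 :: "complex \<Rightarrow> complex \<Rightarrow> complex^2" where
  "point2 x y = (\<chi> i. if i = 1 then x else y)"

lemma point2_nth [simp]: "point2 x y $ 1 = x" "point2 x y $ 2 = y"
  by (simp_all add: point2_def)

lemma point2_eta [simp]: "point2 (z $ 1) (z $ 2) = z"
  by (simp add: vec_eq_iff forall_2)

lemma point2_0 [simp]: "point2 0 0 = 0"
  by (simp add: vec_eq_iff forall_2)

lemma point2_add_axis:
  "point2 x y + axis 1 t = point2 (x + t) y" "point2 x y + axis 2 t = point2 x (y + t)"
  by (simp_all add: vec_eq_iff forall_2 axis_def)

lemma norm_point2_le: "norm (point2 x y) \<le> norm x + norm y"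
  using L2_set_le_sum[of UNIV "\<lambda>i. norm (point2 x y $ i)"] by (simp add: norm_vec_def sum_2)

lemma bounded_linear_point2: "bounded_linear (\<lambda>p. point2 (fst p) (snd p))"
proof -
  have "norm (point2 (fst p) (snd p)) \<le> norm p * 2" for p :: "complex \<times> complex"
    using norm_point2_le[of "fst p" "snd p"] norm_fst_le[of "fst p" "snd p"]
      norm_snd_le[of "snd p" "fst p"] by simp
  then show ?thesis
    by (intro bounded_linear_intro[where K = 2]) (auto simp: vec_eq_iff forall_2)
qed

lemma continuous_on_point2 [continuous_intros]:
  assumes "continuous_on S f" "continuous_on S g"
  shows "continuous_on S (\<lambda>x. point2 (f x) (g x))"
  using bounded_linear.continuous_on[OF bounded_linear_point2 continuous_on_Pair[OF assms]] by simp

text \<open>Along a curve with derivative \<open>sc h v\<close>, a Frechet derivative g' that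
  commutes with \<open>sc\<close> becomes multiplication by the number g' v, that is, a complex
  derivative.\<close>

lemma holomorphic_on_line:
  assumes "holomorphic_wrt sc g U" "\<And>t. t \<in> T \<Longrightarrow> \<phi> t \<in> U"
    and "\<And>t. t \<in> T \<Longrightarrow> (\<phi> has_derivative (\<lambda>h. sc h v)) (at t)"
  shows "(\<lambda>t. g (\<phi> t)) holomorphic_on T"
  unfolding holomorphic_on_def
proof
  fix t assume t: "t \<in> T"
  with assms obtain g' where g': "(g has_derivative g') (at (\<phi> t))" "\<And>c v. g' (sc c v) = c * g' v"
    unfolding holomorphic_wrt_def by blast
  have "((\<lambda>t. g (\<phi> t)) has_derivative (\<lambda>h. g' (sc h v))) (at t)"
    using has_derivative_compose[OF assms(3)[OF t] g'(1)] .
  then have "((\<lambda>t. g (\<phi> t)) has_field_derivative g' v) (at t)"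
    by (simp add: g'(2) has_field_derivative_def mult.commute[of _ "g' v"])
  then show "(\<lambda>t. g (\<phi> t)) field_differentiable at t within T"
    using field_differentiable_at_within field_differentiable_def by blast
qed

lemma holomorphic_wrt_continuous_on:
  assumes "holomorphic_wrt sc g U" shows "continuous_on U g"
  using assms unfolding holomorphic_wrt_def
  by (meson continuous_at_imp_continuous_on has_derivative_continuous)

lemma holomorphic_germ_pair_family:
  fixes f :: "complex \<Rightarrow> complex^2 \<Rightarrow> complex"
  assumes "holomorphic_germ_pair f"
  obtains r where "r > 0" "hol_family (ball 0 r) r (\<lambda>s x y. f s (point2 x y))"
proof -
  obtain U where U: "(0, 0) \<in> U"
      "holomorphic_wrt (\<lambda>c p. (c * fst p, c *s snd p)) (\<lambda>p. f (fst p) (snd p)) U"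
    using assms unfolding holomorphic_germ_pair_def by blast
  then have "open U" by (simp add: holomorphic_wrt_def)
  then obtain e where e: "e > 0" "ball (0, 0) e \<subseteq> U"
    using U(1) open_contains_ball by blast
  \<comment> \<open>The norm of \<open>(s, point2 x y)\<close> is at most |s| + |x| + |y|.\<close>
  define r where "r = e / 3"
  have r: "r > 0" using e by (simp add: r_def)
  have sub: "(s, point2 x y) \<in> U" if "norm s < r" "norm x < r" "norm y < r" for s x y
  proof -
    have "norm (s, point2 x y) \<le> norm s + norm (point2 x y)" by (rule norm_Pair_le)
    also have "\<dots> < e" using norm_point2_le[of x y] that by (simp add: r_def)
    finally show ?thesis using e by (auto simp: dist_norm zero_prod_def[symmetric])
  qed
  have "hol_family (ball 0 r) r (\<lambda>s x y. f s (point2 x y))"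
    unfolding hol_family_def
  proof (intro conjI ballI)
    have "continuous_on (ball 0 r \<times> ball 0 r \<times> ball 0 r)
       ((\<lambda>p. f (fst p) (snd p)) \<circ> (\<lambda>(s, x, y). (s, point2 x y)))"
      by (intro continuous_on_compose continuous_on_subset[OF holomorphic_wrt_continuous_on[OF U(2)]])
         (auto simp: case_prod_unfold sub intro!: continuous_intros)
    then show "continuous_on (ball 0 r \<times> ball 0 r \<times> ball 0 r) (\<lambda>(s, x, y). f s (point2 x y))"
      by (simp add: o_def case_prod_unfold)
  next
    fix s y :: complex assume s: "s \<in> ball 0 r" "y \<in> ball 0 r"
    have "(\<lambda>x. f (fst (s, point2 x y)) (snd (s, point2 x y))) holomorphic_on ball 0 r"
    proof (rule holomorphic_on_line[OF U(2)])
      fix x :: complex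
      have "((\<lambda>x. (s, point2 (fst (x, y)) (snd (x, y)))) has_derivative (\<lambda>h. (0, point2 (fst (h, 0::complex)) (snd (h, 0::complex))))) (at x)"
        by (intro has_derivative_Pair has_derivative_const has_derivative_ident
          bounded_linear.has_derivative[OF bounded_linear_point2])
      moreover have "(\<lambda>h. (0, point2 h 0)) = (\<lambda>h. (h * fst (0::complex, axis 1 1 :: complex^2), h *s snd (0::complex, axis 1 1)))"
        by (simp add: fun_eq_iff vec_eq_iff forall_2 axis_def)
      ultimately show "((\<lambda>x. (s, point2 x y)) has_derivative (\<lambda>h. (h * fst (0::complex, axis 1 1 :: complex^2), h *s snd (0::complex, axis 1 1)))) (at x)"
        by simp
    qed (use s sub in auto)
    then show "(\<lambda>x. f s (point2 x y)) holomorphic_on ball 0 r" by simp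
  next
    fix s x :: complex assume s: "s \<in> ball 0 r" "x \<in> ball 0 r"
    have "(\<lambda>y. f (fst (s, point2 x y)) (snd (s, point2 x y))) holomorphic_on ball 0 r"
    proof (rule holomorphic_on_line[OF U(2)])
      fix y :: complex
      have "((\<lambda>y. (s, point2 (fst (x, y)) (snd (x, y)))) has_derivative (\<lambda>h. (0, point2 (fst (0::complex, h)) (snd (0::complex, h))))) (at y)"
        by (intro has_derivative_Pair has_derivative_const has_derivative_ident
          bounded_linear.has_derivative[OF bounded_linear_point2])
      moreover have "(\<lambda>h. (0, point2 0 h)) = (\<lambda>h. (h * fst (0::complex, axis 2 1 :: complex^2), h *s snd (0::complex, axis 2 1)))"
        by (simp add: fun_eq_iff vec_eq_iff forall_2 axis_def)
      ultimately show "((\<lambda>y. (s, point2 x y)) has_derivative (\<lambda>h. (h * fst (0::complex, axis 2 1 :: complex^2), h *s snd (0::complex, axis 2 1)))) (at y)"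
        by simp
    qed (use s sub in auto)
    then show "(\<lambda>y. f s (point2 x y)) holomorphic_on ball 0 r" by simp
  qed
  with r show thesis by (rule that)
qed

text \<open>A single function is a family over the one-point parameter set {0}, so every lemma about
  families applies to it.\<close>

abbreviation hol2 :: "real \<Rightarrow> (complex^2 \<Rightarrow> complex) \<Rightarrow> bool" where
  "hol2 r g \<equiv> hol_family {0 :: complex} r (\<lambda>_ x y. g (point2 x y))"

lemma holomorphic_germ_imp_hol2:
  fixes g :: "complex^2 \<Rightarrow> complex"
  assumes "holomorphic_germ g"
  obtains r where "r > 0" "hol2 r g"
proof -
  obtain U where U: "0 \<in> U" "holomorphic_wrt (\<lambda>c v. c *s v) g U"
    using assms unfolding holomorphic_germ_def by blast
  have "holomorphic_wrt (\<lambda>c p. (c * fst p, c *s snd p)) (\<lambda>p. g (snd p)) (UNIV \<times> U :: (complex \<times> _) set)"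
    unfolding holomorphic_wrt_def
  proof (intro conjI ballI)
    show "open (UNIV \<times> U :: (complex \<times> _) set)"
      using U(2) by (auto simp: holomorphic_wrt_def intro: open_Times)
    fix p :: "complex \<times> (complex^2)" assume "p \<in> UNIV \<times> U"
    then obtain g' where g': "(g has_derivative g') (at (snd p))" "\<forall>c v. g' (c *s v) = c * g' v"
      using U(2) unfolding holomorphic_wrt_def by force
    have "((\<lambda>p. g (snd p)) has_derivative (\<lambda>h. g' (snd h))) (at p)"
      using bounded_linear.has_derivative[OF bounded_linear_snd has_derivative_ident] g'(1)
      by (rule has_derivative_compose)
    with g'(2) show "\<exists>f'. ((\<lambda>p. g (snd p)) has_derivative f') (at p) \<and>
        (\<forall>c v. f' (c * fst v, c *s snd v) = c * f' v)"
      by (intro exI[of _ "\<lambda>h. g' (snd h)"]) simp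
  qed
  with U(1) have "holomorphic_germ_pair (\<lambda>_. g)"
    unfolding holomorphic_germ_pair_def by (intro exI[of _ "UNIV \<times> U"]) auto
  then obtain r where r: "r > 0" "hol_family (ball 0 r) r (\<lambda>s::complex. \<lambda>x y. g (point2 x y))"
    by (rule holomorphic_germ_pair_family)
  from hol_family_compose[OF r(2), of "{0 :: complex}" "\<lambda>_. 0"] r(1) have "hol2 r g" by simp
  with r(1) show thesis by (rule that)
qed

text \<open>The partial derivatives are jointly continuous by \<open>hol_family_deriv\<close>, hence
  the function is totally differentiable, with a derivative that is complex linear by its formula.
  This direction shows that constructions done in coordinates, such as division, stay inside the
  germs.\<close>

lemma hol2_imp_holomorphic_germ:
  assumes "hol2 r g" "r > 0" shows "holomorphic_germ g"
proof -
  define q where "q = r / 2"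
  have q: "0 < q" "q < r" using assms by (auto simp: q_def)
  define gx where "gx = (\<lambda>x y. deriv (\<lambda>x. g (point2 x y)) x)"
  define gy where "gy = (\<lambda>x y. deriv (\<lambda>y. g (point2 x y)) y)"
  have "hol_family {0 :: complex} q (\<lambda>_ x y. gy x y)"
    using hol_family_swap[OF hol_family_deriv[OF hol_family_swap[OF assms(1)] q]]
    by (simp add: gy_def)
  then have "continuous_on ({0 :: complex} \<times> ball 0 q \<times> ball 0 q) (\<lambda>(s, x, y). gy x y)"
    by (simp add: hol_family_def)
  from continuous_on_compose2[OF this, of "ball 0 q \<times> ball 0 q" "\<lambda>p. (0, p)"]
  have gy: "continuous_on (ball 0 q \<times> ball 0 q) (\<lambda>(x, y). gy x y)"
    by (force intro: continuous_intros)
  define U where "U = {z :: complex^2. z $ 1 \<in> ball 0 q \<and> z $ 2 \<in> ball 0 q}"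
  have "U = (\<lambda>z. z $ 1) -` ball 0 q \<inter> (\<lambda>z. z $ 2) -` ball 0 q" by (auto simp: U_def)
  then have "open U"
    by (auto intro!: open_Int open_vimage continuous_intros)
  have der: "((\<lambda>(x, y). g (point2 x y)) has_derivative (\<lambda>(tx, ty). gx x y * tx + gy x y * ty)) (at (x, y))"
    if xy: "x \<in> ball 0 q" "y \<in> ball 0 q" for x y
  proof -
    have "((\<lambda>(x, y). g (point2 x y)) has_derivative
        (\<lambda>(tx, ty). gx x y * tx + blinfun_apply (blinfun_mult_right (gy x y)) ty))
        (at (x, y) within ball 0 q \<times> ball 0 q)"
    proof (rule has_derivative_partialsI)
      have "(\<lambda>x. g (point2 x y)) holomorphic_on ball 0 r"
        using assms xy q by (auto simp: hol_family_def)
      from holomorphic_derivI[OF this open_ball, of x] xy q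
      show "((\<lambda>x. g (point2 x y)) has_derivative (\<lambda>tx. gx x y * tx)) (at x within ball 0 q)"
        by (simp add: gx_def has_field_derivative_def has_derivative_at_withinI)
    next
      fix x y :: complex assume xy: "x \<in> ball 0 q" "y \<in> ball 0 q"
      have "(\<lambda>y. g (point2 x y)) holomorphic_on ball 0 r"
        using assms xy q by (auto simp: hol_family_def)
      from holomorphic_derivI[OF this open_ball, of y] xy q
      show "((\<lambda>y. g (point2 x y)) has_derivative blinfun_apply (blinfun_mult_right (gy x y))) (at y within ball 0 q)"
        by (simp add: gy_def has_field_derivative_def has_derivative_at_withinI)
    next
      have "continuous_on (ball 0 q \<times> ball 0 q) (\<lambda>p. blinfun_mult_right (case p of (x, y) \<Rightarrow> gy x y))"
        by (intro bounded_linear.continuous_on[OF bounded_linear_blinfun_mult_right] gy)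
      then show "continuous (at (x, y) within ball 0 q \<times> ball 0 q) (\<lambda>(x, y). blinfun_mult_right (gy x y))"
        using xy by (simp add: continuous_on_eq_continuous_within case_prod_unfold)
    qed (use xy in auto)
    moreover have "at (x, y) within ball 0 q \<times> ball 0 q = at (x, y)"
      using xy by (intro at_within_open) (auto intro: open_Times)
    ultimately show ?thesis by simp
  qed
  have "holomorphic_wrt (\<lambda>c v. c *s v) g U"
    unfolding holomorphic_wrt_def
  proof (intro conjI ballI)
    fix z assume z: "z \<in> U"
    have "((\<lambda>z. (z $ 1, z $ 2)) has_derivative (\<lambda>h. (h $ 1, h $ 2))) (at z)"
      by (intro has_derivative_Pair bounded_linear.has_derivative[OF bounded_linear_vec_nth] has_derivative_ident)
    moreover have "((\<lambda>(x, y). g (point2 x y)) has_derivative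
        (\<lambda>(tx, ty). gx (z $ 1) (z $ 2) * tx + gy (z $ 1) (z $ 2) * ty)) (at (z $ 1, z $ 2))"
      using z by (intro der) (auto simp: U_def)
    ultimately have "((\<lambda>z. (\<lambda>(x, y). g (point2 x y)) (z $ 1, z $ 2)) has_derivative
        (\<lambda>h. (\<lambda>(tx, ty). gx (z $ 1) (z $ 2) * tx + gy (z $ 1) (z $ 2) * ty) (h $ 1, h $ 2))) (at z)"
      by (rule has_derivative_compose)
    then have "(g has_derivative (\<lambda>h. gx (z $ 1) (z $ 2) * h $ 1 + gy (z $ 1) (z $ 2) * h $ 2)) (at z)"
      by simp
    then show "\<exists>f'. (g has_derivative f') (at z) \<and> (\<forall>c v. f' (c *s v) = c * f' v)"
      by (intro exI conjI) (auto simp: algebra_simps)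
  qed fact
  then show ?thesis
    unfolding holomorphic_germ_def using q by (intro exI[of _ U]) (auto simp: U_def)
qed

lemma partial_deriv_point2:
  "partial_deriv 1 f (point2 x y) = deriv (\<lambda>x. f (point2 x y)) x"
  "partial_deriv 2 f (point2 x y) = deriv (\<lambda>y. f (point2 x y)) y"
  using deriv_shift_0[of "\<lambda>x. f (point2 x y)" x] deriv_shift_0[of "\<lambda>y. f (point2 x y)" y]
  by (simp_all add: partial_deriv_def point2_add_axis o_def)

lemma hol_family_partial_deriv:
  fixes i :: 2
  assumes "hol_family S r (\<lambda>s x y. f s (point2 x y))" "0 < q" "q < r"
  shows "hol_family S q (\<lambda>s x y. partial_deriv i (f s) (point2 x y))"
  using exhaust_2[of i] hol_family_deriv[OF assms]
    hol_family_swap[OF hol_family_deriv[OF hol_family_swap[OF assms(1)] assms(2,3)]]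
  by (auto simp: partial_deriv_point2)

lemma holomorphic_germ_partial_deriv:
  fixes f :: "complex^2 \<Rightarrow> complex"
  assumes "holomorphic_germ f" shows "holomorphic_germ (partial_deriv i f)"
proof -
  obtain r where r: "r > 0" "hol2 r f" using assms by (rule holomorphic_germ_imp_hol2)
  from hol_family_partial_deriv[OF r(2), of "r / 2" i] r(1)
  have "hol2 (r / 2) (partial_deriv i f)" by simp
  then show ?thesis using r(1) by (intro hol2_imp_holomorphic_germ[of "r / 2"]) auto
qed

lemma holomorphic_germ_inverse:
  fixes f :: "complex^'n \<Rightarrow> complex"
  assumes "holomorphic_germ f" "f 0 \<noteq> 0"
  shows "holomorphic_germ (\<lambda>z. inverse (f z))"
proof -
  obtain U where U: "0 \<in> U" "holomorphic_wrt (\<lambda>c v. c *s v) f U"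
    using assms unfolding holomorphic_germ_def by blast
  define V where "V = {z \<in> U. f z \<in> - {0}}"
  have "open V"
    unfolding V_def using U(2)
    by (intro continuous_open_preimage[unfolded vimage_def Int_def mem_Collect_eq]
      holomorphic_wrt_continuous_on[OF U(2)]) (auto simp: holomorphic_wrt_def Compl_eq_Diff_UNIV)
  have "holomorphic_wrt (\<lambda>c v. c *s v) (\<lambda>z. inverse (f z)) V"
    unfolding holomorphic_wrt_def
  proof (intro conjI ballI)
    fix z assume "z \<in> V"
    then obtain f' where "f z \<noteq> 0" "(f has_derivative f') (at z)" "\<forall>c v. f' (c *s v) = c * f' v"
      using U(2) unfolding holomorphic_wrt_def V_def by blast
    then show "\<exists>h. ((\<lambda>z. inverse (f z)) has_derivative h) (at z) \<and> (\<forall>c v. h (c *s v) = c * h v)"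
      by (intro exI[of _ "\<lambda>v. - (inverse (f z) * f' v * inverse (f z))"])
         (auto intro!: has_derivative_inverse)
  qed fact
  then show ?thesis
    unfolding holomorphic_germ_def using U(1) assms(2) by (intro exI[of _ V]) (auto simp: V_def)
qed

lemma holomorphic_germ_nth: "holomorphic_germ (\<lambda>z. z $ i)"
  unfolding holomorphic_germ_def holomorphic_wrt_def
  by (intro exI[of _ UNIV] conjI ballI exI[of _ "\<lambda>z. z $ i"])
     (auto intro: bounded_linear.has_derivative[OF bounded_linear_vec_nth])

subsection \<open>Division and Taylor coefficients of germs\<close>

lift_definition const_germ :: "complex \<Rightarrow> 'n::finite germ" is "\<lambda>c _. c"
  by (simp add: germ_rel_def holomorphic_germ_const)

lift_definition var_germ :: "'n::finite \<Rightarrow> 'n germ" is "\<lambda>i (z :: complex^'n). z $ i"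
  by (simp add: germ_rel_def holomorphic_germ_nth)

lift_definition germ_value :: "'n::finite germ \<Rightarrow> complex" is "\<lambda>f :: complex^'n \<Rightarrow> complex. f 0"
  by (auto simp: germ_rel_def dest: eventually_nhds_x_imp_x)

lemma const_germ_simps [simp]:
  "const_germ 0 = 0" "const_germ 1 = 1"
  by (transfer, simp add: germ_rel_def holomorphic_germ_const)+

lemma const_germ_add: "const_germ (a + b) = const_germ a + const_germ b"
  by transfer (simp add: germ_rel_def holomorphic_germ_const)

lemma const_germ_mult: "const_germ (a * b) = const_germ a * const_germ b"
  by transfer (simp add: germ_rel_def holomorphic_germ_const)

lemma const_germ_minus: "const_germ (- a) = - const_germ a"
  by transfer (simp add: germ_rel_def holomorphic_germ_const)

lemma const_germ_diff: "const_germ (a - b) = const_germ a - const_germ b"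
  using const_germ_add[of a "- b"] by (simp add: const_germ_minus)

lemma const_germ_numeral [simp]: "const_germ (numeral k) = numeral k"
proof (induction k)
  case (Bit0 k)
  then show ?case by (simp only: numeral_Bit0 const_germ_add)
next
  case (Bit1 k)
  then show ?case by (simp only: numeral_Bit1 const_germ_add const_germ_simps)
qed simp

lemma const_germ_power: "const_germ (a ^ k) = const_germ a ^ k"
  by (induction k) (simp_all add: const_germ_mult)

lemma germ_value_simps [simp]:
  "germ_value 0 = 0" "germ_value 1 = 1" "germ_value (const_germ c) = c" "germ_value (var_germ i) = 0"
  "germ_value (g + h) = germ_value g + germ_value h" "germ_value (g * h) = germ_value g * germ_value h"
  "germ_value (- g) = - germ_value g"
  by (transfer, simp)+

lemma germ_value_diff [simp]: "germ_value (g - h) = germ_value g - germ_value h"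
  using germ_value_simps(5)[of g "- h"] by (simp del: germ_value_simps(5))

lemma germ_value_power [simp]: "germ_value (g ^ k) = germ_value g ^ k"
  by (induction k) simp_all

lemma germ_value_sum: "germ_value (\<Sum>a\<in>A. g a) = (\<Sum>a\<in>A. germ_value (g a))"
  by (induction A rule: infinite_finite_induct) simp_all

text \<open>By continuity the representative has no zero near 0, so its reciprocal is a germ: the
  ring of germs is local. This is what allows factors such as 6 - 2 b^2 y^2 to be cancelled in an
  ideal.\<close>

lemma germ_unit:
  assumes "germ_value g \<noteq> 0"
  obtains h where "g * h = 1"
proof -
  have "\<exists>h. g * h = 1" using assms
  proof transfer
    fix f :: "complex^'a \<Rightarrow> complex"
    assume f: "germ_rel f f" "f 0 \<noteq> 0"
    then have hf: "holomorphic_germ f" by (simp add: germ_rel_def)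
    then obtain U where U: "0 \<in> U" "holomorphic_wrt (\<lambda>c v. c *s v) f U"
      unfolding holomorphic_germ_def by blast
    have "isCont f 0"
      using holomorphic_wrt_continuous_on[OF U(2)] U
      by (simp add: continuous_on_eq_continuous_at holomorphic_wrt_def)
    then have "\<forall>\<^sub>F z in nhds 0. f z \<noteq> 0"
      using f(2) by (auto simp: eventually_nhds_conv_at isCont_def intro: tendsto_imp_eventually_ne)
    then have "\<forall>\<^sub>F z in nhds 0. f z * inverse (f z) = 1"
      by eventually_elim simp
    with hf f(2) show "\<exists>h\<in>{h. germ_rel h h}. germ_rel (\<lambda>z. f z * h z) (\<lambda>_. 1)"
      by (intro bexI[of _ "\<lambda>z. inverse (f z)"])
         (auto simp: germ_rel_def holomorphic_germ_inverse holomorphic_germ_mult holomorphic_germ_const)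
  qed
  then show thesis using that by blast
qed

section \<open>Division of a germ by a coordinate\<close>

definition set_coord :: "2 \<Rightarrow> complex \<Rightarrow> complex^2 \<Rightarrow> complex^2" where
  "set_coord i t z = (\<chi> j. if j = i then t else z $ j)"

lemma set_coord_point2 [simp]:
  "set_coord 1 t (point2 x y) = point2 t y" "set_coord 2 t (point2 x y) = point2 x t"
  by (simp_all add: set_coord_def vec_eq_iff forall_2)

lemma set_coord_nth [simp]: "set_coord i (z $ i) z = z" "set_coord i t z $ i = t"
  "j \<noteq> i \<Longrightarrow> set_coord i t z $ j = z $ j"
  by (simp_all add: set_coord_def vec_eq_iff)

lemma set_coord_0 [simp]: "set_coord i 0 0 = 0"
  by (simp add: set_coord_def vec_eq_iff)

lemma set_coord_idem [simp]: "set_coord i t (set_coord i u z) = set_coord i t z"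
  by (simp add: set_coord_def vec_eq_iff)

lemma set_coord_2: "j \<noteq> i \<Longrightarrow> set_coord i 0 (set_coord j 0 z) = 0"
  using exhaust_2[of i] exhaust_2[of j] by (auto simp: set_coord_def vec_eq_iff forall_2)

lemma norm_set_coord_le: "norm (set_coord i t z) \<le> norm t + norm z"
proof -
  have "set_coord i t z = axis i t + set_coord i 0 z"
    by (simp add: set_coord_def axis_def vec_eq_iff)
  moreover have "norm (axis i t) = norm t"
    using exhaust_2[of i] by (auto simp: norm_vec_def L2_set_def axis_def sum_2)
  moreover have "norm (set_coord i 0 z) \<le> norm z"
    by (simp add: norm_le_componentwise_cart set_coord_def)
  ultimately show ?thesis by (metis add_left_mono norm_triangle_ineq order_trans)
qed

text \<open>Division by the i-th coordinate looks at a function at z, at the projection of z to the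
  hyperplane z_i = 0 and, for the derivative, near that projection in the i-th direction. Agreement
  near 0 gives agreement in all three places, so quotient and remainder are well defined on
  germs.\<close>

lemma eventually_set_coord:
  assumes "\<forall>\<^sub>F z in nhds 0. P z"
  shows "\<forall>\<^sub>F z in nhds 0. P z \<and> P (set_coord i 0 z) \<and> (\<forall>\<^sub>F t in nhds 0. P (set_coord i t z))"
proof -
  obtain e where e: "e > 0" "\<And>z. norm z < e \<Longrightarrow> P z"
    using assms by (auto simp: eventually_nhds_metric)
  have ev: "\<forall>\<^sub>F t in nhds 0. P (set_coord i t z)" "P (set_coord i 0 z)" if "norm z < e / 2" for z
  proof -
    have *: "P (set_coord i t z)" if "norm t < e / 2" for t
      using that \<open>norm z < e / 2\<close> norm_set_coord_le[of i t z] by (intro e) auto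
    then show "\<forall>\<^sub>F t in nhds 0. P (set_coord i t z)" "P (set_coord i 0 z)"
      using e(1) by (auto simp: eventually_nhds_metric intro!: exI[of _ "e / 2"])
  qed
  show ?thesis
    by (subst eventually_nhds_metric, rule exI[of _ "e / 2"]) (use e ev in auto)
qed

lemma hol_family_coord_quot:
  fixes i :: 2
  assumes "hol_family S r (\<lambda>s x y. f s (point2 x y))" "r > 0"
  shows "hol_family S r (\<lambda>s x y. diff_quot (\<lambda>t. f s (set_coord i t (point2 x y))) (point2 x y $ i))"
proof -
  consider "i = 1" | "i = 2" using exhaust_2 by blast
  then show ?thesis
  proof cases
    case 1 then show ?thesis using hol_family_diff_quot[OF assms] by simp
  next
    case 2 then show ?thesis
      using hol_family_swap[OF hol_family_diff_quot[OF hol_family_swap[OF assms(1)] assms(2)]] by simp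
  qed
qed

lemma hol2_set_coord:
  assumes "hol2 r f" "r > 0"
  shows "hol2 r (\<lambda>z. diff_quot (\<lambda>t. f (set_coord i t z)) (z $ i))" "hol2 r (\<lambda>z. f (set_coord i 0 z))"
proof -
  show "hol2 r (\<lambda>z. diff_quot (\<lambda>t. f (set_coord i t z)) (z $ i))"
    using assms by (rule hol_family_coord_quot)
  have *: "hol_family S r (\<lambda>s x y. F s 0 y)" if "hol_family S r F" for F and S :: "complex set"
  proof -
    have "continuous_on (S \<times> ball 0 r \<times> ball 0 r) ((\<lambda>(s, x, y). F s x y) \<circ> (\<lambda>(s, x, y). (s, 0, y)))"
      using that \<open>r > 0\<close> unfolding hol_family_def
      by (intro continuous_on_compose)
         (auto simp: case_prod_unfold intro!: continuous_intros elim!: continuous_on_subset)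
    then show ?thesis using that \<open>r > 0\<close> unfolding hol_family_def by (auto simp: o_def case_prod_unfold)
  qed
  consider "i = 1" | "i = 2" using exhaust_2 by blast
  then show "hol2 r (\<lambda>z. f (set_coord i 0 z))"
  proof cases
    case 1 then show ?thesis using *[OF assms(1)] by simp
  next
    case 2 then show ?thesis
      using hol_family_swap[OF *[OF hol_family_swap[OF assms(1)]]] by simp
  qed
qed

lemma holomorphic_germ_set_coord:
  assumes "holomorphic_germ f"
  shows "holomorphic_germ (\<lambda>z. diff_quot (\<lambda>t. f (set_coord i t z)) (z $ i))"
    "holomorphic_germ (\<lambda>z. f (set_coord i 0 z))"
proof -
  obtain r where r: "r > 0" "hol2 r f" using assms by (rule holomorphic_germ_imp_hol2)
  from hol2_imp_holomorphic_germ[OF hol2_set_coord(1)[OF r(2,1)] r(1)]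
    hol2_imp_holomorphic_germ[OF hol2_set_coord(2)[OF r(2,1)] r(1)]
  show "holomorphic_germ (\<lambda>z. diff_quot (\<lambda>t. f (set_coord i t z)) (z $ i))"
    "holomorphic_germ (\<lambda>z. f (set_coord i 0 z))" .
qed

lift_definition coord_quot :: "2 \<Rightarrow> 2 germ \<Rightarrow> 2 germ"
  is "\<lambda>i f z. diff_quot (\<lambda>t. f (set_coord i t z)) (z $ i)"
proof -
  fix i :: 2 and f g :: "complex^2 \<Rightarrow> complex" assume "germ_rel f g"
  then have fg: "holomorphic_germ f" "holomorphic_germ g" "\<forall>\<^sub>F z in nhds 0. f z = g z"
    by (auto simp: germ_rel_def)
  from eventually_set_coord[OF fg(3), of i]
  have "\<forall>\<^sub>F z in nhds 0. diff_quot (\<lambda>t. f (set_coord i t z)) (z $ i) = diff_quot (\<lambda>t. g (set_coord i t z)) (z $ i)"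
    by eventually_elim (auto intro: diff_quot_cong)
  with fg show "germ_rel (\<lambda>z. diff_quot (\<lambda>t. f (set_coord i t z)) (z $ i))
      (\<lambda>z. diff_quot (\<lambda>t. g (set_coord i t z)) (z $ i))"
    by (simp add: germ_rel_def holomorphic_germ_set_coord)
qed

lift_definition coord_restrict :: "2 \<Rightarrow> 2 germ \<Rightarrow> 2 germ" is "\<lambda>i f z. f (set_coord i 0 z)"
proof -
  fix i :: 2 and f g :: "complex^2 \<Rightarrow> complex" assume "germ_rel f g"
  then have fg: "holomorphic_germ f" "holomorphic_germ g" "\<forall>\<^sub>F z in nhds 0. f z = g z"
    by (auto simp: germ_rel_def)
  from eventually_set_coord[OF fg(3), of i]
  have "\<forall>\<^sub>F z in nhds 0. f (set_coord i 0 z) = g (set_coord i 0 z)"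
    by eventually_elim auto
  with fg show "germ_rel (\<lambda>z. f (set_coord i 0 z)) (\<lambda>z. g (set_coord i 0 z))"
    by (simp add: germ_rel_def holomorphic_germ_set_coord)
qed

lemma germ_decomp: "g = coord_restrict i g + var_germ i * coord_quot i g"
proof transfer
  fix i :: 2 and f :: "complex^2 \<Rightarrow> complex"
  assume "germ_rel f f"
  moreover have "(\<lambda>z. f (set_coord i 0 z) + z $ i * diff_quot (\<lambda>t. f (set_coord i t z)) (z $ i)) = f"
  proof
    fix z :: "complex^2"
    show "f (set_coord i 0 z) + z $ i * diff_quot (\<lambda>t. f (set_coord i t z)) (z $ i) = f z"
      using diff_quot_eq[of "\<lambda>t. f (set_coord i t z)" "z $ i"] unfolding set_coord_nth by (rule sym)
  qed
  ultimately show "germ_rel f (\<lambda>z. f (set_coord i 0 z) + z $ i * diff_quot (\<lambda>t. f (set_coord i t z)) (z $ i))"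
    by simp
qed

text \<open>Off the hyperplane z_i = 0 the factor cancels; on it the quotient is the derivative at 0
  of t times f, which is the value of f by continuity. In particular multiplication by a coordinate
  is injective.\<close>

lemma coord_quot_var_mult [simp]: "coord_quot i (var_germ i * g) = g"
proof transfer
  fix i :: 2 and f :: "complex^2 \<Rightarrow> complex"
  assume "germ_rel f f"
  then have f: "holomorphic_germ f" by (simp add: germ_rel_def)
  then obtain U where U: "0 \<in> U" "holomorphic_wrt (\<lambda>c v. c *s v) f U"
    unfolding holomorphic_germ_def by blast
  then have "open U" by (simp add: holomorphic_wrt_def)
  then have "\<forall>\<^sub>F z in nhds 0. z \<in> U" using U by (intro eventually_nhds_in_open)
  from eventually_set_coord[OF this, of i]
  have "\<forall>\<^sub>F z in nhds 0. diff_quot (\<lambda>t. set_coord i t z $ i * f (set_coord i t z)) (z $ i) = f z"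
  proof eventually_elim
    case (elim z)
    show ?case
    proof (cases "z $ i = 0")
      case True
      then have z: "set_coord i 0 z = z" using set_coord_nth(1)[of i z] by simp
      have "isCont f z"
        using holomorphic_wrt_continuous_on[OF U(2)] elim \<open>open U\<close> continuous_on_eq_continuous_at by blast
      moreover have "continuous_on UNIV (\<lambda>t. set_coord i t z)"
      proof -
        have "continuous_on UNIV (\<lambda>t. if j = i then t else z $ j)" for j
          by (cases "j = i") auto
        then show ?thesis unfolding set_coord_def by (rule continuous_on_vec_lambda)
      qed
      then have "isCont (\<lambda>t. set_coord i t z) 0" by (simp add: continuous_on_eq_continuous_at)
      ultimately have "isCont (\<lambda>t. f (set_coord i t z)) 0"
        using z isCont_o2[of 0 "\<lambda>t. set_coord i t z" f] by simp
      then have "((\<lambda>t. f (set_coord i t z)) \<longlongrightarrow> f z) (at 0)" using z by (simp add: isCont_def)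
      then have "((\<lambda>t. t * f (set_coord i t z) / t) \<longlongrightarrow> f z) (at 0)"
        by (rule Lim_transform_eventually) (simp add: eventually_at_filter)
      then have "((\<lambda>t. t * f (set_coord i t z)) has_field_derivative f z) (at 0)"
        by (simp add: DERIV_def)
      then show ?thesis using True by (simp add: diff_quot_def DERIV_imp_deriv)
    next
      case False
      then show ?thesis by (simp add: diff_quot_def)
    qed
  qed
  with f show "germ_rel (\<lambda>z. diff_quot (\<lambda>t. set_coord i t z $ i * f (set_coord i t z)) (z $ i)) f"
    using holomorphic_germ_set_coord(1)[OF holomorphic_germ_mult[OF holomorphic_germ_nth f], of i i]
    by (simp add: germ_rel_def)
qed

lemma coord_restrict_simps [simp]:
  "coord_restrict i (g + h) = coord_restrict i g + coord_restrict i h"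
  "coord_restrict i (g * h) = coord_restrict i g * coord_restrict i h"
  "coord_restrict i (- g) = - coord_restrict i g"
  "coord_restrict i (const_germ c) = const_germ c"
  "coord_restrict i (var_germ i) = 0"
  "coord_restrict i (coord_restrict i g) = coord_restrict i g"
  by (transfer, simp add: germ_rel_def holomorphic_germ_set_coord holomorphic_germ_const
    holomorphic_germ_add holomorphic_germ_mult holomorphic_germ_uminus holomorphic_germ_nth)+

lemma coord_restrict_var: "j \<noteq> i \<Longrightarrow> coord_restrict i (var_germ j) = var_germ j"
  by transfer (simp add: germ_rel_def holomorphic_germ_nth)

lemma coord_restrict_restrict: "j \<noteq> i \<Longrightarrow> coord_restrict j (coord_restrict i g) = const_germ (germ_value g)"
  by transfer (simp add: germ_rel_def holomorphic_germ_const set_coord_2)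

lemma coord_quot_0 [simp]: "coord_quot i 0 = 0"
  using coord_quot_var_mult[of i 0] by simp

text \<open>Injectivity of multiplication by a coordinate makes the quotient in
  \<open>germ_decomp\<close> unique. The algebraic rules for division are read off from this,
  without returning to difference quotients.\<close>

lemma coord_quot_unique:
  assumes "coord_restrict i r = r" shows "coord_quot i (r + var_germ i * h) = h"
proof -
  let ?g = "r + var_germ i * h"
  have "?g = r + var_germ i * coord_quot i ?g"
    using germ_decomp[of ?g i] assms by simp
  then have "var_germ i * h = var_germ i * coord_quot i ?g" by simp
  then show ?thesis by (metis coord_quot_var_mult)
qed

lemma coord_quot_add: "coord_quot i (g + h) = coord_quot i g + coord_quot i h"
proof -
  have "g + h = (coord_restrict i g + coord_restrict i h) + var_germ i * (coord_quot i g + coord_quot i h)"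
    by (subst germ_decomp[of g i], subst germ_decomp[of h i]) (simp add: algebra_simps)
  then show ?thesis by (metis coord_quot_unique coord_restrict_simps(1,6))
qed

lemma coord_quot_mult_indep:
  assumes "coord_restrict i r = r" shows "coord_quot i (r * g) = r * coord_quot i g"
proof -
  have "r * g = r * coord_restrict i g + var_germ i * (r * coord_quot i g)"
    by (subst germ_decomp[of g i]) (simp add: algebra_simps)
  then show ?thesis using coord_quot_unique[of i "r * coord_restrict i g"] assms by simp
qed

lemma coord_quot_indep: "coord_restrict i r = r \<Longrightarrow> coord_quot i r = 0"
  using coord_quot_unique[of i r 0] by simp

lemma coord_quot_const_mult: "coord_quot i (const_germ c * g) = const_germ c * coord_quot i g"
  by (rule coord_quot_mult_indep) simp

text \<open>The Taylor coefficient at x^i y^j: the divisions bring it to the constant term. No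
  factorials occur, and multiplication by a coordinate merely shifts the indices.\<close>

definition germ_coeff :: "2 germ \<Rightarrow> nat \<Rightarrow> nat \<Rightarrow> complex" where
  "germ_coeff g i j = germ_value ((coord_quot 1 ^^ i) ((coord_quot 2 ^^ j) g))"

lemma coord_quot_pow_add: "(coord_quot i ^^ n) (g + h) = (coord_quot i ^^ n) g + (coord_quot i ^^ n) h"
  by (induction n) (simp_all add: coord_quot_add)

lemma coord_quot_pow_const_mult: "(coord_quot i ^^ n) (const_germ c * g) = const_germ c * (coord_quot i ^^ n) g"
  by (induction n) (simp_all add: coord_quot_const_mult)

lemma coord_quot_pow_var_mult:
  "j \<noteq> i \<Longrightarrow> (coord_quot i ^^ n) (var_germ j * g) = var_germ j * (coord_quot i ^^ n) g"
  by (induction n) (simp_all add: coord_quot_mult_indep coord_restrict_var)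

lemma coord_quot_pow_0 [simp]: "(coord_quot i ^^ n) 0 = 0"
  by (induction n) simp_all

lemma germ_coeff_0 [simp]: "germ_coeff 0 i j = 0"
  by (simp add: germ_coeff_def)

lemma germ_coeff_add: "germ_coeff (g + h) i j = germ_coeff g i j + germ_coeff h i j"
  by (simp add: germ_coeff_def coord_quot_pow_add)

lemma germ_coeff_const_mult: "germ_coeff (const_germ c * g) i j = c * germ_coeff g i j"
  by (simp add: germ_coeff_def coord_quot_pow_const_mult)

lemma germ_coeff_x_mult:
  "germ_coeff (var_germ 1 * g) i j = (case i of 0 \<Rightarrow> 0 | Suc i \<Rightarrow> germ_coeff g i j)"
  by (cases i) (simp_all add: germ_coeff_def coord_quot_pow_var_mult funpow_Suc_right del: funpow.simps(2))

lemma germ_coeff_y_mult: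
  "germ_coeff (var_germ 2 * g) i j = (case j of 0 \<Rightarrow> 0 | Suc j \<Rightarrow> germ_coeff g i j)"
proof (cases j)
  case 0
  have "(coord_quot 1 ^^ i) (var_germ 2 * g) = var_germ 2 * (coord_quot 1 ^^ i) g"
    by (rule coord_quot_pow_var_mult) simp
  with 0 show ?thesis by (simp add: germ_coeff_def)
qed (simp add: germ_coeff_def funpow_Suc_right del: funpow.simps(2))

lemma germ_coeff_sum: "germ_coeff (\<Sum>a\<in>A. g a) i j = (\<Sum>a\<in>A. germ_coeff (g a) i j)"
  by (induction A rule: infinite_finite_induct) (simp_all add: germ_coeff_add)

lemma germ_coeff_x_power_mult:
  "germ_coeff (var_germ 1 ^ a * g) i j = (if a \<le> i then germ_coeff g (i - a) j else 0)"
  by (induction a arbitrary: i)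
     (auto simp: germ_coeff_x_mult mult.assoc split: nat.splits)

lemma germ_coeff_y_power_mult:
  "germ_coeff (var_germ 2 ^ a * g) i j = (if a \<le> j then germ_coeff g i (j - a) else 0)"
  by (induction a arbitrary: j)
     (auto simp: germ_coeff_y_mult mult.assoc split: nat.splits)

lemma germ_coeff_const: "germ_coeff (const_germ c) i j = (if i = 0 \<and> j = 0 then c else 0)"
proof -
  have *: "(coord_quot k ^^ n) (const_germ c) = (if n = 0 then const_germ c else 0)" for k n
    by (cases n) (simp_all add: funpow_Suc_right coord_quot_indep del: funpow.simps(2))
  then show ?thesis by (simp add: germ_coeff_def)
qed

text \<open>The coordinates generate the maximal ideal: the remainder of division by x depends on y
  only, and its own remainder on division by y is the constant term.\<close>

lemma germ_split:
  fixes g :: "2 germ"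
  shows "\<exists>h k. g = const_germ (germ_value g) + var_germ 1 * h + var_germ 2 * k"
proof -
  have "coord_restrict 2 (coord_restrict 1 g) = const_germ (germ_value g)"
    by (rule coord_restrict_restrict) simp
  then have "g = const_germ (germ_value g) + var_germ 2 * coord_quot 2 (coord_restrict 1 g)
      + var_germ 1 * coord_quot 1 g"
    using germ_decomp[of "coord_restrict 1 g" 2] germ_decomp[of g 1] by metis
  then show ?thesis by (metis add.assoc add.commute)
qed

subsection \<open>Dimensions of quotients of the ring of germs\<close>

text \<open>Going through the list, a vector in the span of the later ones is dropped.\<close>

lemma (in ring) Span_base_le:
  assumes K: "subfield K R" and "set Us \<subseteq> carrier R"
  obtains Vs where "independent K Vs" "Span K Vs = Span K Us" "length Vs \<le> length Us"
proof -
  have "\<exists>Vs. independent K Vs \<and> Span K Vs = Span K Us \<and> length Vs \<le> length Us"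
    using assms(2)
  proof (induction Us)
    case Nil
    then show ?case by (intro exI[of _ "[]"]) simp
  next
    case (Cons u Us)
    then obtain Vs where Vs: "independent K Vs" "Span K Vs = Span K Us" "length Vs \<le> length Us"
      by auto
    show ?case
    proof (cases "u \<in> Span K Us")
      case True
      then have "set (u # Us) \<subseteq> Span K Us" using Span_base_incl[OF K] Cons.prems by auto
      then have "Span K (u # Us) = Span K Us"
        using mono_Span_subset[OF K, of "u # Us" Us] mono_Span[OF K, of Us u] Cons.prems by auto
      with Vs show ?thesis by (intro exI[of _ Vs]) simp
    next
      case False
      with Vs Cons.prems have "independent K (u # Vs)" by (intro li_Cons) auto
      with Vs show ?thesis by (intro exI[of _ "u # Vs"]) simp
    qed
  qed
  then show thesis using that by blast
qed

section \<open>Ideals with two generators\<close>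

definition ideal_gen2 :: "'a::comm_ring_1 \<Rightarrow> 'a \<Rightarrow> 'a set" where
  "ideal_gen2 p q = {a * p + b * q | a b. True}"

lemma germ_ring_simps [simp]:
  "carrier germ_ring = UNIV" "x \<otimes>\<^bsub>germ_ring\<^esub> y = x * y" "\<one>\<^bsub>germ_ring\<^esub> = 1" "\<zero>\<^bsub>germ_ring\<^esub> = 0"
  "x \<oplus>\<^bsub>germ_ring\<^esub> y = x + y"
  by (simp_all add: ring_of_type_algebra_def)

interpretation G: cring "germ_ring :: 'n::finite germ ring"
  by (rule cring_from_type_algebra)

lemma germ_ring_a_inv [simp]: "\<ominus>\<^bsub>germ_ring\<^esub> x = - (x :: 'n::finite germ)"
  using G.l_neg[of x] by (simp add: eq_neg_iff_add_eq_0)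

lemma germ_ring_a_minus [simp]: "x \<ominus>\<^bsub>germ_ring\<^esub> y = x - (y :: 'n::finite germ)"
  by (simp add: a_minus_def)

lemma ideal_gen2_mem: "p \<in> ideal_gen2 p q" "q \<in> ideal_gen2 p q"
proof -
  have "p = 1 * p + 0 * q" "q = 0 * p + 1 * q" by simp_all
  then show "p \<in> ideal_gen2 p q" "q \<in> ideal_gen2 p q" unfolding ideal_gen2_def by blast+
qed

lemma ideal_gen2_closed:
  "0 \<in> ideal_gen2 p q"
  "g \<in> ideal_gen2 p q \<Longrightarrow> h \<in> ideal_gen2 p q \<Longrightarrow> g + h \<in> ideal_gen2 p q"
  "g \<in> ideal_gen2 p q \<Longrightarrow> h * g \<in> ideal_gen2 p q"
proof -
  have "0 = 0 * p + 0 * q" by simp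
  then show "0 \<in> ideal_gen2 p q" unfolding ideal_gen2_def by blast
next
  assume "g \<in> ideal_gen2 p q" "h \<in> ideal_gen2 p q"
  then obtain a b c d where "g = a * p + b * q" "h = c * p + d * q" by (auto simp: ideal_gen2_def)
  then have "g + h = (a + c) * p + (b + d) * q" by (simp add: algebra_simps)
  then show "g + h \<in> ideal_gen2 p q" unfolding ideal_gen2_def by blast
next
  assume "g \<in> ideal_gen2 p q"
  then obtain a b where "g = a * p + b * q" by (auto simp: ideal_gen2_def)
  then have "h * g = (h * a) * p + (h * b) * q" by (simp add: algebra_simps)
  then show "h * g \<in> ideal_gen2 p q" unfolding ideal_gen2_def by blast
qed

lemma ideal_ideal_gen2: "ideal (ideal_gen2 p q) (germ_ring :: 'n::finite germ ring)"
proof (rule idealI)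
  show "ring (germ_ring :: 'n germ ring)" by (rule G.ring_axioms)
  have "- g \<in> ideal_gen2 p q" if "g \<in> ideal_gen2 p q" for g :: "'n germ"
    using ideal_gen2_closed(3)[OF that, of "-1"] by simp
  moreover have "inv\<^bsub>add_monoid germ_ring\<^esub> g = - g" for g :: "'n germ"
    using germ_ring_a_inv[of g] by (simp only: a_inv_def)
  moreover have "x \<otimes>\<^bsub>add_monoid germ_ring\<^esub> y = x + y" for x y :: "'n germ" by simp
  ultimately show "subgroup (ideal_gen2 p q) (add_monoid (germ_ring :: 'n germ ring))"
    using ideal_gen2_mem(1)[of p q] ideal_gen2_closed(1,2)[where p = p and q = q]
    by (intro group.subgroupI G.a_group) (auto simp only: partial_object.simps germ_ring_simps)
next
  fix a x :: "'n germ" assume a: "a \<in> ideal_gen2 p q"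
  then show "x \<otimes>\<^bsub>germ_ring\<^esub> a \<in> ideal_gen2 p q" by (simp add: ideal_gen2_closed)
  from a show "a \<otimes>\<^bsub>germ_ring\<^esub> x \<in> ideal_gen2 p q"
    using ideal_gen2_closed(3)[of a p q x] by (simp add: mult.commute)
qed

lemma gradient_ideal_2:
  fixes f :: "complex^2 \<Rightarrow> complex"
  shows "gradient_ideal f = ideal_gen2 (germ_of (partial_deriv 1 f)) (germ_of (partial_deriv 2 f))"
    (is "_ = ideal_gen2 ?p ?q")
proof -
  have r: "range (\<lambda>i. germ_of (partial_deriv i f)) = {?p, ?q}"
    using exhaust_2 by (auto simp: image_iff) metis
  have "Idl\<^bsub>germ_ring\<^esub> {?p, ?q} = ideal_gen2 ?p ?q"
  proof
    show "Idl\<^bsub>germ_ring\<^esub> {?p, ?q} \<subseteq> ideal_gen2 ?p ?q"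
      by (intro G.genideal_minimal ideal_ideal_gen2) (simp add: ideal_gen2_mem)
    interpret J: ideal "Idl\<^bsub>germ_ring\<^esub> {?p, ?q}" "germ_ring :: 2 germ ring"
      by (rule G.genideal_ideal) simp
    have "{?p, ?q} \<subseteq> Idl\<^bsub>germ_ring\<^esub> {?p, ?q}" by (rule G.genideal_self) simp
    then have "a * ?p + b * ?q \<in> Idl\<^bsub>germ_ring\<^esub> {?p, ?q}" for a b
      using J.I_l_closed[of ?p a] J.I_l_closed[of ?q b] J.a_closed by simp
    then show "ideal_gen2 ?p ?q \<subseteq> Idl\<^bsub>germ_ring\<^esub> {?p, ?q}" by (auto simp: ideal_gen2_def)
  qed
  with r show ?thesis by (simp add: gradient_ideal_def)
qed

lemma subfield_const_germ: "subfield (range const_germ) (germ_ring :: 'n::finite germ ring)"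
proof (rule G.subfieldI)
  show "subcring (range const_germ) (germ_ring :: 'n germ ring)"
  proof (intro G.subcringI G.subringI)
    show "\<one>\<^bsub>germ_ring\<^esub> \<in> range (const_germ :: _ \<Rightarrow> 'n germ)"
      using range_eqI[of _ const_germ 1] by simp
  qed (auto simp: mult.commute simp flip: const_germ_add const_germ_mult const_germ_minus)
  have inv: "const_germ c * const_germ (inverse c) = (1 :: 'n germ)" if "c \<noteq> 0" for c
    using that by (simp flip: const_germ_mult)
  have inj: "const_germ c = (0 :: 'n germ) \<longleftrightarrow> c = 0" for c
    by (metis germ_value_simps(1,3) const_germ_simps(1))
  show "Units (germ_ring\<lparr>carrier := range const_germ\<rparr>) = range const_germ - {\<zero>\<^bsub>germ_ring :: 'n germ ring\<^esub>}"
    using inv by (auto simp: Units_def inj mult.commute) blast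
qed

section \<open>Linear algebra over the constants in a quotient of the ring of germs\<close>

locale germ_quotient =
  fixes I :: "'n::finite germ set"
  assumes I: "ideal I germ_ring"
begin

sublocale I: ideal I germ_ring by (rule I)

abbreviation "Q \<equiv> germ_ring Quot I"
abbreviation "K \<equiv> range (\<lambda>c. I +>\<^bsub>germ_ring\<^esub> const_germ c)"
abbreviation \<pi> where "\<pi> g \<equiv> I +>\<^bsub>germ_ring\<^esub> g"

sublocale Q: ring Q by (rule I.quotient_is_ring)

sublocale hom: ring_hom_ring germ_ring Q \<pi> by (rule I.rcos_ring_hom_ring)

lemma pi_eq_iff: "\<pi> g = \<pi> h \<longleftrightarrow> g - h \<in> I"
  using G.quotient_eq_iff_same_a_r_cos[OF I, of g h] by auto

lemma pi_eq_zero_iff: "\<pi> g = \<zero>\<^bsub>Q\<^esub> \<longleftrightarrow> g \<in> I"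
  using pi_eq_iff[of g 0] hom.hom_zero by simp

lemma carrier_Q: "carrier Q = range \<pi>"
  by (auto simp: FactRing_def A_RCOSETS_def' )

text \<open>In the zero ring the constants collapse to a point and form no field. The case 1 \<in>
  I, which arises from a nonzero gradient at 0, is therefore treated apart in
  \<open>dimension_0\<close>.\<close>

lemma subfield_K:
  assumes "1 \<notin> I" shows "subfield K Q"
proof -
  have "\<one>\<^bsub>Q\<^esub> \<noteq> \<zero>\<^bsub>Q\<^esub>" using assms pi_eq_zero_iff[of 1] hom.hom_one by simp
  from hom.img_is_subfield(2)[OF subfield_const_germ this] show ?thesis
    by (simp add: image_image)
qed

lemma combine_pi:
  "Q.combine (map (\<lambda>a. \<pi> (const_germ (c a))) xs) (map (\<lambda>a. \<pi> (b a)) xs) =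
     \<pi> (\<Sum>a\<leftarrow>xs. const_germ (c a) * b a)"
proof (induction xs)
  case Nil
  then show ?case using hom.hom_zero by simp
next
  case (Cons a xs)
  then show ?case
    using hom.hom_add[of "const_germ (c a) * b a" "\<Sum>a\<leftarrow>xs. const_germ (c a) * b a"]
      hom.hom_mult[of "const_germ (c a)" "b a"] by simp
qed

text \<open>A list of scalars becomes a function of the index; as the indices are distinct, the
  value at the head can be set without disturbing the tail.\<close>

lemma K_list:
  assumes "set Ks \<subseteq> K" "distinct xs" "length Ks = length xs"
  obtains c where "Ks = map (\<lambda>a. \<pi> (const_germ (c a))) xs"
proof -
  have "\<exists>c. Ks = map (\<lambda>a. \<pi> (const_germ (c a))) xs"
    using assms
  proof (induction xs arbitrary: Ks)
    case (Cons a xs)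
    then obtain k Ks' where Ks: "Ks = k # Ks'" by (cases Ks) auto
    with Cons obtain c where c: "Ks' = map (\<lambda>a. \<pi> (const_germ (c a))) xs" by force
    from Ks Cons.prems obtain d where d: "k = \<pi> (const_germ d)" by auto
    have "Ks = map (\<lambda>b. \<pi> (const_germ ((c(a := d)) b))) (a # xs)"
      using Ks c d Cons.prems by auto
    then show ?case by blast
  qed simp
  then show thesis using that by blast
qed

lemma Span_pi:
  assumes "1 \<notin> I" "distinct xs"
  shows "Q.Span K (map (\<lambda>a. \<pi> (b a)) xs) = {\<pi> (\<Sum>a\<in>set xs. const_germ (c a) * b a) | c. True}"
proof -
  have s: "set (map (\<lambda>a. \<pi> (b a)) xs) \<subseteq> carrier Q" by (auto simp: carrier_Q)
  have "{Q.combine Ks (map (\<lambda>a. \<pi> (b a)) xs) |Ks. length Ks = length (map (\<lambda>a. \<pi> (b a)) xs) \<and> set Ks \<subseteq> K}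
     = {\<pi> (\<Sum>a\<in>set xs. const_germ (c a) * b a) | c. True}" (is "?L = ?R")
  proof
    show "?L \<subseteq> ?R"
    proof
      fix v assume "v \<in> ?L"
      then obtain Ks where Ks: "length Ks = length xs" "set Ks \<subseteq> K"
        "v = Q.combine Ks (map (\<lambda>a. \<pi> (b a)) xs)" by auto
      from K_list[OF Ks(2) assms(2) Ks(1)] obtain c where "Ks = map (\<lambda>a. \<pi> (const_germ (c a))) xs" .
      with Ks(3) assms(2) show "v \<in> ?R"
        by (auto simp: combine_pi sum_list_distinct_conv_sum_set)
    qed
    show "?R \<subseteq> ?L"
    proof
      fix v assume "v \<in> ?R"
      then obtain c where "v = \<pi> (\<Sum>a\<in>set xs. const_germ (c a) * b a)" by blast
      then have "v = Q.combine (map (\<lambda>a. \<pi> (const_germ (c a))) xs) (map (\<lambda>a. \<pi> (b a)) xs)"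
        using assms(2) by (simp add: combine_pi sum_list_distinct_conv_sum_set)
      then show "v \<in> ?L" by (auto intro!: exI[of _ "map (\<lambda>a. \<pi> (const_germ (c a))) xs"])
    qed
  qed
  then show ?thesis using Q.Span_eq_combine_set_length_version[OF subfield_K[OF assms(1)] s] by simp
qed

lemma Span_pi_eq_carrier:
  assumes "1 \<notin> I" "distinct xs" "\<And>g. \<exists>c. g - (\<Sum>a\<in>set xs. const_germ (c a) * b a) \<in> I"
  shows "Q.Span K (map (\<lambda>a. \<pi> (b a)) xs) = carrier Q"
  unfolding Span_pi[OF assms(1,2)] carrier_Q using assms(3) pi_eq_iff by (auto simp: image_iff)

lemma dimension_eq:
  assumes "finite A" "1 \<notin> I"
    and span: "\<And>g. \<exists>c. g - (\<Sum>a\<in>A. const_germ (c a) * b a) \<in> I"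
    and indep: "\<And>c a. (\<Sum>a\<in>A. const_germ (c a) * b a) \<in> I \<Longrightarrow> a \<in> A \<Longrightarrow> c a = 0"
  shows "Q.dimension (card A) K (carrier Q)"
proof -
  obtain xs where xs: "set xs = A" "distinct xs" using assms(1) finite_distinct_list by blast
  let ?Us = "map (\<lambda>a. \<pi> (b a)) xs"
  have "Q.independent K ?Us"
  proof (rule ccontr)
    assume "\<not> Q.independent K ?Us"
    moreover have "set ?Us \<subseteq> carrier Q" by (auto simp: carrier_Q)
    ultimately obtain Ks where Ks: "length Ks = length ?Us" "Q.combine Ks ?Us = \<zero>\<^bsub>Q\<^esub>" "set Ks \<subseteq> K"
        "set Ks \<noteq> {\<zero>\<^bsub>Q\<^esub>}"
      using Q.dependent_imp_non_trivial_combine[OF subfield_K[OF assms(2)]] by metis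
    from K_list[OF Ks(3) xs(2)] Ks(1) obtain c where c: "Ks = map (\<lambda>a. \<pi> (const_germ (c a))) xs"
      by auto
    with Ks(2) xs have "(\<Sum>a\<in>A. const_germ (c a) * b a) \<in> I"
      by (simp add: combine_pi sum_list_distinct_conv_sum_set pi_eq_zero_iff)
    then have "c a = 0" if "a \<in> set xs" for a using indep that xs by blast
    then have "set Ks \<subseteq> {\<zero>\<^bsub>Q\<^esub>}" using c hom.hom_zero by auto
    \<comment> \<open>All scalars vanish, yet their set is not {0}: only the empty list is left, and
      that is independent.\<close>
    with Ks(4) have "set Ks = {}" using subset_singletonD by metis
    then have "xs = []" using c by simp
    with \<open>\<not> Q.independent K ?Us\<close> show False by simp
  qed
  from Q.dimensionI[OF subfield_K[OF assms(2)] this Span_pi_eq_carrier[OF assms(2) xs(2)]] span xs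
  show ?thesis by (simp add: distinct_card[symmetric])
qed

lemma dimension_le:
  assumes "finite A" "1 \<notin> I" and dim: "Q.dimension m K (carrier Q)"
    and span: "\<And>g. \<exists>c. g - (\<Sum>a\<in>A. const_germ (c a) * b a) \<in> I"
  shows "m \<le> card A"
proof -
  obtain xs where xs: "set xs = A" "distinct xs" using assms(1) finite_distinct_list by blast
  let ?Us = "map (\<lambda>a. \<pi> (b a)) xs"
  have "set ?Us \<subseteq> carrier Q" by (auto simp: carrier_Q)
  from Q.Span_base_le[OF subfield_K[OF assms(2)] this] obtain Vs where Vs:
    "Q.independent K Vs" "Q.Span K Vs = Q.Span K ?Us" "length Vs \<le> length ?Us" .
  have "Q.Span K ?Us = carrier Q" using Span_pi_eq_carrier[OF assms(2) xs(2)] span xs by simp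
  with Vs have "Q.dimension (length Vs) K (carrier Q)"
    using Q.dimensionI[OF subfield_K[OF assms(2)]] by metis
  then have "m = length Vs" using Q.dimension_is_inj[OF subfield_K[OF assms(2)]] dim by metis
  with Vs(3) xs show ?thesis by (simp add: distinct_card[symmetric])
qed

lemma dependent_if_dimension_less:
  assumes "finite A" "1 \<notin> I" and dim: "Q.dimension m K (carrier Q)" and "m < card A"
  obtains c a where "(\<Sum>a\<in>A. const_germ (c a) * b a) \<in> I" "a \<in> A" "c a \<noteq> 0"
proof -
  obtain xs where xs: "set xs = A" "distinct xs" using assms(1) finite_distinct_list by blast
  let ?Us = "map (\<lambda>a. \<pi> (b a)) xs"
  have s: "set ?Us \<subseteq> carrier Q" by (auto simp: carrier_Q)
  then have "\<not> Q.independent K ?Us"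
    using Q.independent_length_le_dimension[OF subfield_K[OF assms(2)] dim, of ?Us] assms(4) xs
    by (auto simp: distinct_card[symmetric])
  with s obtain Ks where Ks: "length Ks = length ?Us" "Q.combine Ks ?Us = \<zero>\<^bsub>Q\<^esub>" "set Ks \<subseteq> K"
      "set Ks \<noteq> {\<zero>\<^bsub>Q\<^esub>}"
    using Q.dependent_imp_non_trivial_combine[OF subfield_K[OF assms(2)]] by metis
  from K_list[OF Ks(3) xs(2)] Ks(1) obtain c where c: "Ks = map (\<lambda>a. \<pi> (const_germ (c a))) xs"
    by auto
  with Ks(2) xs have 1: "(\<Sum>a\<in>A. const_germ (c a) * b a) \<in> I"
    by (simp add: combine_pi sum_list_distinct_conv_sum_set pi_eq_zero_iff)
  have "\<exists>a\<in>A. c a \<noteq> 0"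
  proof (rule ccontr)
    assume "\<not> (\<exists>a\<in>A. c a \<noteq> 0)"
    then have "set Ks \<subseteq> {\<zero>\<^bsub>Q\<^esub>}" using c xs hom.hom_zero by auto
    with Ks(4) have "set Ks = {}" using subset_singletonD by metis
    with Ks(1) xs assms(4) show False by (auto simp: distinct_card[symmetric])
  qed
  with 1 show thesis using that by blast
qed

lemma dimension_0:
  assumes "1 \<in> I" shows "Q.dimension 0 K (carrier Q)"
proof -
  have "g \<in> I" for g using I.I_l_closed[OF assms, of g] by simp
  then have "carrier Q = {\<zero>\<^bsub>Q\<^esub>}" using pi_eq_zero_iff by (auto simp: carrier_Q)
  then show ?thesis by simp
qed

end

lemma const_germ_eq: "germ_of (\<lambda>_. c) = const_germ c"
  by (simp add: const_germ.abs_eq)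

text \<open>Dimension over a subfield is unique, so the set whose infimum defines
  \<open>milnor\<close> is a singleton.\<close>

lemma milnor_eqI:
  fixes f :: "complex^2 \<Rightarrow> complex"
  defines "I \<equiv> gradient_ideal f"
  assumes "finite A" "1 \<notin> I"
    and "\<And>g. \<exists>c. g - (\<Sum>a\<in>A. const_germ (c a) * b a) \<in> I"
    and "\<And>c a. (\<Sum>a\<in>A. const_germ (c a) * b a) \<in> I \<Longrightarrow> a \<in> A \<Longrightarrow> c a = 0"
  shows "milnor f = enat (card A)"
proof -
  interpret germ_quotient I by (rule germ_quotient.intro) (simp add: I_def gradient_ideal_2 ideal_ideal_gen2)
  have d: "Q.dimension (card A) K (carrier Q)" by (rule dimension_eq) (use assms in auto)
  then have "{enat m |m. Q.dimension m K (carrier Q)} = {enat (card A)}"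
    using Q.dimension_is_inj[OF subfield_K[OF assms(3)]] by blast
  then show ?thesis
    by (simp add: milnor_def milnor_algebra_def milnor_scalars_def I_def const_germ_eq)
qed

text \<open>A finite infimum in \<open>enat\<close> comes from a nonempty set and is attained
  there.\<close>

lemma milnor_eq_enatD:
  fixes f :: "complex^2 \<Rightarrow> complex"
  assumes "milnor f = enat m"
  shows "ring.dimension (germ_ring Quot gradient_ideal f) m
    (range (\<lambda>c. gradient_ideal f +>\<^bsub>germ_ring\<^esub> const_germ c)) (carrier (germ_ring Quot gradient_ideal f))"
proof -
  let ?S = "{enat m |m. ring.dimension (milnor_algebra f) m (milnor_scalars f) (carrier (milnor_algebra f))}"
  have "?S \<noteq> {}" using assms by (auto simp: milnor_def Inf_enat_def split: if_splits)
  then have "Inf ?S \<in> ?S" by (auto simp: Inf_enat_def intro: LeastI)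
  with assms show ?thesis
    by (auto simp: milnor_def milnor_algebra_def milnor_scalars_def const_germ_eq)
qed

definition germ_subspace :: "'n::finite germ set \<Rightarrow> bool" where
  "germ_subspace W \<longleftrightarrow> 0 \<in> W \<and> (\<forall>g\<in>W. \<forall>h\<in>W. g + h \<in> W) \<and> (\<forall>c. \<forall>g\<in>W. const_germ c * g \<in> W)"

lemma germ_subspaceD:
  assumes "germ_subspace W"
  shows "0 \<in> W" "g \<in> W \<Longrightarrow> h \<in> W \<Longrightarrow> g + h \<in> W" "g \<in> W \<Longrightarrow> const_germ c * g \<in> W"
    "g \<in> W \<Longrightarrow> - g \<in> W" "g \<in> W \<Longrightarrow> h \<in> W \<Longrightarrow> g - h \<in> W"
proof -
  show 1: "0 \<in> W" "g \<in> W \<Longrightarrow> h \<in> W \<Longrightarrow> g + h \<in> W" "g \<in> W \<Longrightarrow> const_germ c * g \<in> W" for g h c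
    using assms by (auto simp: germ_subspace_def)
  show 2: "g \<in> W \<Longrightarrow> - g \<in> W" for g
    using 1(3)[of g "-1"] by (simp add: const_germ_minus)
  show "g \<in> W \<Longrightarrow> h \<in> W \<Longrightarrow> g - h \<in> W"
    using 1(2)[of g "- h"] 2[of h] by simp
qed

lemma germ_subspace_cancel:
  assumes "germ_subspace W" "const_germ c * g \<in> W" "c \<noteq> 0" shows "g \<in> W"
proof -
  have "const_germ (inverse c) * (const_germ c * g) = g"
    using assms(3) by (simp add: mult.assoc[symmetric] flip: const_germ_mult)
  then show ?thesis using germ_subspaceD(3)[OF assms(1,2), of "inverse c"] by simp
qed

lemma germ_subspace_cancel_numeral:
  "germ_subspace W \<Longrightarrow> numeral k * g \<in> W \<Longrightarrow> g \<in> W"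
  using germ_subspace_cancel[of W "numeral k" g] by simp

lemma germ_subspace_ideal_gen2: "germ_subspace (ideal_gen2 p q)"
  by (simp add: germ_subspace_def ideal_gen2_closed)

text \<open>The full preimage, in the ring of germs, of the span of the classes of
  \<open>b a\<close> modulo I. Spanning can thus be proved with germs in place of cosets.\<close>

definition span_mod :: "'n::finite germ set \<Rightarrow> 'k set \<Rightarrow> ('k \<Rightarrow> 'n germ) \<Rightarrow> 'n germ set" where
  "span_mod I A b = {g. \<exists>c. g - (\<Sum>a\<in>A. const_germ (c a) * b a) \<in> I}"

lemma germ_subspace_span_mod:
  assumes "germ_subspace I" shows "germ_subspace (span_mod I A b)"
proof -
  note I = germ_subspaceD[OF assms]
  have "0 \<in> span_mod I A b"
    using I(1) by (auto simp: span_mod_def intro!: exI[of _ "\<lambda>_. 0"])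
  moreover have "g + h \<in> span_mod I A b" if gh: "g \<in> span_mod I A b" "h \<in> span_mod I A b" for g h
  proof -
    obtain c d where "g - (\<Sum>a\<in>A. const_germ (c a) * b a) \<in> I" "h - (\<Sum>a\<in>A. const_germ (d a) * b a) \<in> I"
      using gh by (auto simp: span_mod_def)
    from I(2)[OF this] have "g + h - (\<Sum>a\<in>A. const_germ (c a + d a) * b a) \<in> I"
      by (simp add: const_germ_add algebra_simps sum.distrib)
    then show ?thesis unfolding span_mod_def by (intro CollectI exI[of _ "\<lambda>a. c a + d a"])
  qed
  moreover have "const_germ e * g \<in> span_mod I A b" if g: "g \<in> span_mod I A b" for g e
  proof -
    obtain c where "g - (\<Sum>a\<in>A. const_germ (c a) * b a) \<in> I"
      using g by (auto simp: span_mod_def)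
    from I(3)[OF this, of e] have "const_germ e * g - (\<Sum>a\<in>A. const_germ (e * c a) * b a) \<in> I"
      by (simp add: const_germ_mult algebra_simps sum_distrib_left)
    then show ?thesis unfolding span_mod_def by (intro CollectI exI[of _ "\<lambda>a. e * c a"])
  qed
  ultimately show ?thesis by (simp add: germ_subspace_def)
qed

lemma span_mod_base:
  assumes "germ_subspace I" "finite A" "a \<in> A" shows "b a \<in> span_mod I A b"
proof -
  have "(\<Sum>k\<in>A. const_germ (if k = a then 1 else 0) * b k) = (\<Sum>k\<in>A. if k = a then b k else 0)"
    by (intro sum.cong) auto
  also have "\<dots> = b a" using assms(2,3) by simp
  finally have "b a - (\<Sum>k\<in>A. const_germ (if k = a then 1 else 0) * b k) \<in> I"
    using germ_subspaceD(1)[OF assms(1)] by simp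
  then show ?thesis unfolding span_mod_def by (intro CollectI exI[of _ "\<lambda>k. if k = a then 1 else 0"])
qed

lemma ideal_subset_span_mod: "g \<in> I \<Longrightarrow> g \<in> span_mod I A b"
  unfolding span_mod_def by (auto intro!: exI[of _ "\<lambda>_. 0"])

text \<open>Downward induction on the degree in u and v: below degree n, splitting h turns u^i v^j h
  into a scalar times u^i v^j and two multiples of degree one higher. A spanning proof is thereby
  reduced to finitely many monomials and to the single degree n. The generators are left open
  because both (x, y) and (v, y) are needed.\<close>

lemma germ_subspace_eq_UNIV:
  assumes W: "germ_subspace W"
    and split: "\<And>g. \<exists>h k. g = const_germ (germ_value g) + u * h + v * k"
    and low: "\<And>i j. i + j < n \<Longrightarrow> u ^ i * v ^ j \<in> W"
    and high: "\<And>i j h. i + j = n \<Longrightarrow> u ^ i * v ^ j * h \<in> W"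
  shows "g \<in> W"
proof -
  have "u ^ i * v ^ j * h \<in> W" if "k \<le> n" "i + j = n - k" for k i j h
    using that
  proof (induction k arbitrary: i j h)
    case 0
    then show ?case using high by simp
  next
    case (Suc k)
    obtain h1 h2 where h: "h = const_germ (germ_value h) + u * h1 + v * h2" using split by blast
    have "Suc i + j = n - k" "i + Suc j = n - k" "k \<le> n" using Suc.prems by auto
    then have "u ^ Suc i * v ^ j * h1 \<in> W" "u ^ i * v ^ Suc j * h2 \<in> W"
      by (blast intro: Suc.IH)+
    moreover have "const_germ (germ_value h) * (u ^ i * v ^ j) \<in> W"
      using Suc.prems by (intro germ_subspaceD[OF W] low) auto
    ultimately have "const_germ (germ_value h) * (u ^ i * v ^ j) + u ^ Suc i * v ^ j * h1 + u ^ i * v ^ Suc j * h2 \<in> W"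
      by (blast intro: germ_subspaceD(2)[OF W])
    also have "const_germ (germ_value h) * (u ^ i * v ^ j) + u ^ Suc i * v ^ j * h1 + u ^ i * v ^ Suc j * h2 = u ^ i * v ^ j * h"
      by (subst (2) h) (simp add: algebra_simps)
    finally show ?case .
  qed
  from this[of n 0 0 g] show ?thesis by simp
qed

section \<open>Computing with representatives of germs\<close>

lemma holomorphic_germ_power: "holomorphic_germ f \<Longrightarrow> holomorphic_germ (\<lambda>z. f z ^ k)"
  by (induction k) (simp_all add: holomorphic_germ_const holomorphic_germ_mult)

lemma germ_of_simps:
  fixes f g :: "complex^'n::finite \<Rightarrow> complex"
  shows "germ_of (\<lambda>_. c) = (const_germ c :: 'n germ)" "germ_of (\<lambda>z. z $ i) = var_germ i"
    "holomorphic_germ f \<Longrightarrow> holomorphic_germ g \<Longrightarrow> germ_of (\<lambda>z. f z + g z) = germ_of f + germ_of g"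
    "holomorphic_germ f \<Longrightarrow> holomorphic_germ g \<Longrightarrow> germ_of (\<lambda>z. f z * g z) = germ_of f * germ_of g"
  by (simp_all add: const_germ_eq var_germ.abs_eq plus_germ.abs_eq times_germ.abs_eq germ_rel_def)

lemma germ_of_power: "holomorphic_germ f \<Longrightarrow> germ_of (\<lambda>z. f z ^ k) = germ_of f ^ k"
  by (induction k) (simp_all add: germ_of_simps holomorphic_germ_power)

lemmas holomorphic_germ_intros =
  holomorphic_germ_const holomorphic_germ_nth holomorphic_germ_add holomorphic_germ_mult holomorphic_germ_power

lemma germ_of_eq_iff:
  assumes "holomorphic_germ f" "holomorphic_germ g"
  shows "germ_of f = germ_of g \<longleftrightarrow> (\<forall>\<^sub>F z in nhds 0. f z = g z)"
  using Quotient_rel[OF Quotient_germ, of f g] assms by (simp add: germ_rel_def)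

lemma germ_of_rep: "germ_of (rep_germ g) = g" "holomorphic_germ (rep_germ g)"
  using Quotient_abs_rep[OF Quotient_germ] Quotient_rep_reflp[OF Quotient_germ]
  by (auto simp: germ_rel_def)

text \<open>A germ in the ideal is a combination of the two partial derivatives, so it vanishes
  where both do. With powers of two coordinates in the ideal, this isolates the critical
  point.\<close>

lemma gradient_ideal_vanishing:
  fixes f G :: "complex^2 \<Rightarrow> complex"
  assumes f: "holomorphic_germ f" and G: "holomorphic_germ G" "germ_of G \<in> gradient_ideal f"
  shows "\<forall>\<^sub>F z in nhds 0. grad f z = 0 \<longrightarrow> G z = 0"
proof -
  let ?p = "partial_deriv 1 f" and ?q = "partial_deriv 2 f"
  note hol = holomorphic_germ_partial_deriv[OF f]
  obtain a b where "germ_of G = a * germ_of ?p + b * germ_of ?q"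
    using G(2) by (auto simp: gradient_ideal_2 ideal_gen2_def)
  then have "germ_of G = germ_of (\<lambda>z. rep_germ a z * ?p z + rep_germ b z * ?q z)"
    using hol by (simp add: germ_of_simps germ_of_rep holomorphic_germ_mult)
  then have "\<forall>\<^sub>F z in nhds 0. G z = rep_germ a z * ?p z + rep_germ b z * ?q z"
    using hol G by (subst (asm) germ_of_eq_iff) (auto intro!: holomorphic_germ_intros germ_of_rep)
  then show ?thesis
    by eventually_elim (simp add: grad_def vec_eq_iff)
qed

lemma germ_value_numeral [simp]: "germ_value (numeral k) = numeral k"
  by (metis const_germ_numeral germ_value_simps(3))

lemma ideal_unit_cancel:
  assumes "g * u \<in> ideal_gen2 p q" "germ_value u \<noteq> 0"
  shows "g \<in> ideal_gen2 p q"
proof -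
  obtain h where "u * h = 1" using assms(2) by (rule germ_unit)
  then have "h * (g * u) = g" by (simp add: algebra_simps)
  then show ?thesis using ideal_gen2_closed(3)[OF assms(1), of h] by simp
qed

lemma ideal_gen2_value:
  "g \<in> ideal_gen2 p q \<Longrightarrow> germ_value p = 0 \<Longrightarrow> germ_value q = 0 \<Longrightarrow> germ_value g = 0"
  by (auto simp: ideal_gen2_def)

lemma ideal_gen2_dvd:
  assumes "g \<in> ideal_gen2 p q" "g dvd h" shows "h \<in> ideal_gen2 p q"
  using assms ideal_gen2_closed(3)[OF assms(1)] by (auto simp: dvd_def mult.commute)

abbreviation gx :: "2 germ" where "gx \<equiv> var_germ 1"
abbreviation gy :: "2 germ" where "gy \<equiv> var_germ 2"

lemma germ_coeff_monomial_mult: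
  "germ_coeff (gx ^ a * (gy ^ b * g)) i j = (if a \<le> i \<and> b \<le> j then germ_coeff g (i - a) (j - b) else 0)"
  by (simp add: germ_coeff_x_power_mult germ_coeff_y_power_mult)

lemma germ_coeff_monomial: "germ_coeff (gx ^ a * gy ^ b) i j = (if a = i \<and> b = j then 1 else 0)"
  using germ_coeff_monomial_mult[of a b 1 i j] germ_coeff_const[of 1] by auto

subsection \<open>The Milnor number of the undeformed singularity\<close>

context
  fixes b :: complex and p q :: "2 germ"
  defines "p \<equiv> 4 * gx ^ 3 + const_germ (2 * b) * gx * gy ^ 4"
    and "q \<equiv> 6 * gy ^ 5 + const_germ (4 * b) * gx ^ 2 * gy ^ 3"
begin

text \<open>In x q - b y^3 p the terms with x^3 y^3 cancel, which leaves x y^5 times the unit 6 - 2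
  b^2 y^2. The other members follow by reducing multiples of p and q with those already
  found.\<close>

lemma W10_ideal_members:
  "gx * gy ^ 5 \<in> ideal_gen2 p q" "gx ^ 3 * gy \<in> ideal_gen2 p q" "gx ^ 5 \<in> ideal_gen2 p q"
  "gy ^ 7 \<in> ideal_gen2 p q"
proof -
  note S = germ_subspaceD[OF germ_subspace_ideal_gen2[of p q]] and M = ideal_gen2_closed(3)[where p = p and q = q]
  note cancel = germ_subspace_cancel_numeral[OF germ_subspace_ideal_gen2[of p q]]
  note B = const_germ_mult const_germ_power const_germ_numeral
  have "gx * gy ^ 5 * (6 - const_germ (2 * b ^ 2) * gy ^ 2) = gx * q - (const_germ b * gy ^ 3) * p"
    by (simp add: p_def q_def B algebra_simps power_numeral_reduce)
  also have "\<dots> \<in> ideal_gen2 p q" by (intro S M ideal_gen2_mem)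
  finally show 1: "gx * gy ^ 5 \<in> ideal_gen2 p q" by (rule ideal_unit_cancel) simp
  have "4 * (gx ^ 3 * gy) = gy * p - const_germ (2 * b) * (gx * gy ^ 5)"
    by (simp add: p_def q_def B algebra_simps power_numeral_reduce)
  also have "\<dots> \<in> ideal_gen2 p q" by (intro S M ideal_gen2_mem 1)
  finally show 2: "gx ^ 3 * gy \<in> ideal_gen2 p q" by (rule cancel)
  have "4 * gx ^ 5 = gx ^ 2 * p - (const_germ (2 * b) * gy ^ 3) * (gx ^ 3 * gy)"
    by (simp add: p_def q_def B algebra_simps power_numeral_reduce)
  also have "\<dots> \<in> ideal_gen2 p q" by (intro S M ideal_gen2_mem 2)
  finally show "gx ^ 5 \<in> ideal_gen2 p q" by (rule cancel)
  have "6 * gy ^ 7 = gy ^ 2 * q - (const_germ (4 * b) * gx) * (gx * gy ^ 5)"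
    by (simp add: p_def q_def B algebra_simps power_numeral_reduce)
  also have "\<dots> \<in> ideal_gen2 p q" by (intro S M ideal_gen2_mem 1)
  finally show "gy ^ 7 \<in> ideal_gen2 p q" by (rule cancel)
qed

text \<open>Of the monomials outside the 3 by 5 box, all but x^3, x^4, y^5 and y^6 are multiples of
  the known members; these four are reduced to the box by p, x p, q and y q. Degree 7 is the first
  in which every monomial is such a multiple.\<close>

lemma W10_span: "g \<in> span_mod (ideal_gen2 p q) ({..<3} \<times> {..<5}) (\<lambda>(i, j). gx ^ i * gy ^ j)"
proof -
  define W where "W = span_mod (ideal_gen2 p q) ({..<3} \<times> {..<5}) (\<lambda>(i, j). gx ^ i * gy ^ j)"
  have W: "germ_subspace W"
    unfolding W_def by (intro germ_subspace_span_mod germ_subspace_ideal_gen2)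
  note S = germ_subspaceD[OF W] and cancel = germ_subspace_cancel_numeral[OF W]
  note B = const_germ_mult const_germ_power const_germ_numeral
  have base: "gx ^ i * gy ^ j \<in> W" if "i < 3" "j < 5" for i j
    using span_mod_base[OF germ_subspace_ideal_gen2[of p q], of "{..<3} \<times> {..<5}" "(i, j)" "\<lambda>(i, j). gx ^ i * gy ^ j"] that
    by (simp add: W_def)
  have I: "g \<in> W" if "g \<in> ideal_gen2 p q" for g
    using that by (simp add: W_def ideal_subset_span_mod)
  have pq: "h * p \<in> W" "h * q \<in> W" for h
    by (intro I ideal_gen2_closed ideal_gen2_mem)+
  have "6 * gy ^ 5 = 1 * q - const_germ (4 * b) * (gx ^ 2 * gy ^ 3)" by (simp add: q_def algebra_simps)
  also have "\<dots> \<in> W" by (intro S pq base) auto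
  finally have 1: "gy ^ 5 \<in> W" by (rule cancel)
  have "6 * gy ^ 6 = gy * q - const_germ (4 * b) * (gx ^ 2 * gy ^ 4)"
    by (simp add: q_def algebra_simps power_numeral_reduce)
  also have "\<dots> \<in> W" by (intro S pq base) auto
  finally have 2: "gy ^ 6 \<in> W" by (rule cancel)
  have "4 * gx ^ 3 = 1 * p - const_germ (2 * b) * (gx ^ 1 * gy ^ 4)" by (simp add: p_def algebra_simps)
  also have "\<dots> \<in> W" by (intro S pq base) auto
  finally have 3: "gx ^ 3 \<in> W" by (rule cancel)
  have "4 * gx ^ 4 = gx * p - const_germ (2 * b) * (gx ^ 2 * gy ^ 4)"
    by (simp add: p_def algebra_simps power_numeral_reduce)
  also have "\<dots> \<in> W" by (intro S pq base) auto
  finally have 4: "gx ^ 4 \<in> W" by (rule cancel)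
  have dvdI: "g \<in> W" if "gx * gy ^ 5 dvd g \<or> gx ^ 3 * gy dvd g \<or> gx ^ 5 dvd g \<or> gy ^ 7 dvd g" for g
    using that W10_ideal_members ideal_gen2_dvd by (blast intro: I)
  have in_I: "gx ^ i * gy ^ j * h \<in> W" if "i \<ge> 1 \<and> j \<ge> 5 \<or> i \<ge> 3 \<and> j \<ge> 1 \<or> i \<ge> 5 \<or> j \<ge> 7" for i j h
  proof (rule dvdI)
    from that show "gx * gy ^ 5 dvd gx ^ i * gy ^ j * h \<or> gx ^ 3 * gy dvd gx ^ i * gy ^ j * h
        \<or> gx ^ 5 dvd gx ^ i * gy ^ j * h \<or> gy ^ 7 dvd gx ^ i * gy ^ j * h"
      using mult_dvd_mono[of "gx ^ 1" "gx ^ i" "gy ^ 5" "gy ^ j"] mult_dvd_mono[of "gx ^ 3" "gx ^ i" "gy ^ 1" "gy ^ j"]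
      by (auto simp: le_imp_power_dvd intro: dvd_mult2 dvd_mult)
  qed
  show ?thesis
    unfolding W_def[symmetric]
  proof (rule germ_subspace_eq_UNIV[OF W germ_split, where n = 7])
    fix i j :: nat assume "i + j < 7"
    then consider "i < 3" "j < 5" | "i \<ge> 1 \<and> j \<ge> 5 \<or> i \<ge> 3 \<and> j \<ge> 1 \<or> i \<ge> 5 \<or> j \<ge> 7"
      | "i = 0" "j = 5" | "i = 0" "j = 6" | "i = 3" "j = 0" | "i = 4" "j = 0" by linarith
    then show "gx ^ i * gy ^ j \<in> W"
      using base 1 2 3 4 in_I[of i j 1] by cases auto
  next
    fix i j :: nat and h assume "i + j = 7"
    then show "gx ^ i * gy ^ j * h \<in> W" by (intro in_I) linarith
  qed
qed

text \<open>
  The coefficient functional dual to the socle \<open>x\<^sup>2 y\<^sup>4\<close>; the corrections at \<open>x\<^sup>4\<close> and \<open>y\<^sup>6\<close> are forced by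
  the requirement that it vanish on \<open>x p\<close> and \<open>y q\<close>.
\<close>

definition W10_functional :: "2 germ \<Rightarrow> complex" where
  "W10_functional g = germ_coeff g 2 4 - b / 2 * germ_coeff g 4 0 - 2 * b / 3 * germ_coeff g 0 6"

lemma W10_functional_monomial:
  "W10_functional (gx ^ m * gy ^ n) = (if m = 2 \<and> n = 4 then 1 else if m = 4 \<and> n = 0 then - b / 2
     else if m = 0 \<and> n = 6 then - 2 * b / 3 else 0)"
  by (simp add: W10_functional_def germ_coeff_monomial)

lemma W10_functional_ideal:
  assumes "g \<in> ideal_gen2 p q" shows "W10_functional g = 0"
proof -
  obtain h k where g: "g = h * p + k * q" using assms by (auto simp: ideal_gen2_def)
  have "h * p = const_germ 4 * (gx ^ 3 * h) + const_germ (2 * b) * (gx ^ 1 * (gy ^ 4 * h))"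
    "k * q = const_germ 6 * (gy ^ 5 * k) + const_germ (4 * b) * (gx ^ 2 * (gy ^ 3 * k))"
    by (simp_all add: p_def q_def algebra_simps)
  then show ?thesis
    unfolding g W10_functional_def
    by (simp only: germ_coeff_add germ_coeff_const_mult germ_coeff_x_power_mult germ_coeff_y_power_mult) simp
qed

text \<open>Multiplying a relation by x^k y^l and applying the functional gives a linear equation
  for each (k, l). The monomial x^i y^j pairs to 1 with x^(2-i) y^(4-j); the values at x^4 and y^6
  add a few terms, and in the order below the system stays triangular.\<close>

lemma W10_independent:
  assumes "(\<Sum>a\<in>{..<3} \<times> {..<5}. const_germ (c a) * (case a of (i, j) \<Rightarrow> gx ^ i * gy ^ j)) \<in> ideal_gen2 p q"
    and "a \<in> {..<3} \<times> {..<5}"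
  shows "c a = 0"
proof -
  have eq: "(\<Sum>i<3. \<Sum>j<5. c (i, j) * W10_functional (gx ^ (k + i) * gy ^ (l + j))) = 0" for k l
  proof -
    have "gx ^ k * gy ^ l * (\<Sum>a\<in>{..<3} \<times> {..<5}. const_germ (c a) * (case a of (i, j) \<Rightarrow> gx ^ i * gy ^ j))
        = (\<Sum>i<3. \<Sum>j<5. const_germ (c (i, j)) * (gx ^ (k + i) * gy ^ (l + j)))"
      unfolding sum_distrib_left sum.cartesian_product
      by (intro sum.cong) (auto simp: power_add mult_ac)
    then have "(\<Sum>i<3. \<Sum>j<5. const_germ (c (i, j)) * (gx ^ (k + i) * gy ^ (l + j))) \<in> ideal_gen2 p q"
      using ideal_gen2_closed(3)[OF assms(1), of "gx ^ k * gy ^ l"] by simp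
    from W10_functional_ideal[OF this] show ?thesis
      by (simp add: W10_functional_def germ_coeff_sum germ_coeff_const_mult sum_distrib_left sum_distrib_right
          sum_subtractf sum.distrib algebra_simps)
  qed
  note eq' = eq[unfolded W10_functional_monomial]
  have c0: "c (0, 0) = 0" "c (0, 1) = 0" "c (0, 2) = 0" "c (0, 3) = 0"
    using eq'[of 2 4] eq'[of 2 3] eq'[of 2 2] eq'[of 2 1] by (simp_all add: lessThan_nat_numeral)
  have c1: "c (1, 0) = 0" "c (1, 1) = 0" "c (1, 2) = 0" "c (1, 3) = 0" "c (1, 4) = 0"
    using eq'[of 1 4] eq'[of 1 3] eq'[of 1 2] eq'[of 1 1] eq'[of 1 0]
    by (simp_all add: lessThan_nat_numeral)
  have c2: "c (2, 0) = 0" "c (2, 1) = 0" "c (0, 4) = 0" "c (2, 2) = 0" "c (2, 3) = 0" "c (2, 4) = 0"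
    using eq'[of 0 4] eq'[of 0 3] eq'[of 2 0] eq'[of 0 2] eq'[of 0 1] eq'[of 0 0] c0
    by (simp_all add: lessThan_nat_numeral)
  obtain i j where a: "a = (i, j)" "i < 3" "j < 5" using assms(2) by auto
  from a(2) have "i = 0 \<or> i = 1 \<or> i = 2" by auto
  moreover from a(3) have "j = 0 \<or> j = 1 \<or> j = 2 \<or> j = 3 \<or> j = 4" by auto
  ultimately show ?thesis using a(1) c0 c1 c2 by auto
qed

end

subsection \<open>The Milnor number of the deformed singularity\<close>

text \<open>With P_u and P_v the partial derivatives of P at (x, v), the generators are p = P_u + s
  P_v and q = 2 y P_v.\<close>

context
  fixes b s :: complex and v p q :: "2 germ"
  defines "v \<equiv> gy ^ 2 + const_germ s * gx"
    and "p \<equiv> 4 * gx ^ 3 + const_germ (2 * b) * gx * v ^ 2 + const_germ s * (3 * v ^ 2 + const_germ (2 * b) * gx ^ 2 * v)"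
    and "q \<equiv> 2 * gy * (3 * v ^ 2 + const_germ (2 * b) * gx ^ 2 * v)"
  assumes s: "s \<noteq> 0"
begin

text \<open>For s \<noteq> 0 the variable x equals (v - y^2) / s, so v and y also generate the
  maximal ideal.\<close>

lemma E14_split: "\<exists>h k. g = const_germ (germ_value g) + v * h + gy * k"
proof -
  obtain h k where g: "g = const_germ (germ_value g) + gx * h + gy * k" using germ_split by blast
  define r where "r = (const_germ (inverse s) :: 2 germ)"
  have r: "r * const_germ s = 1" using s by (simp add: r_def flip: const_germ_mult)
  have "v * (r * h) + gy * (k - gy * r * h) = (r * const_germ s) * (gx * h) + gy * k"
    by (simp add: v_def algebra_simps power2_eq_square)
  with r have "g = const_germ (germ_value g) + v * (r * h) + gy * (k - gy * r * h)"
    using g by (simp add: add.assoc)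
  then show ?thesis by blast
qed

text \<open>Powers of s clear the denominators of x = (v - y^2) / s: in the form s x = v - y^2,
  relations can be expanded in v and y. The two members that are not monomials express y^7 by v y^5
  and, up to v^4, v^3 by v y^6.\<close>

lemma E14_ideal_members:
  "gy * v ^ 3 \<in> ideal_gen2 p q" "gy ^ 3 * v ^ 2 \<in> ideal_gen2 p q"
  "3 * v * gy ^ 5 - gy ^ 7 \<in> ideal_gen2 p q" "v * gy ^ 7 \<in> ideal_gen2 p q" "gy ^ 9 \<in> ideal_gen2 p q"
  "3 * const_germ s ^ 4 * v ^ 3 + (4 + 4 * const_germ b * const_germ s ^ 2) * v ^ 4 - 4 * v * gy ^ 6
     \<in> ideal_gen2 p q"
  "v ^ 4 \<in> ideal_gen2 p q"
proof -
  let ?S = "const_germ s" and ?B = "const_germ b"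
  note S = germ_subspaceD[OF germ_subspace_ideal_gen2[of p q]] and M = ideal_gen2_closed(3)[where p = p and q = q]
  note cancel = germ_subspace_cancel_numeral[OF germ_subspace_ideal_gen2[of p q]]
  note ring = const_germ_mult const_germ_power const_germ_numeral algebra_simps power_numeral_reduce
  \<comment> \<open>Since q = 2 y P_v, the ideal contains y P_u as well as y P_v. Eliminating x y
    v^2 between y P_u and x y P_v isolates y x^3 up to a unit.\<close>
  have "gy * gx ^ 3 * (24 - 8 * ?B ^ 2 * v) = (6 * gy) * p - (3 * ?S + 2 * ?B * gx) * q"
    by (simp add: p_def q_def ring)
  also have "\<dots> \<in> ideal_gen2 p q" by (intro S M ideal_gen2_mem)
  finally have 1: "gy * gx ^ 3 \<in> ideal_gen2 p q" by (rule ideal_unit_cancel) (simp add: v_def)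
  have "6 * (gy * gx * v ^ 2) = gx * q - (4 * ?B * v) * (gy * gx ^ 3)"
    by (simp add: p_def q_def ring)
  also have "\<dots> \<in> ideal_gen2 p q" by (intro S M ideal_gen2_mem 1)
  finally have 2: "gy * gx * v ^ 2 \<in> ideal_gen2 p q" by (rule cancel)
  have "6 * (gy * v ^ 3) = v * q - (4 * ?B * gx) * (gy * gx * v ^ 2)"
    by (simp add: p_def q_def ring)
  also have "\<dots> \<in> ideal_gen2 p q" by (intro S M ideal_gen2_mem 2)
  finally show 3: "gy * v ^ 3 \<in> ideal_gen2 p q" by (rule cancel)
  have y2: "gy ^ 2 = v - ?S * gx" by (simp add: v_def)
  have "gy ^ 3 * gx ^ 2 * v = gy * gx ^ 2 * v * gy ^ 2" by (simp add: ring)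
  also have "\<dots> = gx * (gy * gx * v ^ 2) - (?S * v) * (gy * gx ^ 3)"
    unfolding y2 by (simp add: ring)
  also have "\<dots> \<in> ideal_gen2 p q" by (intro S M 1 2)
  finally have 4: "gy ^ 3 * gx ^ 2 * v \<in> ideal_gen2 p q" .
  have "6 * (gy ^ 3 * v ^ 2) = gy ^ 2 * q - (4 * ?B) * (gy ^ 3 * gx ^ 2 * v)"
    by (simp add: q_def ring)
  also have "\<dots> \<in> ideal_gen2 p q" by (intro S M ideal_gen2_mem 4)
  finally show 5: "gy ^ 3 * v ^ 2 \<in> ideal_gen2 p q" by (rule cancel)
  have Sx: "?S * gx = v - gy ^ 2" by (simp add: v_def)
  \<comment> \<open>In the expansion of y (v - y^2)^3 the terms y v^3 and y^3 v^2 are already in the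
    ideal, as is the whole; the remaining two terms follow.\<close>
  have "?S ^ 3 * (gy * gx ^ 3) = gy * (?S * gx) ^ 3" by (simp add: power_mult_distrib mult_ac)
  also have "\<dots> = gy * v ^ 3 - 3 * (gy ^ 3 * v ^ 2) + (3 * v * gy ^ 5 - gy ^ 7)"
    unfolding Sx by (simp add: ring)
  finally have "3 * v * gy ^ 5 - gy ^ 7 = ?S ^ 3 * (gy * gx ^ 3) - gy * v ^ 3 + 3 * (gy ^ 3 * v ^ 2)"
    by simp
  also have "\<dots> \<in> ideal_gen2 p q" by (intro S(2,5) M 1 3 5)
  finally show 6: "3 * v * gy ^ 5 - gy ^ 7 \<in> ideal_gen2 p q" .
  have "v * gy ^ 7 = (3 * gy ^ 2) * (gy ^ 3 * v ^ 2) - v * (3 * v * gy ^ 5 - gy ^ 7)"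
    by (simp add: ring)
  also have "\<dots> \<in> ideal_gen2 p q" by (intro S(2,5) M 5 6)
  finally show 7: "v * gy ^ 7 \<in> ideal_gen2 p q" .
  have "gy ^ 9 = 3 * (v * gy ^ 7) - gy ^ 2 * (3 * v * gy ^ 5 - gy ^ 7)" by (simp add: ring)
  also have "\<dots> \<in> ideal_gen2 p q" by (intro S(2,5) M 6 7)
  finally show "gy ^ 9 \<in> ideal_gen2 p q" .
  have "?S ^ 3 * v * p = 4 * v * (?S * gx) ^ 3 + 2 * ?B * ?S ^ 2 * v ^ 3 * (?S * gx) + 3 * ?S ^ 4 * v ^ 3
      + 2 * ?B * ?S ^ 2 * v ^ 2 * (?S * gx) ^ 2"
    by (simp add: p_def ring)
  then have "3 * ?S ^ 4 * v ^ 3 + (4 + 4 * ?B * ?S ^ 2) * v ^ 4 - 4 * v * gy ^ 6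
    = (?S ^ 3 * v) * p + ((12 + 6 * ?B * ?S ^ 2) * gy) * (gy * v ^ 3) - ((12 + 2 * ?B * ?S ^ 2) * gy) * (gy ^ 3 * v ^ 2)"
    unfolding Sx by (simp add: ring)
  also have "\<dots> \<in> ideal_gen2 p q" by (intro S(2,5) M 3 5 ideal_gen2_mem)
  finally show 8: "3 * ?S ^ 4 * v ^ 3 + (4 + 4 * ?B * ?S ^ 2) * v ^ 4 - 4 * v * gy ^ 6 \<in> ideal_gen2 p q" .
  \<comment> \<open>Multiplied by v, the last term of the preceding member becomes a multiple of y^3
    v^2; what is left is v^4 times a factor with value 3 s^4.\<close>
  have "v ^ 4 * (3 * ?S ^ 4 + (4 + 4 * ?B * ?S ^ 2) * v)
    = v * (3 * ?S ^ 4 * v ^ 3 + (4 + 4 * ?B * ?S ^ 2) * v ^ 4 - 4 * v * gy ^ 6) + (4 * gy ^ 3) * (gy ^ 3 * v ^ 2)"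
    by (simp add: ring)
  also have "\<dots> \<in> ideal_gen2 p q" by (intro S(2,5) M 5 8)
  finally show "v ^ 4 \<in> ideal_gen2 p q" by (rule ideal_unit_cancel) (use s in \<open>simp add: v_def\<close>)
qed

text \<open>Outside the 2 by 7 box the known members leave y^7, y^8, v^3, y^2 v^2, y v^2 and v^2. In
  this order each is reduced to the box, to the ideal and to monomials treated before. Degree 9 is
  the first in which every monomial is a multiple of a known member.\<close>

lemma E14_span: "g \<in> span_mod (ideal_gen2 p q) ({..<2} \<times> {..<7}) (\<lambda>(i, j). v ^ i * gy ^ j)"
proof -
  let ?S = "const_germ s" and ?B = "const_germ b"
  define W where "W = span_mod (ideal_gen2 p q) ({..<2} \<times> {..<7}) (\<lambda>(i, j). v ^ i * gy ^ j)"
  have W: "germ_subspace W"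
    unfolding W_def by (intro germ_subspace_span_mod germ_subspace_ideal_gen2)
  note S = germ_subspaceD[OF W]
  note ring = const_germ_mult const_germ_power const_germ_numeral const_germ_add algebra_simps power_numeral_reduce
  note mem = E14_ideal_members
  have base: "v ^ i * gy ^ j \<in> W" if "i < 2" "j < 7" for i j
    using span_mod_base[OF germ_subspace_ideal_gen2[of p q], of "{..<2} \<times> {..<7}" "(i, j)" "\<lambda>(i, j). v ^ i * gy ^ j"] that
    by (simp add: W_def)
  have I: "h * g \<in> W" if "g \<in> ideal_gen2 p q" for g h
    using ideal_gen2_closed(3)[OF that] by (simp add: W_def ideal_subset_span_mod)
  note pq = I[OF ideal_gen2_mem(1)] I[OF ideal_gen2_mem(2)]
  have Sx: "?S * gx = v - gy ^ 2" by (simp add: v_def)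
  have y7: "gy ^ 7 \<in> W"
  proof -
    have "const_germ 3 * (v ^ 1 * gy ^ 5) - 1 * (3 * v * gy ^ 5 - gy ^ 7) \<in> W"
      by (rule S(5)[OF S(3)[OF base] I[OF mem(3)]]) auto
    then show ?thesis by (simp add: ring)
  qed
  have y8: "gy ^ 8 \<in> W"
  proof -
    have "const_germ 3 * (v ^ 1 * gy ^ 6) - gy * (3 * v * gy ^ 5 - gy ^ 7) \<in> W"
      by (rule S(5)[OF S(3)[OF base] I[OF mem(3)]]) auto
    then show ?thesis by (simp add: ring)
  qed
  have v3: "v ^ 3 \<in> W"
  proof (rule germ_subspace_cancel[OF W])
    have "1 * (3 * ?S ^ 4 * v ^ 3 + (4 + 4 * ?B * ?S ^ 2) * v ^ 4 - 4 * v * gy ^ 6)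
       - (4 + 4 * ?B * ?S ^ 2) * v ^ 4 + const_germ 4 * (v ^ 1 * gy ^ 6) \<in> W"
      by (rule S(2)[OF S(5)[OF I[OF mem(6)] I[OF mem(7)]] S(3)[OF base]]) auto
    then show "const_germ (3 * s ^ 4) * v ^ 3 \<in> W" by (simp add: ring)
  qed (use s in simp)
  \<comment> \<open>With s x = v - y^2 the last term is 4 b y v (v - y^2)^2. So modulo the ideal y
    v^2 is a multiple of v y^5, and y^2 v^2 one of v y^6.\<close>
  have SSq: "?S ^ 2 * q = 6 * ?S ^ 2 * (gy * v ^ 2) + 4 * ?B * gy * v * (?S * gx) ^ 2"
    by (simp add: q_def ring)
  have y2v2: "gy ^ 2 * v ^ 2 \<in> W"
  proof (rule germ_subspace_cancel[OF W])
    have "(?S ^ 2 * gy) * q - (4 * ?B * gy) * (gy * v ^ 3) + (8 * ?B * gy) * (gy ^ 3 * v ^ 2)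
        - const_germ (4 * b) * (v ^ 1 * gy ^ 6) \<in> W"
      by (rule S(5)[OF S(2)[OF S(5)[OF pq(2) I[OF mem(1)]] I[OF mem(2)]] S(3)[OF base]]) auto
    also have "(?S ^ 2 * gy) * q = gy * (?S ^ 2 * q)" by (simp add: mult_ac)
    finally show "const_germ (6 * s ^ 2) * (gy ^ 2 * v ^ 2) \<in> W"
      unfolding SSq Sx by (simp add: ring)
  qed (use s in simp)
  have yv2: "gy * v ^ 2 \<in> W"
  proof (rule germ_subspace_cancel[OF W])
    have "?S ^ 2 * q - (4 * ?B) * (gy * v ^ 3) + (8 * ?B) * (gy ^ 3 * v ^ 2)
        - const_germ (4 * b) * (v ^ 1 * gy ^ 5) \<in> W"
      by (rule S(5)[OF S(2)[OF S(5)[OF pq(2) I[OF mem(1)]] I[OF mem(2)]] S(3)[OF base]]) auto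
    then show "const_germ (6 * s ^ 2) * (gy * v ^ 2) \<in> W"
      unfolding SSq Sx by (simp add: ring)
  qed (use s in simp)
  \<comment> \<open>This reduction comes last because s^3 p, expanded in v and y, contains v^3 and
    y^2 v^2 besides 3 s^4 v^2 and box monomials.\<close>
  have v2: "v ^ 2 \<in> W"
  proof (rule germ_subspace_cancel[OF W])
    have "?S ^ 3 * p - const_germ (4 + 4 * b * s ^ 2) * v ^ 3 + const_germ (12 + 6 * b * s ^ 2) * (gy ^ 2 * v ^ 2)
        - const_germ (12 + 2 * b * s ^ 2) * (v ^ 1 * gy ^ 4) + const_germ 4 * (v ^ 0 * gy ^ 6) \<in> W"
      by (intro S(2,5) pq S(3)[OF base] S(3)[OF v3] S(3)[OF y2v2]) auto
    also have "?S ^ 3 * p = 4 * (?S * gx) ^ 3 + 2 * ?B * ?S ^ 2 * v ^ 2 * (?S * gx) + 3 * ?S ^ 4 * v ^ 2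
      + 2 * ?B * ?S ^ 2 * v * (?S * gx) ^ 2"
      by (simp add: p_def ring)
    finally show "const_germ (3 * s ^ 4) * v ^ 2 \<in> W"
      unfolding Sx by (simp add: ring)
  qed (use s in simp)
  have dvdI: "g \<in> W" if "h dvd g" "h \<in> ideal_gen2 p q" for g h
    using I[OF that(2)] that(1) by (auto simp: dvd_def mult.commute)
  have in_I: "v ^ i * gy ^ j * h \<in> W"
    if "j \<ge> 9 \<or> i \<ge> 1 \<and> j \<ge> 7 \<or> i \<ge> 2 \<and> j \<ge> 3 \<or> i \<ge> 3 \<and> j \<ge> 1 \<or> i \<ge> 4" for i j h
  proof -
    have d: "v ^ k * gy ^ l dvd v ^ i * gy ^ j * h" if "k \<le> i" "l \<le> j" for k l
      using that by (intro dvd_mult2 mult_dvd_mono le_imp_power_dvd)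
    from that consider "j \<ge> 9" | "i \<ge> 1" "j \<ge> 7" | "i \<ge> 2" "j \<ge> 3" | "i \<ge> 3" "j \<ge> 1" | "i \<ge> 4" by blast
    then show ?thesis
    proof cases
      case 1 then show ?thesis using dvdI[OF d[of 0 9]] mem by simp
    next
      case 2 then show ?thesis using dvdI[OF d[of 1 7]] mem by simp
    next
      case 3 then show ?thesis using dvdI[OF d[of 2 3]] mem by (simp add: mult.commute)
    next
      case 4 then show ?thesis using dvdI[OF d[of 3 1]] mem by (simp add: mult.commute)
    next
      case 5 then show ?thesis using dvdI[OF d[of 4 0]] mem by simp
    qed
  qed
  show ?thesis
    unfolding W_def[symmetric]
  proof (rule germ_subspace_eq_UNIV[OF W E14_split, where n = 9])
    fix i j :: nat assume "i + j < 9"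
    show "v ^ i * gy ^ j \<in> W"
    proof (cases "j \<ge> 9 \<or> i \<ge> 1 \<and> j \<ge> 7 \<or> i \<ge> 2 \<and> j \<ge> 3 \<or> i \<ge> 3 \<and> j \<ge> 1 \<or> i \<ge> 4")
      case True
      from in_I[OF this, of 1] show ?thesis by simp
    next
      case False
      then have "i < 2 \<and> j < 7 \<or> i = 0 \<and> j = 7 \<or> i = 0 \<and> j = 8 \<or> i = 2 \<and> j = 0 \<or> i = 2 \<and> j = 1
        \<or> i = 2 \<and> j = 2 \<or> i = 3 \<and> j = 0" by presburger
      then consider "i < 2" "j < 7" | "i = 0" "j = 7" | "i = 0" "j = 8" | "i = 2" "j = 0" | "i = 2" "j = 1"
        | "i = 2" "j = 2" | "i = 3" "j = 0" by blast
      then show ?thesis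
        using base y7 y8 v3 y2v2 yv2 v2 by cases (auto simp: mult.commute)
    qed
  next
    fix i j :: nat and h assume "i + j = 9"
    then show "v ^ i * gy ^ j * h \<in> W" by (intro in_I) linarith
  qed
qed

text \<open>
  The functional dual to the socle \<open>v y\<^sup>6\<close>, multiplied by \<open>9 s\<^sup>1\<^sup>0\<close> to clear denominators.
\<close>

definition E14_functional :: "2 germ \<Rightarrow> complex" where
  "E14_functional g = - 9 * s ^ 6 * germ_coeff g 4 0 + 9 * s ^ 8 * germ_coeff g 2 4 - 18 * s ^ 9 * germ_coeff g 1 6
     + 27 * s ^ 10 * germ_coeff g 0 8 + (12 * s ^ 3 + 18 * b * s ^ 5) * germ_coeff g 3 0
     - 6 * b * s ^ 6 * germ_coeff g 2 2 - (16 + 40 * b * s ^ 2 + 12 * b ^ 2 * s ^ 4) * germ_coeff g 2 0"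

lemma E14_functional_add: "E14_functional (g + h) = E14_functional g + E14_functional h"
  unfolding E14_functional_def germ_coeff_add by (simp add: algebra_simps)

lemma E14_functional_const_mult: "E14_functional (const_germ e * g) = e * E14_functional g"
  unfolding E14_functional_def germ_coeff_const_mult by (simp add: algebra_simps)

text \<open>Products of two box monomials contain at most v^2, hence the bound on m. As the
  functional kills the ideal, each value is 9 s^10 times the coefficient of v y^6 in the reduced
  form: y^8 reduces to 3 v y^6, and v^2 y^2 to -2 b / (3 s^2) times v y^6.\<close>

lemma E14_functional_monomial:
  assumes "m \<le> 2"
  shows "E14_functional (v ^ m * gy ^ n) = (if m = 0 \<and> n = 8 then 27 * s ^ 10 else if m = 1 \<and> n = 6 then 9 * s ^ 10
     else if m = 2 \<and> n = 2 then - 6 * b * s ^ 8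
     else if m = 2 \<and> n = 0 then - (16 + 40 * b * s ^ 2 + 12 * b ^ 2 * s ^ 4) * s ^ 2 else 0)"
proof -
  have y: "E14_functional (gx ^ i * gy ^ l) = (if i = 0 \<and> l = 8 then 27 * s ^ 10 else if i = 1 \<and> l = 6 then - 18 * s ^ 9
     else if i = 2 \<and> l = 4 then 9 * s ^ 8 else if i = 2 \<and> l = 2 then - 6 * b * s ^ 6
     else if i = 2 \<and> l = 0 then - (16 + 40 * b * s ^ 2 + 12 * b ^ 2 * s ^ 4) else 0)" if "i \<le> 2" for i l
    using that by (auto simp: E14_functional_def germ_coeff_monomial)
  consider "m = 0" | "m = 1" | "m = 2" using assms by linarith
  then show ?thesis
  proof cases
    case 1
    then show ?thesis using y[of 0 n] by simp
  next
    case 2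
    then have "v ^ m * gy ^ n = gx ^ 0 * gy ^ (n + 2) + const_germ s * (gx ^ 1 * gy ^ n)"
      by (simp add: v_def algebra_simps power_add power2_eq_square)
    then show ?thesis using 2 y[of 0 "n + 2"] y[of 1 n]
      by (simp add: E14_functional_add E14_functional_const_mult power_numeral_reduce)
  next
    case 3
    then have "v ^ m * gy ^ n = gx ^ 0 * gy ^ (n + 4) + const_germ (2 * s) * (gx ^ 1 * gy ^ (n + 2)) + const_germ (s ^ 2) * (gx ^ 2 * gy ^ n)"
      by (simp add: v_def algebra_simps power_add const_germ_mult const_germ_power power_numeral_reduce)
    then show ?thesis using 3 y[of 0 "n + 4"] y[of 1 "n + 2"] y[of 2 n]
      by (simp add: E14_functional_add E14_functional_const_mult power_numeral_reduce)
  qed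
qed

text \<open>In the monomials of x and y, multiplication by p or q shifts and combines coefficients.
  The constants of the functional are those for which every coefficient of h and of k
  cancels.\<close>

lemma E14_functional_ideal:
  assumes "g \<in> ideal_gen2 p q" shows "E14_functional g = 0"
proof -
  obtain h k where g: "g = h * p + k * q" using assms by (auto simp: ideal_gen2_def)
  have hp: "h * p = const_germ (4 + 4 * b * s ^ 2) * (gx ^ 3 * h) + const_germ (6 * b * s) * (gx ^ 2 * (gy ^ 2 * h))
      + const_germ (2 * b) * (gx ^ 1 * (gy ^ 4 * h)) + const_germ (3 * s) * (gy ^ 4 * h)
      + const_germ (6 * s ^ 2) * (gx ^ 1 * (gy ^ 2 * h)) + const_germ (3 * s ^ 3) * (gx ^ 2 * h)"
    by (simp add: p_def v_def const_germ_add const_germ_mult const_germ_power algebra_simps power_numeral_reduce)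
  have kq: "k * q = const_germ 6 * (gy ^ 5 * k) + const_germ (12 * s) * (gx ^ 1 * (gy ^ 3 * k))
      + const_germ (6 * s ^ 2) * (gx ^ 2 * (gy ^ 1 * k)) + const_germ (4 * b) * (gx ^ 2 * (gy ^ 3 * k))
      + const_germ (4 * b * s) * (gx ^ 3 * (gy ^ 1 * k))"
    by (simp add: q_def v_def const_germ_add const_germ_mult const_germ_power algebra_simps power_numeral_reduce)
  have "E14_functional (h * p) = 0"
    unfolding hp E14_functional_def
    by (simp only: germ_coeff_add germ_coeff_const_mult germ_coeff_x_power_mult germ_coeff_y_power_mult)
       (simp add: algebra_simps power_numeral_reduce)
  moreover have "E14_functional (k * q) = 0"
    unfolding kq E14_functional_def
    by (simp only: germ_coeff_add germ_coeff_const_mult germ_coeff_x_power_mult germ_coeff_y_power_mult)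
       (simp add: algebra_simps power_numeral_reduce)
  ultimately show ?thesis
    unfolding g by (simp add: E14_functional_add)
qed

text \<open>Testing a relation with y^l and with v y^l gives the systems \<open>e0\<close> and
  \<open>e1\<close>. They are solved alternately, each equation contributing one new unknown with
  the factor 9 s^10.\<close>

lemma E14_independent:
  assumes "(\<Sum>a\<in>{..<2} \<times> {..<7}. const_germ (c a) * (case a of (i, j) \<Rightarrow> v ^ i * gy ^ j)) \<in> ideal_gen2 p q"
    and "a \<in> {..<2} \<times> {..<7}"
  shows "c a = 0"
proof -
  have zero: "E14_functional 0 = 0" by (simp add: E14_functional_def)
  have sum: "E14_functional (\<Sum>a\<in>A. g a) = (\<Sum>a\<in>A. E14_functional (g a))" for g and A :: "nat set"
    by (induction A rule: infinite_finite_induct) (simp_all add: E14_functional_add zero)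
  have eq: "(\<Sum>i<2. \<Sum>j<7. c (i, j) * E14_functional (v ^ (k + i) * gy ^ (l + j))) = 0" for k l
  proof -
    have "v ^ k * gy ^ l * (\<Sum>a\<in>{..<2} \<times> {..<7}. const_germ (c a) * (case a of (i, j) \<Rightarrow> v ^ i * gy ^ j))
        = (\<Sum>i<2. \<Sum>j<7. const_germ (c (i, j)) * (v ^ (k + i) * gy ^ (l + j)))"
      unfolding sum_distrib_left sum.cartesian_product
      by (intro sum.cong) (auto simp: power_add mult_ac)
    then have "(\<Sum>i<2. \<Sum>j<7. const_germ (c (i, j)) * (v ^ (k + i) * gy ^ (l + j))) \<in> ideal_gen2 p q"
      using ideal_gen2_closed(3)[OF assms(1), of "v ^ k * gy ^ l"] by simp
    from E14_functional_ideal[OF this] show ?thesis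
      by (simp add: sum E14_functional_const_mult)
  qed
  have eq': "(\<Sum>j<7. c (0, j) * E14_functional (v ^ k * gy ^ (l + j))) + (\<Sum>j<7. c (1, j) * E14_functional (v ^ (k + 1) * gy ^ (l + j))) = 0" for k l
    using eq[of k l] by (simp add: lessThan_nat_numeral[of "Num.Bit0 Num.One"] add.commute)
  note F = E14_functional_monomial
  \<comment> \<open>The value on v^2. It enters only \<open>e1\<close> at l = 0, next to
    \<open>c (1, 0)\<close>, which is known to vanish by then.\<close>
  define \<kappa> where "\<kappa> = - (16 + 40 * b * s ^ 2 + 12 * b ^ 2 * s ^ 4) * s ^ 2"
  have F0: "E14_functional (v ^ 0 * gy ^ n) = (if n = 8 then 27 * s ^ 10 else 0)"
    and F1: "E14_functional (v ^ 1 * gy ^ n) = (if n = 6 then 9 * s ^ 10 else 0)"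
    and F2: "E14_functional (v ^ (1 + 1) * gy ^ n) = (if n = 2 then - 6 * b * s ^ 8 else if n = 0 then \<kappa> else 0)" for n
    using F[of 0 n] F[of 1 n] F[of "1 + 1" n] by (auto simp: \<kappa>_def)
  have e1: "(\<Sum>j<7. c (0, j) * (if l + j = 6 then 9 * s ^ 10 else 0))
      + (\<Sum>j<7. c (1, j) * (if l + j = 2 then - 6 * b * s ^ 8 else if l + j = 0 then \<kappa> else 0)) = 0" for l
    using eq'[of 1 l] unfolding F1 F2 .
  have e0: "(\<Sum>j<7. c (0, j) * (if l + j = 8 then 27 * s ^ 10 else 0))
      + (\<Sum>j<7. c (1, j) * (if l + j = 6 then 9 * s ^ 10 else 0)) = 0" for l
    using eq'[of 0 l] unfolding add_0 F0 F1 .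
  have c1: "c (0, 0) = 0" "c (0, 1) = 0" "c (0, 2) = 0" "c (0, 3) = 0"
    using e1[of 6] e1[of 5] e1[of 4] e1[of 3] s by (simp_all add: lessThan_nat_numeral)
  have c2: "c (1, 0) = 0" "c (1, 1) = 0" "c (1, 5) = 0" "c (1, 6) = 0"
    using e0[of 6] e0[of 5] e0[of 1] e0[of 0] c1 s by (simp_all add: lessThan_nat_numeral)
  have c3: "c (0, 4) = 0" "c (0, 5) = 0"
    using e1[of 2] e1[of 1] c2 s by (simp_all add: lessThan_nat_numeral)
  have c4: "c (1, 2) = 0" "c (1, 3) = 0"
    using e0[of 4] e0[of 3] c3 s by (simp_all add: lessThan_nat_numeral)
  have c5: "c (0, 6) = 0"
    using e1[of 0] c2 c4 s by (simp_all add: lessThan_nat_numeral)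
  have c6: "c (1, 4) = 0"
    using e0[of 2] c5 s by (simp_all add: lessThan_nat_numeral)
  obtain i j where a: "a = (i, j)" "i < 2" "j < 7" using assms(2) by auto
  from a(2) have "i = 0 \<or> i = 1" by auto
  moreover from a(3) have "j = 0 \<or> j = 1 \<or> j = 2 \<or> j = 3 \<or> j = 4 \<or> j = 5 \<or> j = 6" by auto
  ultimately show ?thesis using a(1) c1 c2 c3 c4 c5 c6 by auto
qed

end

subsection \<open>Upper semicontinuity of the Milnor number\<close>

lemma hol_family_holomorphic_germ:
  assumes "hol_family S r (\<lambda>s x y. f s (point2 x y))" "r > 0" "s \<in> S"
  shows "holomorphic_germ (f s)"
  using hol_family_compose[OF assms(1), of "{0}" "\<lambda>_. s"] assms(2,3)
  by (intro hol2_imp_holomorphic_germ[of r]) auto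

lemma hol_family_ring:
  assumes "hol_family S r F" "hol_family S r G"
  shows "hol_family S r (\<lambda>s x y. F s x y + G s x y)" "hol_family S r (\<lambda>s x y. F s x y * G s x y)"
    "hol_family S r (\<lambda>s x y. F s x y - G s x y)"
  using assms unfolding hol_family_def case_prod_unfold
  by (auto intro!: continuous_intros holomorphic_intros)

lemma hol_family_const:
  assumes "hol_family S r F" "s0 \<in> S" shows "hol_family T r (\<lambda>_. F s0)"
  using hol_family_compose[OF assms(1), of T "\<lambda>_. s0"] assms(2) by auto

text \<open>The coefficient is the value at 0 of an iterated difference quotient, and these
  quotients again form a \<open>hol_family\<close>, which is jointly continuous.\<close>

lemma continuous_on_germ_coeff:
  assumes "hol_family S r (\<lambda>s x y. f s (point2 x y))" "r > 0"
  shows "continuous_on S (\<lambda>s. germ_coeff (germ_of (f s)) i j)"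
proof -
  define D where "D = (\<lambda>k f z. diff_quot (\<lambda>t. f (set_coord k t z)) (z $ k))"
  have D: "hol_family S r (\<lambda>s x y. ((D k ^^ n) (f s)) (point2 x y))"
    "\<forall>s\<in>S. (coord_quot k ^^ n) (germ_of (f s)) = germ_of ((D k ^^ n) (f s))"
    if "hol_family S r (\<lambda>s x y. f s (point2 x y))" for f k n
  proof (induction n)
    case (Suc n)
    { case 1 show ?case
        using hol_family_coord_quot[OF Suc.IH(1) assms(2), of k] by (simp add: D_def) }
    { case 2 show ?case
        using Suc.IH(2) hol_family_holomorphic_germ[OF Suc.IH(1) assms(2)]
        by (auto simp: coord_quot.abs_eq germ_rel_def D_def) }
  qed (use that in simp_all)
  have F: "hol_family S r (\<lambda>s x y. ((D 1 ^^ i) ((D 2 ^^ j) (f s))) (point2 x y))"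
    by (intro D assms)
  have "germ_coeff (germ_of (f s)) i j = ((D 1 ^^ i) ((D 2 ^^ j) (f s))) (point2 0 0)" if "s \<in> S" for s
  proof -
    have "germ_coeff (germ_of (f s)) i j = germ_value (germ_of ((D 1 ^^ i) ((D 2 ^^ j) (f s))))"
      using D(2)[OF assms(1)] D(2)[OF D(1)[OF assms(1)]] that by (simp add: germ_coeff_def)
    also have "\<dots> = ((D 1 ^^ i) ((D 2 ^^ j) (f s))) 0"
      using hol_family_holomorphic_germ[OF F assms(2) that]
      by (intro germ_value.abs_eq) (simp add: germ_rel_def)
    finally show ?thesis by simp
  qed
  moreover have "continuous_on S (\<lambda>s. ((D 1 ^^ i) ((D 2 ^^ j) (f s))) (point2 0 0))"
  proof -
    have "continuous_on (S \<times> ball 0 r \<times> ball 0 r) (\<lambda>(s, x, y). ((D 1 ^^ i) ((D 2 ^^ j) (f s))) (point2 x y))"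
      using F unfolding hol_family_def by blast
    from continuous_on_compose2[OF this, of S "\<lambda>s. (s, 0, 0)"] assms(2) show ?thesis
      by (force intro!: continuous_intros)
  qed
  ultimately show ?thesis by (simp cong: continuous_on_cong)
qed

text \<open>The system \<open>e = \<epsilon> e\<close> modulo \<open>W\<close> has only the trivial solution if the rows of \<open>\<epsilon>\<close> are small;
  eliminating one unknown preserves the bound on the rows.\<close>

lemma small_perturbation_mem:
  assumes W: "germ_subspace W" and "finite K"
    and "\<And>k. k \<in> K \<Longrightarrow> e k - (\<Sum>l\<in>K. const_germ (\<epsilon> k l) * e l) \<in> W"
    and "\<And>k. k \<in> K \<Longrightarrow> (\<Sum>l\<in>K. norm (\<epsilon> k l)) < 1"
    and "k \<in> K"
  shows "e k \<in> W"
  using assms(2-)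
proof (induction K arbitrary: \<epsilon> k rule: finite_induct)
  case (insert a K)
  note S = germ_subspaceD[OF W]
  \<comment> \<open>Solving row a for \<open>e a\<close> divides by d; substitution into row k then
    produces the coefficients \<delta>.\<close>
  define d where "d = 1 - \<epsilon> a a"
  define \<delta> where "\<delta> = (\<lambda>k l. \<epsilon> k l + \<epsilon> k a * \<epsilon> a l / d)"
  have row: "norm (\<epsilon> k a) + (\<Sum>l\<in>K. norm (\<epsilon> k l)) < 1" if "k \<in> insert a K" for k
    using insert.prems(2)[OF that] insert.hyps by simp
  have nd: "1 - norm (\<epsilon> a a) \<le> norm d"
    unfolding d_def by (metis norm_one norm_triangle_ineq2)
  then have sum_a: "(\<Sum>l\<in>K. norm (\<epsilon> a l)) < norm d" using row[of a] by simp
  moreover have "0 \<le> (\<Sum>l\<in>K. norm (\<epsilon> a l))" by (intro sum_nonneg) simp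
  ultimately have d0: "d \<noteq> 0" by auto
  have scale: "const_germ d * (const_germ (x / d) * g) = const_germ x * g" for x g
    using d0 by (simp add: mult.assoc[symmetric] flip: const_germ_mult)
  have scale': "const_germ (x * y / d) * g = const_germ x * (const_germ (y / d) * g)" for x y g
    by (simp only: times_divide_eq_right[symmetric] const_germ_mult mult.assoc)
  have ea: "e a - (\<Sum>l\<in>K. const_germ (\<epsilon> a l / d) * e l) \<in> W"
  proof (rule germ_subspace_cancel[OF W _ d0])
    have "const_germ d * (e a - (\<Sum>l\<in>K. const_germ (\<epsilon> a l / d) * e l))
        = const_germ d * e a - (\<Sum>l\<in>K. const_germ (\<epsilon> a l) * e l)"
      by (simp add: right_diff_distrib sum_distrib_left scale)
    also have "\<dots> = e a - (\<Sum>l\<in>insert a K. const_germ (\<epsilon> a l) * e l)"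
      using insert.hyps by (simp add: d_def const_germ_diff algebra_simps)
    also have "\<dots> \<in> W" by (rule insert.prems) simp
    finally show "const_germ d * (e a - (\<Sum>l\<in>K. const_germ (\<epsilon> a l / d) * e l)) \<in> W" .
  qed
  have K: "e k \<in> W" if "k \<in> K" for k
  proof (rule insert.IH[where \<epsilon> = \<delta>, OF _ _ that])
    fix k assume k: "k \<in> K"
    have "(\<Sum>l\<in>K. const_germ (\<delta> k l) * e l)
        = (\<Sum>l\<in>K. const_germ (\<epsilon> k l) * e l) + const_germ (\<epsilon> k a) * (\<Sum>l\<in>K. const_germ (\<epsilon> a l / d) * e l)"
      by (simp add: \<delta>_def const_germ_add distrib_right sum.distrib sum_distrib_left scale')
    then have "e k - (\<Sum>l\<in>K. const_germ (\<delta> k l) * e l)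
        = (e k - (\<Sum>l\<in>insert a K. const_germ (\<epsilon> k l) * e l))
          + const_germ (\<epsilon> k a) * (e a - (\<Sum>l\<in>K. const_germ (\<epsilon> a l / d) * e l))"
      using insert.hyps by (simp add: algebra_simps)
    also have "\<dots> \<in> W" using k by (intro S(2) S(3) ea insert.prems) simp
    finally show "e k - (\<Sum>l\<in>K. const_germ (\<delta> k l) * e l) \<in> W" .
    \<comment> \<open>Off the diagonal, row a sums to less than 1 - |\<epsilon> a a| \<le> |d|. So
      the correction to row k is at most |\<epsilon> k a|, the entry that the elimination
      removes.\<close>
    have "(\<Sum>l\<in>K. norm (\<delta> k l)) \<le> (\<Sum>l\<in>K. norm (\<epsilon> k l) + norm (\<epsilon> k a) * norm (\<epsilon> a l) / norm d)"
      by (intro sum_mono) (metis \<delta>_def norm_triangle_ineq norm_mult norm_divide)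
    also have "\<dots> = (\<Sum>l\<in>K. norm (\<epsilon> k l)) + norm (\<epsilon> k a) * ((\<Sum>l\<in>K. norm (\<epsilon> a l)) / norm d)"
      by (simp add: sum.distrib sum_distrib_left sum_divide_distrib)
    also have "\<dots> \<le> (\<Sum>l\<in>K. norm (\<epsilon> k l)) + norm (\<epsilon> k a) * 1"
      using sum_a d0 by (intro add_left_mono mult_left_mono) (simp_all add: divide_le_eq)
    also have "\<dots> < 1" using row[of k] k by simp
    finally show "(\<Sum>l\<in>K. norm (\<delta> k l)) < 1" .
  qed
  show ?case
  proof (cases "k = a")
    case True
    have "(\<Sum>l\<in>K. const_germ (\<epsilon> a l / d) * e l) \<in> W"
      using K by (induction K rule: infinite_finite_induct) (auto intro: S)
    from S(2)[OF ea this] True show ?thesis by simp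
  next
    case False
    then show ?thesis using K insert.prems(3) by simp
  qed
qed simp

text \<open>The m + 1 powers 1, ..., u^m are dependent in an algebra of dimension m. The lowest
  power u^l in a nontrivial relation factors out, and its cofactor has nonzero value at 0, hence is
  a unit; so the ideal contains u^l with l \<le> m.\<close>

lemma power_mem_gradient_ideal:
  fixes f :: "complex^2 \<Rightarrow> complex"
  assumes "milnor f = enat m" "germ_value u = 0"
  shows "u ^ m \<in> gradient_ideal f"
proof -
  define p q where "p = germ_of (partial_deriv 1 f)" and "q = germ_of (partial_deriv 2 f)"
  have grad_eq: "gradient_ideal f = ideal_gen2 p q" by (simp add: gradient_ideal_2 p_def q_def)
  interpret germ_quotient "ideal_gen2 p q" by (rule germ_quotient.intro) (rule ideal_ideal_gen2)
  show ?thesis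
  proof (cases "1 \<in> ideal_gen2 p q")
    case True
    from ideal_gen2_closed(3)[OF True, of "u ^ m"] show ?thesis by (simp add: grad_eq)
  next
    case False
    have "Q.dimension m K (carrier Q)" using milnor_eq_enatD[OF assms(1)] by (simp add: grad_eq)
    from dependent_if_dimension_less[OF _ False this, of "{..m}" "\<lambda>k. u ^ k"]
    obtain c a where ca: "(\<Sum>k\<le>m. const_germ (c k) * u ^ k) \<in> ideal_gen2 p q" "a \<le> m" "c a \<noteq> 0"
      by auto
    define l where "l = (LEAST k. c k \<noteq> 0)"
    have l: "c l \<noteq> 0" "l \<le> a"
      unfolding l_def by (rule LeastI[where P = "\<lambda>k. c k \<noteq> 0", OF ca(3)],
        rule Least_le[where P = "\<lambda>k. c k \<noteq> 0", OF ca(3)])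
    have l0: "c k = 0" if "k < l" for k
      using not_less_Least[of k "\<lambda>k. c k \<noteq> 0"] that by (simp add: l_def)
    define w where "w = (\<Sum>k\<in>{l..m}. const_germ (c k) * u ^ (k - l))"
    have "(\<Sum>k\<le>m. const_germ (c k) * u ^ k) = (\<Sum>k\<in>{l..m}. const_germ (c k) * u ^ k)"
      by (rule sum.mono_neutral_right) (auto simp: l0)
    also have "\<dots> = u ^ l * w"
      unfolding w_def sum_distrib_left
    proof (rule sum.cong[OF refl])
      fix k assume "k \<in> {l..m}"
      then have "u ^ k = u ^ l * u ^ (k - l)" by (simp flip: power_add)
      then show "const_germ (c k) * u ^ k = u ^ l * (const_germ (c k) * u ^ (k - l))"
        by (simp only: mult_ac)
    qed
    finally have "u ^ l * w \<in> ideal_gen2 p q" using ca(1) by simp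
    moreover have "germ_value w = (\<Sum>k\<in>{l..m}. germ_value (const_germ (c k) * u ^ (k - l)))"
      unfolding w_def by (rule germ_value_sum)
    moreover have "\<dots> = (\<Sum>k\<in>{l..m}. if k = l then c k else 0)"
      by (intro sum.cong) (auto simp: assms(2) power_0_left)
    ultimately have "u ^ l * w \<in> ideal_gen2 p q" "germ_value w \<noteq> 0" using l ca(2) by simp_all
    then have "u ^ l \<in> ideal_gen2 p q" by (rule ideal_unit_cancel)
    then show ?thesis
      unfolding grad_eq by (rule ideal_gen2_dvd) (use l(2) ca(2) in \<open>auto intro: le_imp_power_dvd\<close>)
  qed
qed

text \<open>The germs that agree with their Taylor polynomial modulo I form a subspace. Monomials
  below degree n are their own polynomial, and multiples of monomials of degree n have polynomial
  0.\<close>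

lemma germ_coeff_expansion:
  assumes I: "germ_subspace I" and high: "\<And>i j h. i + j = n \<Longrightarrow> gx ^ i * gy ^ j * h \<in> I"
  shows "g - (\<Sum>(i, j)\<in>{(i, j). i + j < n}. const_germ (germ_coeff g i j) * (gx ^ i * gy ^ j)) \<in> I"
proof -
  define K where "K = {(i :: nat, j :: nat). i + j < n}"
  have "K \<subseteq> {..<n} \<times> {..<n}" by (auto simp: K_def)
  then have fin: "finite K" by (rule finite_subset) simp
  define T where "T = (\<lambda>g. \<Sum>(i, j)\<in>K. const_germ (germ_coeff g i j) * (gx ^ i * gy ^ j))"
  define W where "W = {g. g - T g \<in> I}"
  note S = germ_subspaceD[OF I]
  have T: "T (g + h) = T g + T h" "T (const_germ c * g) = const_germ c * T g" for g h c
    unfolding T_def germ_coeff_add germ_coeff_const_mult const_germ_add const_germ_mult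
    by (simp_all add: case_prod_unfold distrib_right sum.distrib sum_distrib_left mult.assoc)
  have "germ_subspace W"
    unfolding germ_subspace_def
  proof (intro conjI ballI allI)
    show "0 \<in> W" using S(1) by (simp add: W_def T_def case_prod_unfold)
  next
    fix g h assume "g \<in> W" "h \<in> W"
    then show "g + h \<in> W" using S(2)[of "g - T g" "h - T h"] by (simp add: W_def T algebra_simps)
  next
    fix c g assume "g \<in> W"
    then show "const_germ c * g \<in> W" using S(3)[of "g - T g" c] by (simp only: W_def mem_Collect_eq T right_diff_distrib)
  qed
  then have "g \<in> W"
  proof (rule germ_subspace_eq_UNIV[OF _ germ_split, where n = n])
    fix i j :: nat assume ij: "i + j < n"
    have "T (gx ^ i * gy ^ j) = (\<Sum>k\<in>K. if k = (i, j) then gx ^ i * gy ^ j else 0)"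
      unfolding T_def
    proof (rule sum.cong[OF refl])
      fix k
      show "(case k of (a, b) \<Rightarrow> const_germ (germ_coeff (gx ^ i * gy ^ j) a b) * (gx ^ a * gy ^ b))
          = (if k = (i, j) then gx ^ i * gy ^ j else 0)"
        by (cases k; cases "fst k = i"; cases "snd k = j") (auto simp: germ_coeff_monomial)
    qed
    also have "\<dots> = gx ^ i * gy ^ j" using ij fin by (simp add: K_def)
    finally show "gx ^ i * gy ^ j \<in> W" using S(1) by (simp add: W_def)
  next
    fix i j h assume ij: "i + j = n"
    have "T (gx ^ i * gy ^ j * h) = 0"
      unfolding T_def
    proof (intro sum.neutral ballI, clarify)
      fix k l assume "(k, l) \<in> K"
      then have "\<not> (i \<le> k \<and> j \<le> l)" using ij by (auto simp: K_def)
      then show "const_germ (germ_coeff (gx ^ i * gy ^ j * h) k l) * (gx ^ k * gy ^ l) = 0"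
        by (auto simp: mult.assoc germ_coeff_monomial_mult)
    qed
    then show "gx ^ i * gy ^ j * h \<in> W" using high[OF ij] by (simp add: W_def)
  qed
  then show ?thesis by (simp add: W_def T_def K_def)
qed

lemma milnor_0_if_unit:
  fixes f :: "complex^2 \<Rightarrow> complex"
  assumes "1 \<in> gradient_ideal f" shows "milnor f = 0"
proof -
  define p q where "p = germ_of (partial_deriv 1 f)" and "q = germ_of (partial_deriv 2 f)"
  have grad_eq: "gradient_ideal f = ideal_gen2 p q" by (simp add: gradient_ideal_2 p_def q_def)
  interpret germ_quotient "ideal_gen2 p q" by (rule germ_quotient.intro) (rule ideal_ideal_gen2)
  have "Q.dimension 0 K (carrier Q)" using assms dimension_0 by (simp add: grad_eq)
  then have "milnor f \<le> enat 0"
    unfolding milnor_def milnor_algebra_def milnor_scalars_def const_germ_eq grad_eq by (intro Inf_lower) auto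
  then show ?thesis by (simp add: enat_0)
qed

text \<open>At s = 0 each monomial is a combination of the \<open>b l\<close> plus an element of the
  gradient ideal. Keeping the cofactors and moving the generators to s leaves an error with small
  Taylor coefficients, so modulo the span at s the monomials satisfy the system of
  \<open>small_perturbation_mem\<close>.\<close>

lemma milnor_upper_semicontinuous:
  fixes f :: "complex \<Rightarrow> complex^2 \<Rightarrow> complex"
  assumes f: "holomorphic_germ_pair f" and "finite A"
    and span: "\<And>g. g \<in> span_mod (gradient_ideal (f 0)) A b"
    and m: "\<forall>\<^sub>F s in at 0. milnor (f s) = enat m"
  shows "m \<le> card A"
proof -
  obtain r where r: "r > 0" "hol_family (ball 0 r) r (\<lambda>s x y. f s (point2 x y))"
    using f by (rule holomorphic_germ_pair_family)
  define q where "q = r / 2"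
  have q: "0 < q" "q < r" using r by (auto simp: q_def)
  define P where "P = (\<lambda>i s. germ_of (partial_deriv i (f s)))"
  have fam: "hol_family (ball 0 r) q (\<lambda>s x y. partial_deriv i (f s) (point2 x y))" for i :: 2
    using hol_family_partial_deriv[OF r(2) q] .
  have hol: "holomorphic_germ (partial_deriv i (f s))" if "s \<in> ball 0 r" for s and i :: 2
    using hol_family_holomorphic_germ[OF fam q(1) that] .
  have grad_eq: "gradient_ideal (f s) = ideal_gen2 (P 1 s) (P 2 s)" for s
    by (simp add: gradient_ideal_2 P_def)
  \<comment> \<open>The finite index set is fixed before s, so that smallness can be had for all its
    coefficients at once.\<close>
  define K where "K = {(i :: nat, j :: nat). i + j < 2 * m}"
  have "K \<subseteq> {..<2 * m} \<times> {..<2 * m}" by (auto simp: K_def)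
  then have fin: "finite K" by (rule finite_subset) simp
  define e where "e = (\<lambda>(i, j). gx ^ i * gy ^ j)"
  have "\<exists>c a d. e k - (\<Sum>l\<in>A. const_germ (c l) * b l) = a * P 1 0 + d * P 2 0" for k
    using span[of "e k"] by (auto simp: span_mod_def grad_eq ideal_gen2_def)
  then obtain c a d where e: "\<And>k. e k - (\<Sum>l\<in>A. const_germ (c k l) * b l) = a k * P 1 0 + d k * P 2 0"
    by metis
  \<comment> \<open>The cofactors \<open>a k\<close> and \<open>d k\<close> do not depend on s; only
    the generators move.\<close>
  define R where "R = (\<lambda>k s. a k * (P 1 0 - P 1 s) + d k * (P 2 0 - P 2 s))"
  define \<epsilon> where "\<epsilon> = (\<lambda>s k (i, j). germ_coeff (R k s) i j)"
  have cont: "((\<lambda>s. \<epsilon> s k l) \<longlongrightarrow> 0) (at 0)" for k l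
  proof -
    obtain i j where l: "l = (i, j)" by (cases l)
    obtain t where t: "t > 0" "hol2 t (rep_germ (a k))"
      using germ_of_rep(2) by (rule holomorphic_germ_imp_hol2)
    obtain u where u: "u > 0" "hol2 u (rep_germ (d k))"
      using germ_of_rep(2) by (rule holomorphic_germ_imp_hol2)
    \<comment> \<open>A common radius for the representatives of the cofactors and for the partial
      derivatives.\<close>
    define w where "w = min q (min t u)"
    have w: "w > 0" "w \<le> q" "w \<le> t" "w \<le> u" using q t u by (auto simp: w_def)
    define G where "G = (\<lambda>s z. rep_germ (a k) z * (partial_deriv 1 (f 0) z - partial_deriv 1 (f s) z)
       + rep_germ (d k) z * (partial_deriv 2 (f 0) z - partial_deriv 2 (f s) z))"
    have G: "hol_family (ball 0 r) w (\<lambda>s x y. G s (point2 x y))"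
      unfolding G_def using w r
      by (intro hol_family_ring hol_family_const[OF hol_family_subset[OF t(2) order_refl], of w 0]
          hol_family_const[OF hol_family_subset[OF u(2) order_refl], of w 0]
          hol_family_const[OF hol_family_subset[OF fam order_refl], of w 0]
          hol_family_subset[OF fam]) auto
    have R: "R k s = germ_of (G s)" if s: "s \<in> ball 0 r" for s
    proof -
      have neg: "germ_of (\<lambda>z. g z - h z) = germ_of g - germ_of h"
        "holomorphic_germ (\<lambda>z. g z - h z)" if "holomorphic_germ g" "holomorphic_germ h" for g h :: "complex^2 \<Rightarrow> complex"
        using that holomorphic_germ_uminus[of h] holomorphic_germ_add[of g "\<lambda>z. - h z"]
          germ_of_simps(3)[of g "\<lambda>z. - h z"] uminus_germ.abs_eq[of h]
        by (simp_all add: germ_rel_def)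
      show ?thesis
        unfolding G_def R_def P_def using hol[OF s] hol[of 0] r
        by (simp add: germ_of_simps neg germ_of_rep holomorphic_germ_mult)
    qed
    have "continuous_on (ball 0 r) (\<lambda>s. germ_coeff (germ_of (G s)) i j)"
      using continuous_on_germ_coeff[OF G w(1)] .
    then have lim: "((\<lambda>s. germ_coeff (germ_of (G s)) i j) \<longlongrightarrow> germ_coeff (germ_of (G 0)) i j) (at 0)"
      using r by (simp add: continuous_on_eq_continuous_at isCont_def)
    have lim0: "germ_coeff (germ_of (G 0)) i j = 0"
      using R[of 0] r by (simp add: R_def flip: R)
    have "\<forall>\<^sub>F s in at 0. s \<in> ball (0 :: complex) r"
      using r by (intro eventually_at_in_open') auto
    then have "\<forall>\<^sub>F s in at 0. germ_coeff (germ_of (G s)) i j = \<epsilon> s k l"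
      by eventually_elim (simp add: \<epsilon>_def l R)
    from Lim_transform_eventually[OF lim this] lim0 show ?thesis by simp
  qed
  have "\<forall>\<^sub>F s in at 0. \<forall>k\<in>K. (\<Sum>l\<in>K. norm (\<epsilon> s k l)) < 1"
  proof (rule eventually_ball_finite[OF fin], intro ballI)
    fix k
    have "((\<lambda>s. \<Sum>l\<in>K. norm (\<epsilon> s k l)) \<longlongrightarrow> (\<Sum>l\<in>K. 0)) (at 0)"
      by (rule tendsto_sum) (rule tendsto_norm_zero, rule cont)
    then show "\<forall>\<^sub>F s in at 0. (\<Sum>l\<in>K. norm (\<epsilon> s k l)) < 1"
      by (simp add: order_tendstoD(2))
  qed
  with m have "\<forall>\<^sub>F s in at 0. milnor (f s) = enat m \<and> (\<forall>k\<in>K. (\<Sum>l\<in>K. norm (\<epsilon> s k l)) < 1)"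
    by eventually_elim auto
  \<comment> \<open>A single s suffices, since m is the Milnor number for all small s \<noteq>
    0.\<close>
  then obtain s where s: "milnor (f s) = enat m" "\<And>k. k \<in> K \<Longrightarrow> (\<Sum>l\<in>K. norm (\<epsilon> s k l)) < 1"
    using eventually_happens'[OF at_neq_bot] by blast
  define J where "J = ideal_gen2 (P 1 s) (P 2 s)"
  have J: "germ_subspace J" by (simp add: J_def germ_subspace_ideal_gen2)
  define W where "W = span_mod J A b"
  have W: "germ_subspace W" unfolding W_def by (rule germ_subspace_span_mod[OF J])
  note S = germ_subspaceD[OF W]
  have JW: "g \<in> W" if "g \<in> J" for g using that by (simp add: W_def ideal_subset_span_mod)
  have high: "gx ^ i * gy ^ j * h \<in> J" if "i + j = 2 * m" for i j h
  proof -
    have "gx ^ m \<in> J" "gy ^ m \<in> J"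
      using power_mem_gradient_ideal[OF s(1)] by (simp_all add: J_def grad_eq)
    moreover have "gx ^ m dvd gx ^ i * gy ^ j * h \<or> gy ^ m dvd gx ^ i * gy ^ j * h"
    proof -
      have "m \<le> i \<or> m \<le> j" using that by linarith
      then show ?thesis by (auto intro: dvd_mult2 dvd_mult le_imp_power_dvd)
    qed
    ultimately show ?thesis unfolding J_def using ideal_gen2_dvd by blast
  qed
  have base: "(\<Sum>l\<in>A. const_germ (c k l) * b l) \<in> W" for k
    unfolding W_def span_mod_def using germ_subspaceD(1)[OF J] by (intro CollectI exI[of _ "c k"]) simp
  have eW: "e k \<in> W" if "k \<in> K" for k
  proof (rule small_perturbation_mem[OF W fin _ s(2) that])
    fix k assume "k \<in> K"
    \<comment> \<open>Modulo the gradient ideal at s the error equals its Taylor polynomial, so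
      \<open>e k\<close> is a small combination of the \<open>e l\<close> modulo W.\<close>
    have "R k s - (\<Sum>l\<in>K. const_germ (\<epsilon> s k l) * e l) \<in> J"
      using germ_coeff_expansion[OF J high, of "2 * m" "R k s"]
      by (simp add: K_def \<epsilon>_def e_def case_prod_unfold)
    moreover have "a k * P 1 s + d k * P 2 s \<in> J" by (auto simp: J_def ideal_gen2_def)
    ultimately have "(\<Sum>l\<in>A. const_germ (c k l) * b l) + (a k * P 1 s + d k * P 2 s)
        + (R k s - (\<Sum>l\<in>K. const_germ (\<epsilon> s k l) * e l)) \<in> W"
      by (intro S(2) base JW)
    also have "(\<Sum>l\<in>A. const_germ (c k l) * b l) = e k - (a k * P 1 0 + d k * P 2 0)"
      using e[of k] by (simp add: algebra_simps)
    finally show "e k - (\<Sum>l\<in>K. const_germ (\<epsilon> s k l) * e l) \<in> W"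
      by (simp add: R_def algebra_simps)
  qed
  have all: "g \<in> W" for g
  proof (rule germ_subspace_eq_UNIV[OF W germ_split, where n = "2 * m"])
    show "gx ^ i * gy ^ j \<in> W" if "i + j < 2 * m" for i j
      using eW[of "(i, j)"] that by (simp add: K_def e_def)
    show "gx ^ i * gy ^ j * h \<in> W" if "i + j = 2 * m" for i j h
      using JW[OF high[OF that]] .
  qed
  show ?thesis
  proof (cases "1 \<in> J")
    case True
    then show ?thesis using milnor_0_if_unit[of "f s"] s(1) by (simp add: grad_eq J_def zero_enat_def)
  next
    case False
    interpret germ_quotient J by (rule germ_quotient.intro) (simp add: J_def ideal_ideal_gen2)
    have dim: "Q.dimension m (range (\<lambda>c. J +>\<^bsub>germ_ring\<^esub> const_germ c)) (carrier Q)"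
      using milnor_eq_enatD[OF s(1)] by (simp add: grad_eq J_def)
    show ?thesis
      by (rule dimension_le[OF \<open>finite A\<close> False dim, where b = b])
         (use all in \<open>auto simp: W_def span_mod_def\<close>)
  qed
qed

subsection \<open>The deformation of jump one\<close>

text \<open>Functions equal near 0 are equal near every point close to 0, and a partial derivative
  at such a point sees only the function near it. A deformation agrees with the singularity at s = 0
  only as a germ, so this is what identifies the gradient ideals.\<close>

lemma germ_of_partial_deriv_cong:
  fixes f g :: "complex^2 \<Rightarrow> complex"
  assumes "holomorphic_germ f" "holomorphic_germ g" "\<forall>\<^sub>F z in nhds 0. f z = g z"
  shows "germ_of (partial_deriv i f) = germ_of (partial_deriv i g)"
proof -
  have "\<forall>\<^sub>F z in nhds 0. \<forall>\<^sub>F w in nhds z. f w = g w"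
    using assms(3) by (simp add: eventually_eventually)
  then have "\<forall>\<^sub>F z in nhds 0. partial_deriv i f z = partial_deriv i g z"
  proof eventually_elim
    case (elim z)
    have "continuous_on UNIV (\<lambda>t. z + axis i t)"
    proof -
      have "continuous_on UNIV (\<lambda>t. if j = i then t else (0 :: complex))" for j by (cases "j = i") auto
      then show ?thesis unfolding axis_def by (intro continuous_intros continuous_on_vec_lambda)
    qed
    then have "isCont (\<lambda>t. z + axis i t) 0" by (simp add: continuous_on_eq_continuous_at)
    moreover have "z + axis i 0 = z" by (simp add: axis_def vec_eq_iff)
    ultimately have "filterlim (\<lambda>t. z + axis i t) (nhds z) (nhds 0)"
      using tendsto_at_iff_tendsto_nhds[of "\<lambda>t. z + axis i t" 0] unfolding isCont_def by metis
    then have "\<forall>\<^sub>F t in nhds 0. f (z + axis i t) = g (z + axis i t)"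
      using elim by (rule eventually_compose_filterlim[rotated])
    then show ?case unfolding partial_deriv_def by (rule deriv_cong_ev) simp
  qed
  then show ?thesis using assms by (simp add: germ_of_eq_iff holomorphic_germ_partial_deriv)
qed

context
  fixes b :: complex
begin

definition W10 :: "complex^2 \<Rightarrow> complex" where
  "W10 z = (z$1)^4 + (z$2)^6 + b * (z$1)^2 * (z$2)^4"

definition W10_deformation :: "complex \<Rightarrow> complex^2 \<Rightarrow> complex" where
  "W10_deformation s z = (z$1)^4 + ((z$2)^2 + s * z$1)^3 + b * (z$1)^2 * ((z$2)^2 + s * z$1)^2"

lemma W10_deformation_0: "W10_deformation 0 = W10"
  by (simp add: fun_eq_iff W10_deformation_def W10_def flip: power_mult)

lemma holomorphic_germ_W10_deformation: "holomorphic_germ (W10_deformation s)"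
  unfolding W10_deformation_def by (intro holomorphic_germ_intros)

lemma partial_deriv_W10_deformation:
  "partial_deriv 1 (W10_deformation s) z = 4 * (z$1)^3 + (2 * b) * z$1 * ((z$2)^2 + s * z$1)^2
     + s * (3 * ((z$2)^2 + s * z$1)^2 + (2 * b) * (z$1)^2 * ((z$2)^2 + s * z$1))"
  "partial_deriv 2 (W10_deformation s) z
     = 2 * z$2 * (3 * ((z$2)^2 + s * z$1)^2 + (2 * b) * (z$1)^2 * ((z$2)^2 + s * z$1))"
  unfolding partial_deriv_def W10_deformation_def
  by (rule DERIV_imp_deriv, (rule derivative_eq_intros refl | simp add: axis_def)+,
      simp add: axis_def algebra_simps power_numeral_reduce)+

lemma gradient_ideal_W10_deformation:
  defines "v \<equiv> \<lambda>s. gy ^ 2 + const_germ s * gx"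
  shows "gradient_ideal (W10_deformation s) = ideal_gen2
    (4 * gx ^ 3 + const_germ (2 * b) * gx * v s ^ 2 + const_germ s * (3 * v s ^ 2 + const_germ (2 * b) * gx ^ 2 * v s))
    (2 * gy * (3 * v s ^ 2 + const_germ (2 * b) * gx ^ 2 * v s))"
  unfolding gradient_ideal_2 ext[OF partial_deriv_W10_deformation(1)] ext[OF partial_deriv_W10_deformation(2)] v_def
  by (simp add: germ_of_simps germ_of_power holomorphic_germ_intros)

lemma gradient_ideal_W10:
  "gradient_ideal W10 = ideal_gen2 (4 * gx ^ 3 + const_germ (2 * b) * gx * gy ^ 4)
     (6 * gy ^ 5 + const_germ (4 * b) * gx ^ 2 * gy ^ 3)"
proof -
  have "const_germ (4 * b) = (2 :: 2 germ) * const_germ (2 * b)"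
    by (simp add: const_germ_mult)
  then have "2 * gy * (3 * (gy ^ 2) ^ 2 + const_germ (2 * b) * gx ^ 2 * gy ^ 2) = 6 * gy ^ 5 + const_germ (4 * b) * gx ^ 2 * gy ^ 3"
    by (simp add: algebra_simps power_numeral_reduce)
  then show ?thesis
    using gradient_ideal_W10_deformation[of 0] by (simp add: W10_deformation_0 flip: power_mult)
qed

lemma milnor_W10: "milnor W10 = 15"
proof -
  have "milnor W10 = enat (card ({..<3 :: nat} \<times> {..<5 :: nat}))"
  proof (rule milnor_eqI)
    show "1 \<notin> gradient_ideal W10"
      unfolding gradient_ideal_W10 by (auto dest: ideal_gen2_value)
    show "\<exists>c. g - (\<Sum>a\<in>{..<3} \<times> {..<5}. const_germ (c a) * (case a of (i, j) \<Rightarrow> gx ^ i * gy ^ j)) \<in> gradient_ideal W10" for g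
      using W10_span[of g b] by (simp add: gradient_ideal_W10 span_mod_def)
    show "c a = 0" if "(\<Sum>a\<in>{..<3} \<times> {..<5}. const_germ (c a) * (case a of (i, j) \<Rightarrow> gx ^ i * gy ^ j)) \<in> gradient_ideal W10"
      "a \<in> {..<3} \<times> {..<5}" for c a
      using W10_independent that by (simp only: gradient_ideal_W10)
  qed simp
  then show ?thesis by (simp add: numeral_eq_enat)
qed

lemma milnor_W10_deformation:
  assumes "s \<noteq> 0" shows "milnor (W10_deformation s) = 14"
proof -
  let ?v = "gy ^ 2 + const_germ s * gx"
  have "milnor (W10_deformation s) = enat (card ({..<2 :: nat} \<times> {..<7 :: nat}))"
  proof (rule milnor_eqI)
    show "1 \<notin> gradient_ideal (W10_deformation s)"
      unfolding gradient_ideal_W10_deformation by (auto dest: ideal_gen2_value)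
    show "\<exists>c. g - (\<Sum>a\<in>{..<2} \<times> {..<7}. const_germ (c a) * (case a of (i, j) \<Rightarrow> ?v ^ i * gy ^ j))
        \<in> gradient_ideal (W10_deformation s)" for g
      using E14_span[OF assms, of g b] by (simp add: gradient_ideal_W10_deformation span_mod_def)
    show "c a = 0" if "(\<Sum>a\<in>{..<2} \<times> {..<7}. const_germ (c a) * (case a of (i, j) \<Rightarrow> ?v ^ i * gy ^ j))
        \<in> gradient_ideal (W10_deformation s)" "a \<in> {..<2} \<times> {..<7}" for c a
      using E14_independent[OF assms] that by (simp only: gradient_ideal_W10_deformation)
  qed simp
  then show ?thesis by (simp add: numeral_eq_enat)
qed

text \<open>The gradient ideal contains x^5 and y^7 for s = 0, and v^4 and y^9 otherwise. In the
  second case y = 0 leaves v = s x, so x vanishes as well.\<close>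

lemma W10_deformation_isolated: "\<forall>\<^sub>F z in at 0. grad (W10_deformation s) z \<noteq> 0"
proof (cases "s = 0")
  case True
  have hol: "holomorphic_germ W10" using holomorphic_germ_W10_deformation[of 0] by (simp add: W10_deformation_0)
  have mem: "germ_of (\<lambda>z :: complex^2. (z$1)^5) \<in> gradient_ideal W10"
    "germ_of (\<lambda>z :: complex^2. (z$2)^7) \<in> gradient_ideal W10"
    using W10_ideal_members(3,4)[of b]
    by (simp_all add: gradient_ideal_W10 germ_of_simps germ_of_power holomorphic_germ_intros)
  have "\<forall>\<^sub>F z in nhds 0. grad W10 z = 0 \<longrightarrow> (z$1)^5 = 0" "\<forall>\<^sub>F z in nhds 0. grad W10 z = 0 \<longrightarrow> (z$2)^7 = 0"
    by (rule gradient_ideal_vanishing[OF hol _ mem(1)] gradient_ideal_vanishing[OF hol _ mem(2)],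
        intro holomorphic_germ_intros)+
  then have "\<forall>\<^sub>F z in nhds 0. grad W10 z = 0 \<longrightarrow> z = 0"
    by eventually_elim (auto simp: vec_eq_iff forall_2)
  then show ?thesis using True by (auto simp: W10_deformation_0 eventually_at_filter elim: eventually_mono)
next
  case False
  note hol = holomorphic_germ_W10_deformation[of s]
  have mem: "germ_of (\<lambda>z :: complex^2. ((z$2)^2 + s * z$1)^4) \<in> gradient_ideal (W10_deformation s)"
    "germ_of (\<lambda>z :: complex^2. (z$2)^9) \<in> gradient_ideal (W10_deformation s)"
    using E14_ideal_members(5,7)[OF False, of b]
    by (simp_all add: gradient_ideal_W10_deformation germ_of_simps germ_of_power holomorphic_germ_intros)
  have "\<forall>\<^sub>F z in nhds 0. grad (W10_deformation s) z = 0 \<longrightarrow> ((z$2)^2 + s * z$1)^4 = 0"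
    "\<forall>\<^sub>F z in nhds 0. grad (W10_deformation s) z = 0 \<longrightarrow> (z$2)^9 = 0"
    by (rule gradient_ideal_vanishing[OF hol _ mem(1)] gradient_ideal_vanishing[OF hol _ mem(2)],
        intro holomorphic_germ_intros)+
  then have "\<forall>\<^sub>F z in nhds 0. grad (W10_deformation s) z = 0 \<longrightarrow> z = 0"
    by eventually_elim (use False in \<open>auto simp: vec_eq_iff forall_2\<close>)
  then show ?thesis by (auto simp: eventually_at_filter elim: eventually_mono)
qed

lemma holomorphic_germ_pair_W10_deformation: "holomorphic_germ_pair W10_deformation"
proof -
  let ?sc = "\<lambda>c (p :: complex \<times> (complex^2)). (c * fst p, c *s snd p)"
  have coord: "holomorphic_wrt ?sc (\<lambda>p. snd p $ i) UNIV" for i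
    unfolding holomorphic_wrt_def
    by (intro conjI ballI exI[of _ "\<lambda>p. snd p $ i"])
       (auto intro!: bounded_linear.has_derivative[OF bounded_linear_vec_nth] derivative_intros)
  have par: "holomorphic_wrt ?sc (\<lambda>p. fst p) UNIV"
    unfolding holomorphic_wrt_def
    by (intro conjI ballI exI[of _ fst]) (auto intro!: derivative_intros)
  have pow: "holomorphic_wrt ?sc (\<lambda>p. g p ^ k) UNIV" if "holomorphic_wrt ?sc g UNIV" for g k
    using that by (induction k) (simp_all add: holomorphic_wrt_const holomorphic_wrt_mult)
  have "holomorphic_wrt ?sc (\<lambda>p. W10_deformation (fst p) (snd p)) UNIV"
    unfolding W10_deformation_def
    by (intro holomorphic_wrt_add holomorphic_wrt_mult holomorphic_wrt_const pow coord par open_UNIV)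
  then show ?thesis unfolding holomorphic_germ_pair_def by (intro exI[of _ UNIV]) simp
qed

lemma isolated_singularity_W10: "isolated_singularity W10"
  unfolding isolated_singularity_def
  using holomorphic_germ_W10_deformation[of 0] W10_deformation_isolated[of 0]
  by (auto simp: W10_deformation_0 W10_def grad_def vec_eq_iff forall_2
      partial_deriv_W10_deformation[of 0, unfolded W10_deformation_0])

lemma deformation_W10: "deformation W10 W10_deformation"
  unfolding deformation_def
  using holomorphic_germ_pair_W10_deformation W10_deformation_isolated
  by (simp add: W10_deformation_0) (simp add: W10_deformation_def)

lemma milnor_jump_W10: "milnor_jump W10 = 1"
  unfolding milnor_jump_def
proof (rule Least_equality)
  have "has_jump W10 W10_deformation 1"
    unfolding has_jump_def
    by (intro exI[of _ 15] exI[of _ 14])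
       (auto simp: milnor_W10 milnor_W10_deformation numeral_eq_enat eventually_at_filter)
  then show "1 \<noteq> (0 :: int) \<and> (\<exists>f. deformation W10 f \<and> has_jump W10 f 1)"
    using deformation_W10 by auto
next
  fix j :: int assume "j \<noteq> 0 \<and> (\<exists>f. deformation W10 f \<and> has_jump W10 f j)"
  then obtain f m0 m where j: "j \<noteq> 0" and f: "deformation W10 f" and m: "milnor W10 = enat m0"
    "\<forall>\<^sub>F s in at 0. milnor (f s) = enat m" "j = int m0 - int m"
    by (auto simp: has_jump_def)
  have m0: "m0 = 15" using m(1) milnor_W10 by (simp add: numeral_eq_enat)
  have pair: "holomorphic_germ_pair f" and f0: "\<forall>\<^sub>F z in nhds 0. f 0 z = W10 z"
    using f by (auto simp: deformation_def)
  obtain r where r: "r > 0" "hol_family (ball 0 r) r (\<lambda>s x y. f s (point2 x y))"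
    using pair by (rule holomorphic_germ_pair_family)
  then have "holomorphic_germ (f 0)" by (intro hol_family_holomorphic_germ[OF r(2,1)]) simp
  then have "gradient_ideal (f 0) = gradient_ideal W10"
    using f0 holomorphic_germ_W10_deformation[of 0]
    by (simp add: gradient_ideal_2 W10_deformation_0 germ_of_partial_deriv_cong[of "f 0" W10])
  \<comment> \<open>The 15 box monomials span at s = 0, so j = 15 - m is nonnegative, and a nonzero
    integer j is then at least 1.\<close>
  then have "m \<le> card ({..<3 :: nat} \<times> {..<5 :: nat})"
    using W10_span[of _ b]
    by (intro milnor_upper_semicontinuous[OF pair _ _ m(2)]) (auto simp: gradient_ideal_W10)
  then show "1 \<le> j" using j m(3) m0 by simp
qed

end

theorem proposition3:
  shows "(\<forall>b::complex.
            isolated_singularity (\<lambda>z::complex^2. (z$1)^4 + (z$2)^6 + b * (z$1)^2 * (z$2)^4) \<and>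
            milnor_jump (\<lambda>z::complex^2. (z$1)^4 + (z$2)^6 + b * (z$1)^2 * (z$2)^4) = 1) \<and>
         milnor_jump (\<lambda>z::complex^2. (z$1)^4 + (z$2)^6) = 1"
proof -
  have eq: "W10 b = (\<lambda>z. (z$1)^4 + (z$2)^6 + b * (z$1)^2 * (z$2)^4)" for b
    by (simp add: fun_eq_iff W10_def)
  have eq0: "W10 0 = (\<lambda>z. (z$1)^4 + (z$2)^6)" by (simp add: fun_eq_iff W10_def)
  show ?thesis
    using isolated_singularity_W10 milnor_jump_W10 unfolding eq[symmetric] eq0[symmetric] by blast
qed

end
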